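(* Let $\mathfrak{g}=\mathfrak{so}(2n+1,\mathbb{C})$ and let $\mathfrak{p}$ be a standard parabolic subalgebra of type $(n_1,n_2,\dots,n_k)$. Let $p=(p_1,\dots,p_N)$ be the shape (row lengths) of the Z-diagram of type $(n_k;n_1,\dots,n_{k-1})$, and write its sequence of column lengths as $$p^t=(m_1,m_1,m_2,m_2,\dots,m_{s-1},m_{s-1},2m_s,m_{s+1},m_{s+1},\dots,m_k,m_k),$$ where $m_s=n_k$ and $(m_1,\dots,m_k)$ is the arrangement of $(n_1,\dots,n_k)$ for which this sequence is in descending order. Then the Richardson orbit $\mathcal{O}$ associated to $\mathfrak{p}$ has partition $$\mathbf{p}=[p_1,p_2,\dots,p_{2m_s},\,p_{2m_s+1}+1,\,p_{2m_s+2},\dots,p_N]_{B},$$ where $[\,\cdot\,]_B$ denotes the $B$-collapse (and $p_i=0$ for $i>N$).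
   Context: Lie algebra and parabolics. $\mathfrak{g}=\mathfrak{so}(2n+1,\mathbb{C})$ with simple roots $\Delta$: $\alpha_i=e_i-e_{i+1}$ ($1\le i\le n-1$), $\alpha_n=e_n$. For $I\subset\Delta$, $\mathfrak{p}=\mathfrak{p}_I=\mathfrak{l}\oplus\mathfrak{u}$ is the standard parabolic subalgebra whose Levi factor $\mathfrak{l}$ has root system generated by $I$, $\mathfrak{u}$ being its nilradical. It is of type $(n_1,\dots,n_k)$ if $n_1,\dots,n_{k-1}$ are positive integers, $n_k=n-\sum_{i<k}n_i\ge0$, and $\Delta\setminus I=\{\alpha_{p_1},\dots,\alpha_{p_{k-1}}\}$ with $p_t=n_1+\dots+n_t$ (these indices are unrelated to the row lengths $p_i$ in the claim). Richardson orbit: the unique nilpotent $G$-orbit in $\mathfrak{g}$ ($G$ a complex Lie group with Lie algebra $\mathfrak{g}$) meeting $\mathfrak{u}$ in an open dense subset of $\mathfrak{u}$. Nilpotent orbits of $\mathfrak{so}(2n+1,\mathbb{C})$ are in bijection, via Jordan type, with partitions of $2n+1$ of type $B_n$, i.e. those in which even parts occur with even multiplicity. Z-diagram. For integers $a_0\ge0$, $b_1,\dots,b_{k-1}>0$, the Z-diagram of type $(a_0;b_1,\dots,b_{k-1})$ is the Young diagram whose multiset of column lengths is $\{2a_0,b_1,b_1,\dots,b_{k-1},b_{k-1}\}$. Collapse. A partition $\mathbf{d}$ dominates $\mathbf{f}$ (of the same integer) if $\sum_{j\le l}d_j\ge\sum_{j\le l}f_j$ for all $l$. For a partition $\mathbf{d}$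 of $2n+1$, its $B$-collapse $\mathbf{d}_B$ is the unique largest partition of $2n+1$ of type $B_n$ dominated by $\mathbf{d}$. *)

theory Defs
  imports
    "HOL-Library.Multiset"
    "HOL-Analysis.Function_Topology"
    "Jordan_Normal_Form.Jordan_Normal_Form"
    "Jordan_Normal_Form.VS_Connect"
begin

section \<open>Matrix Lie algebras\<close>

abbreviation mat_space :: "nat \<Rightarrow> (complex, complex mat) module" where
  "mat_space N \<equiv> module_mat TYPE(complex) N N"

abbreviation mat_span :: "nat \<Rightarrow> complex mat set \<Rightarrow> complex mat set" where
  "mat_span N \<equiv> LinearCombinations.module.span class_ring (mat_space N)"

definition lie_bracket :: "complex mat \<Rightarrow> complex mat \<Rightarrow> complex mat" where
  "lie_bracket X Y = X * Y - Y * X"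

definition lie_ideal :: "nat \<Rightarrow> complex mat set \<Rightarrow> complex mat set \<Rightarrow> bool" where
  "lie_ideal N \<aa> \<pp> \<longleftrightarrow> VectorSpace.subspace class_ring \<aa> (mat_space N) \<and> \<aa> \<subseteq> \<pp> \<and>
     (\<forall>X\<in>\<pp>. \<forall>Y\<in>\<aa>. lie_bracket X Y \<in> \<aa>)"

primrec lower_central :: "nat \<Rightarrow> complex mat set \<Rightarrow> nat \<Rightarrow> complex mat set" where
  "lower_central N \<aa> 0 = \<aa>"
| "lower_central N \<aa> (Suc k) = mat_span N {lie_bracket X Y | X Y. X \<in> \<aa> \<and> Y \<in> lower_central N \<aa> k}"

definition lie_nilpotent :: "nat \<Rightarrow> complex mat set \<Rightarrow> bool" where
  "lie_nilpotent N \<aa> \<longleftrightarrow> (\<exists>k. lower_central N \<aa> k = {0\<^sub>m N N})"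

text \<open>The largest nilpotent ideal. In finite dimension a sum of two nilpotent ideals is again a
  nilpotent ideal, so the union of all nilpotent ideals is itself the largest one.\<close>

definition nilradical :: "nat \<Rightarrow> complex mat set \<Rightarrow> complex mat set" where
  "nilradical N \<pp> = \<Union>{\<aa>. lie_ideal N \<aa> \<pp> \<and> lie_nilpotent N \<aa>}"

text \<open>The Euclidean topology of the space of complex \<open>N\<close> by \<open>N\<close> matrices.\<close>

definition mat_topology :: "nat \<Rightarrow> complex mat topology" where
  "mat_topology N = pullback_topology (carrier_mat N N)
     (\<lambda>A. restrict (\<lambda>ij. A $$ ij) ({..<N} \<times> {..<N}))
     (product_topology (\<lambda>_. euclidean) ({..<N} \<times> {..<N}))"


section \<open>The Lie algebra of type B and its standard parabolics\<close>

text \<open>The orthogonal Lie algebra is realised with respect to the symmetric bilinear form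
  \<open>\<Sum>i. x\<^sub>i y\<^bsub>2n-i\<^esub>\<close> (indices from \<open>0\<close>), for which the diagonal matrices
  \<open>diag(h\<^sub>1,\<dots>,h\<^sub>n,0,-h\<^sub>n,\<dots>,-h\<^sub>1)\<close> form a Cartan subalgebra.\<close>

definition form_mat :: "nat \<Rightarrow> complex mat" where
  "form_mat n = mat (2*n+1) (2*n+1) (\<lambda>(i, j). if i + j = 2*n then 1 else 0)"

definition so_odd :: "nat \<Rightarrow> complex mat set" where
  "so_odd n = {X \<in> carrier_mat (2*n+1) (2*n+1).
     transpose_mat X * form_mat n + form_mat n * X = 0\<^sub>m (2*n+1) (2*n+1)}"

definition SO_odd :: "nat \<Rightarrow> complex mat set" where
  "SO_odd n = {g \<in> carrier_mat (2*n+1) (2*n+1).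
     transpose_mat g * form_mat n * g = form_mat n \<and> det g = 1}"

definition cartan :: "nat \<Rightarrow> complex mat set" where
  "cartan n = {H \<in> so_odd n. diagonal_mat H}"

text \<open>A vector \<open>w \<in> \<complex>\<^sup>n\<close> stands for the weight \<open>w\<^sub>1 e\<^sub>1 + \<dots> + w\<^sub>n e\<^sub>n\<close>, where \<open>e\<^sub>i\<close> is the
  \<open>i\<close>-th diagonal entry; vector and matrix entries are counted from \<open>0\<close>.\<close>

definition weight_value :: "nat \<Rightarrow> complex vec \<Rightarrow> complex mat \<Rightarrow> complex" where
  "weight_value n w H = (\<Sum>i<n. vec_index w i * H $$ (i, i))"

definition root_space :: "nat \<Rightarrow> complex vec \<Rightarrow> complex mat set" where
  "root_space n w = {X \<in> so_odd n. \<forall>H\<in>cartan n. lie_bracket H X = weight_value n w H \<cdot>\<^sub>m X}"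

definition roots :: "nat \<Rightarrow> complex vec set" where
  "roots n = {w \<in> carrier_vec n. w \<noteq> 0\<^sub>v n \<and> root_space n w \<noteq> {0\<^sub>m (2*n+1) (2*n+1)}}"

definition simple_root :: "nat \<Rightarrow> nat \<Rightarrow> complex vec" where
  "simple_root n i = (if i < n then unit_vec n (i - 1) - unit_vec n i else unit_vec n (n - 1))"

definition simple_roots :: "nat \<Rightarrow> complex vec set" where
  "simple_roots n = simple_root n ` {1..n}"

definition positive_roots :: "nat \<Rightarrow> complex vec set" where
  "positive_roots n = {w \<in> roots n. \<exists>c :: complex vec \<Rightarrow> nat.
     w = vec n (\<lambda>j. \<Sum>\<alpha>\<in>simple_roots n. of_nat (c \<alpha>) * vec_index \<alpha> j)}"

definition generated_roots :: "nat \<Rightarrow> complex vec set \<Rightarrow> complex vec set" where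
  "generated_roots n I = {w \<in> roots n. \<exists>c :: complex vec \<Rightarrow> int.
     w = vec n (\<lambda>j. \<Sum>\<alpha>\<in>I. of_int (c \<alpha>) * vec_index \<alpha> j)}"

definition levi_factor :: "nat \<Rightarrow> complex vec set \<Rightarrow> complex mat set" where
  "levi_factor n I = mat_span (2*n+1) (cartan n \<union> (\<Union>w\<in>generated_roots n I. root_space n w))"

definition standard_parabolic :: "nat \<Rightarrow> complex vec set \<Rightarrow> complex mat set" where
  "standard_parabolic n I =
     mat_span (2*n+1) (levi_factor n I \<union> (\<Union>w\<in>positive_roots n. root_space n w))"

definition parabolic_type :: "nat \<Rightarrow> complex vec set \<Rightarrow> nat list \<Rightarrow> bool" where
  "parabolic_type n I ns \<longleftrightarrow>
     ns \<noteq> [] \<and> (\<forall>x\<in>set (butlast ns). 0 < x) \<and> sum_list ns = n \<and> I \<subseteq> simple_roots n \<and>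
     simple_roots n - I = {simple_root n (sum_list (take t ns)) | t. 1 \<le> t \<and> t < length ns}"


section \<open>Richardson orbits and Jordan types\<close>

text \<open>The acting group is \<open>SO(2n+1,\<complex>)\<close>, which is connected with trivial centre, hence the adjoint
  group of its Lie algebra.\<close>

definition adjoint_orbit :: "nat \<Rightarrow> complex mat \<Rightarrow> complex mat set" where
  "adjoint_orbit n X = {g * X * h | g h. g \<in> SO_odd n \<and> h \<in> SO_odd n \<and> g * h = 1\<^sub>m (2*n+1)}"

definition nilpotent_orbit :: "nat \<Rightarrow> complex mat set \<Rightarrow> bool" where
  "nilpotent_orbit n \<O> \<longleftrightarrow> (\<exists>X\<in>so_odd n. (\<exists>k. X ^\<^sub>m k = 0\<^sub>m (2*n+1) (2*n+1)) \<and>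
     \<O> = adjoint_orbit n X)"

definition richardson_orbit :: "nat \<Rightarrow> complex mat set \<Rightarrow> complex mat set \<Rightarrow> bool" where
  "richardson_orbit n \<pp> \<O> \<longleftrightarrow> nilpotent_orbit n \<O> \<and>
     (let \<uu> = nilradical (2*n+1) \<pp>; T = subtopology (mat_topology (2*n+1)) \<uu>
      in openin T (\<O> \<inter> \<uu>) \<and> T closure_of (\<O> \<inter> \<uu>) = \<uu>)"

text \<open>\<open>d\<close> lists the sizes of the Jordan blocks, all of eigenvalue \<open>0\<close>.\<close>

definition orbit_partition :: "complex mat set \<Rightarrow> nat list \<Rightarrow> bool" where
  "orbit_partition \<O> d \<longleftrightarrow> (\<forall>X\<in>\<O>. jordan_nf X (map (\<lambda>r. (r, 0)) d))"


section \<open>Partitions\<close>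

definition partition_of :: "nat \<Rightarrow> nat list \<Rightarrow> bool" where
  "partition_of N d \<longleftrightarrow> sorted_wrt (\<ge>) d \<and> (\<forall>x\<in>set d. 0 < x) \<and> sum_list d = N"

text \<open>The \<open>i\<close>-th part, \<open>i \<ge> 1\<close>, which is \<open>0\<close> beyond the length of the partition.\<close>

definition part :: "nat list \<Rightarrow> nat \<Rightarrow> nat" where
  "part d i = (if 1 \<le> i \<and> i \<le> length d then d ! (i - 1) else 0)"

definition transpose_partition :: "nat list \<Rightarrow> nat list" where
  "transpose_partition d = map (\<lambda>i. length (filter (\<lambda>x. i \<le> x) d)) [1..<Suc (foldr max d 0)]"

definition dominates :: "nat list \<Rightarrow> nat list \<Rightarrow> bool" where
  "dominates d f \<longleftrightarrow> (\<forall>l. (\<Sum>j=1..l. part d j) \<ge> (\<Sum>j=1..l. part f j))"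

definition B_partition :: "nat \<Rightarrow> nat list \<Rightarrow> bool" where
  "B_partition n d \<longleftrightarrow> partition_of (2*n+1) d \<and> (\<forall>x. even x \<longrightarrow> even (count_list d x))"

definition B_collapse :: "nat \<Rightarrow> nat list \<Rightarrow> nat list" where
  "B_collapse n d = (THE f. B_partition n f \<and> dominates d f \<and>
     (\<forall>g. B_partition n g \<and> dominates d g \<longrightarrow> dominates f g))"

text \<open>\<open>p\<close> is the list of row lengths; the column of length \<open>2a\<close> is absent if \<open>a = 0\<close>.\<close>

definition Z_diagram :: "nat \<Rightarrow> nat list \<Rightarrow> nat list \<Rightarrow> bool" where
  "Z_diagram a bs p \<longleftrightarrow> partition_of (sum_list p) p \<and>
     mset (transpose_partition p) = filter_mset (\<lambda>c. 0 < c) ({#2*a#} + mset bs + mset bs)"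

text \<open>The sequence \<open>m\<^sub>1,m\<^sub>1,\<dots>,m\<^bsub>s-1\<^esub>,m\<^bsub>s-1\<^esub>,2m\<^sub>s,m\<^bsub>s+1\<^esub>,m\<^bsub>s+1\<^esub>,\<dots>,m\<^sub>k,m\<^sub>k\<close>,
  with \<open>m\<^sub>i = ms ! (i - 1)\<close>.\<close>

definition column_sequence :: "nat \<Rightarrow> nat list \<Rightarrow> nat list" where
  "column_sequence s ms =
     concat (map (\<lambda>i. if i = s then [2 * ms ! (i - 1)] else [ms ! (i - 1), ms ! (i - 1)])
       [1..<Suc (length ms)])"

end

theory Submission
  imports
    Defs
    "Jordan_Normal_Form.Jordan_Normal_Form_Existence"
    "HOL-Analysis.Abstract_Limits"
begin

text \<open>The nilradical \<open>\<uu>\<close> of the parabolic consists of the strictly block upper triangular elements of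
  \<open>so_odd n\<close>, with blocks of sizes \<open>n\<^sub>1, \<dots>, n\<^bsub>k-1\<^esub>, 2 n\<^sub>k + 1, n\<^bsub>k-1\<^esub>, \<dots>, n\<^sub>1\<close>. As the orbit
  meets \<open>\<uu>\<close> in a dense set and rank conditions are open, the rank of \<open>X\<^sup>i\<close> on the orbit is, for each
  \<open>i\<close>, the maximum over \<open>\<uu>\<close>; so the Jordan type of the orbit is determined by these maxima. Let
  \<open>P\<close> be the partition whose columns are the block sizes, and \<open>excess i d = \<Sum>\<^sub>j max (d\<^sub>j - i) 0\<close>, the rank
  of the \<open>i\<close>-th power of a nilpotent matrix of Jordan type \<open>d\<close>. Dominance is comparison of all
  \<open>excess i\<close>, and type B means that \<open>excess i\<close> is even for odd \<open>i\<close>, because \<open>X\<^sup>i\<close> is then skew for the form.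

  From above, block triangularity bounds the rank of \<open>X\<^sup>i\<close> by \<open>excess i P\<close>. From below, for each \<open>q\<close>
  choose a symmetric set \<open>U\<close> of basis vectors, at most \<open>q\<close> in each block. The shift by \<open>q\<close> places along
  \<open>U\<close>, with suitable signs, lies in \<open>\<uu>\<close> and its \<open>i\<close>-th power has rank \<open>card U - i q\<close>. Choosing \<open>q\<close>
  with \<open>P\<^sub>q \<ge> i \<ge> P\<^bsub>q+1\<^esub>\<close>, this is \<open>excess i P\<close>, or one less in cases where no
  partition of type B below \<open>P\<close> reaches \<open>excess i P\<close>. So the Jordan type dominates every partition
  of type B below \<open>P\<close>, which makes it the collapse of \<open>P\<close>.\<close>

section \<open>Rank certificates\<close>

text \<open>No element realising all maximal ranks at once is exhibited. Density hands each single
  lower bound to the orbit, and all elements of the orbit share one Jordan type \<open>d\<close>, so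
  a fresh test element may be taken for every pair \<open>i\<close>, \<open>q\<close>. Nor is the
  collapse computed or its existence assumed: \<open>d\<close> itself is shown to be the largest
  partition of type B below \<open>P\<close>. The unit that may be lost has a concrete origin. An
  entry of the shift that is its own mirror image under the antidiagonal would have to vanish in
  \<open>so_odd n\<close>; equal parity of \<open>card U\<close> and \<open>q\<close> excludes such
  entries. The block sizes cut off at \<open>q\<close> sum to a number of the parity of
  \<open>q\<close>, except when \<open>q\<close> is even and exceeds the size of the middle block.
  In that case one vector has to be given up. The nilradical needs an argument of its own, because
  it is the union of all nilpotent ideals: each of them must be shown to vanish on the diagonal
  blocks, Cartan part included.\<close>

definition rank_ge :: "'a :: field mat \<Rightarrow> nat \<Rightarrow> bool" where
  "rank_ge A r \<longleftrightarrow> (\<exists>L R. L \<in> carrier_mat r (dim_row A) \<and> R \<in> carrier_mat (dim_col A) r \<and>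
     L * A * R = 1\<^sub>m r)"

text \<open>Bounds from either side are all that the proof uses, so rank never appears as a number.
  With factorizations as witnesses, both predicates pass to products by associativity alone.\<close>

definition rank_le :: "'a :: field mat \<Rightarrow> nat \<Rightarrow> bool" where
  "rank_le A r \<longleftrightarrow> (\<exists>C F. C \<in> carrier_mat (dim_row A) r \<and> F \<in> carrier_mat r (dim_col A) \<and>
     A = C * F)"

lemma mult_mat_assoc:
  assumes "dim_col A = dim_row B" and "dim_col B = dim_row C"
  shows "A * B * C = A * (B * (C :: 'a :: semiring_0 mat))"
  using assms by (intro assoc_mult_mat[of _ "dim_row A" "dim_row B" _ "dim_row C" _ "dim_col C"]) auto

lemma rank_geI:
  assumes "L \<in> carrier_mat r (dim_row A)" "R \<in> carrier_mat (dim_col A) r" "L * A * R = 1\<^sub>m r"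
  shows "rank_ge A r"
  using assms unfolding rank_ge_def by blast

lemma rank_leI:
  assumes "C \<in> carrier_mat (dim_row A) r" "F \<in> carrier_mat r (dim_col A)" "A = C * F"
  shows "rank_le A r"
  using assms unfolding rank_le_def by blast

lemma det_zero_row:
  fixes A :: "'a :: field mat"
  assumes A: "A \<in> carrier_mat n n" and k: "k < n" and z: "\<And>j. j < n \<Longrightarrow> A $$ (k, j) = 0"
  shows "det A = 0"
proof -
  have "det A = (\<Sum>j<n. A $$ (k, j) * cofactor A k j)"
    using laplace_expansion_row[OF A k] .
  also have "\<dots> = 0" using z by simp
  finally show ?thesis .
qed

text \<open>Padding the two factors with zeros makes them square, and one of them has a zero row.\<close>

lemma one_mat_factor_dim:
  fixes A B :: "'a :: field mat"
  assumes A: "A \<in> carrier_mat r s" and B: "B \<in> carrier_mat s r" and AB: "A * B = 1\<^sub>m r"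
  shows "r \<le> s"
proof (rule ccontr)
  assume "\<not> r \<le> s"
  then have sr: "s < r" by simp
  define A' where "A' = mat r r (\<lambda>(i, j). if j < s then A $$ (i, j) else 0)"
  define B' where "B' = mat r r (\<lambda>(i, j). if i < s then B $$ (i, j) else 0)"
  have c: "A' \<in> carrier_mat r r" "B' \<in> carrier_mat r r" by (auto simp: A'_def B'_def)
  have "A' * B' = A * B"
  proof (rule eq_matI)
    fix i j assume ij: "i < dim_row (A * B)" "j < dim_col (A * B)"
    then have ij': "i < r" "j < r" using A B by auto
    have "(A' * B') $$ (i, j) = (\<Sum>k = 0..<r. A' $$ (i, k) * B' $$ (k, j))"
      using ij' c by (auto simp: scalar_prod_def)
    also have "\<dots> = (\<Sum>k = 0..<s. A $$ (i, k) * B $$ (k, j))"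
      by (rule sum.mono_neutral_cong_right) (use ij' sr in \<open>auto simp: A'_def B'_def\<close>)
    also have "\<dots> = (A * B) $$ (i, j)"
      using ij' A B by (auto simp: scalar_prod_def)
    finally show "(A' * B') $$ (i, j) = (A * B) $$ (i, j)" .
  qed (use A B c in auto)
  then have "det A' * det B' = 1" using AB c by (simp flip: det_mult)
  moreover have "det B' = 0"
    by (rule det_zero_row[OF c(2) sr]) (use sr in \<open>auto simp: B'_def\<close>)
  ultimately show False by simp
qed

text \<open>Inserting one certificate into the other factors \<open>1\<^sub>m r\<close> through
  dimension \<open>s\<close>.\<close>

lemma rank_ge_le:
  assumes "rank_ge A r" and "rank_le A s"
  shows "r \<le> s"
proof -
  from assms(1) obtain L R where
    L: "L \<in> carrier_mat r (dim_row A)" and R: "R \<in> carrier_mat (dim_col A) r"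
    and one: "L * A * R = 1\<^sub>m r"
    unfolding rank_ge_def by blast
  from assms(2) obtain C F where C: "C \<in> carrier_mat (dim_row A) s"
    and F: "F \<in> carrier_mat s (dim_col A)" and A: "A = C * F"
    unfolding rank_le_def by blast
  have "(L * C) * (F * R) = L * (C * F) * R"
    using L R C F by (simp add: mult_mat_assoc)
  also have "\<dots> = 1\<^sub>m r" using one unfolding A[symmetric] .
  finally show ?thesis by (rule one_mat_factor_dim[rotated 2]) (use L R C F in auto)
qed

lemma rank_ge_mult:
  assumes A: "A \<in> carrier_mat p q" and P: "P \<in> carrier_mat m p" and Q: "Q \<in> carrier_mat q l"
    and "rank_ge (P * A * Q) r"
  shows "rank_ge A r"
proof -
  from assms(4) A P Q obtain L R where
    L: "L \<in> carrier_mat r m" and R: "R \<in> carrier_mat l r" and one: "L * (P * A * Q) * R = 1\<^sub>m r"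
    unfolding rank_ge_def by auto
  have "(L * P) * A * (Q * R) = L * (P * A * Q) * R"
    using L R P Q A
    by (simp add: mult_mat_assoc)
  then show ?thesis using one L R P Q A by (intro rank_geI[of "L * P" _ _ "Q * R"]) auto
qed

lemma rank_le_mult:
  assumes A: "A \<in> carrier_mat p q" and P: "P \<in> carrier_mat m p" and Q: "Q \<in> carrier_mat q l"
    and "rank_le A r"
  shows "rank_le (P * A * Q) r"
proof -
  from assms(4) A obtain C F where
    C: "C \<in> carrier_mat p r" and F: "F \<in> carrier_mat r q" and eq: "A = C * F"
    unfolding rank_le_def by auto
  have "P * A * Q = (P * C) * (F * Q)"
    using C F P Q unfolding eq
    by (simp add: mult_mat_assoc)
  then show ?thesis using C F P Q by (intro rank_leI[of "P * C" _ _ "F * Q"]) auto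
qed

text \<open>The rows \<open>f a\<close> and columns \<open>g a\<close> cut out an invertible
  diagonal matrix: \<open>L\<close> selects the rows and divides by its entries, \<open>R\<close>
  selects the columns.\<close>

lemma rank_ge_monomial:
  fixes A :: "'a :: field mat"
  assumes f: "\<And>a. a < r \<Longrightarrow> f a < dim_row A" and g: "\<And>a. a < r \<Longrightarrow> g a < dim_col A"
    and val: "\<And>a b. a < r \<Longrightarrow> b < r \<Longrightarrow> A $$ (f a, g b) = (if a = b then c a else 0)"
    and c: "\<And>a. a < r \<Longrightarrow> c a \<noteq> 0"
  shows "rank_ge A r"
proof -
  define L where "L = mat r (dim_row A) (\<lambda>(a, x). if x = f a then 1 / c a else 0 :: 'a)"
  define R where "R = mat (dim_col A) r (\<lambda>(x, b). if x = g b then 1 else 0 :: 'a)"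
  have "L * A * R = 1\<^sub>m r"
  proof (rule eq_matI)
    fix a b assume "a < dim_row (1\<^sub>m r :: 'a mat)" "b < dim_col (1\<^sub>m r :: 'a mat)"
    then have ab: "a < r" "b < r" by auto
    have LA: "(L * A) $$ (a, y) = A $$ (f a, y) / c a" if "y < dim_col A" for y
    proof -
      have "(L * A) $$ (a, y) = (\<Sum>x = 0..<dim_row A. (if x = f a then A $$ (x, y) / c a else 0))"
        using ab that by (auto simp: L_def scalar_prod_def if_distrib[of "\<lambda>z. z * _"] if_distribR cong: if_cong intro!: sum.cong)
      then show ?thesis using f[OF ab(1)] by (simp add: sum.delta)
    qed
    have "(L * A * R) $$ (a, b) = (\<Sum>y = 0..<dim_col A. (L * A) $$ (a, y) * (if y = g b then 1 else 0))"
      using ab by (auto simp: R_def L_def scalar_prod_def)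
    also have "\<dots> = (L * A) $$ (a, g b)" using g[OF ab(2)] by (simp add: if_distrib[of "\<lambda>z. _ * z"] cong: if_cong)
    also have "\<dots> = A $$ (f a, g b) / c a" by (rule LA[OF g[OF ab(2)]])
    finally show "(L * A * R) $$ (a, b) = 1\<^sub>m r $$ (a, b)" using ab val[OF ab] c[OF ab(1)] by auto
  qed (auto simp: L_def R_def)
  then show ?thesis by (intro rank_geI[of L _ _ R]) (auto simp: L_def R_def)
qed

section \<open>Skew-symmetric matrices have even rank\<close>

text \<open>A rank factorization \<open>A = C * F\<close> can be made symmetric,
  \<open>A = C * M * C\<^sup>T\<close>, with \<open>M\<close> skew of size \<open>r\<close>.
  Invertibility of \<open>M\<close> follows from the lower rank bound, and
  \<open>det M = det M\<^sup>T = (-1)\<^sup>r * det M\<close> then forces \<open>r\<close> to be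
  even.\<close>

lemma skew_rank_even:
  fixes A :: "'a :: field_char_0 mat"
  assumes A: "A \<in> carrier_mat n n" and skew: "transpose_mat A = - A"
    and ge: "rank_ge A r" and le: "rank_le A r"
  shows "even r"
proof -
  from ge le A obtain L R C F where
    L: "L \<in> carrier_mat r n" and R: "R \<in> carrier_mat n r" and one: "L * A * R = 1\<^sub>m r"
    and C: "C \<in> carrier_mat n r" and F: "F \<in> carrier_mat r n" and eq: "A = C * F"
    unfolding rank_ge_def rank_le_def by auto
  let ?T = "\<lambda>X. transpose_mat X :: 'a mat"
  have "(L * C) * (F * R) = L * (C * F) * R"
    using L R C F by (simp add: mult_mat_assoc)
  then have lcfr: "(L * C) * (F * R) = 1\<^sub>m r" using eq one by simp
  have cf: "L * C \<in> carrier_mat r r" "F * R \<in> carrier_mat r r" using L R C F by auto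
  have frlc: "(F * R) * (L * C) = 1\<^sub>m r" by (rule mat_mult_left_right_inverse[OF cf lcfr])
  define L' where "L' = F * R * L"
  have L': "L' \<in> carrier_mat r n" using F R L by (simp add: L'_def)
  have L'C: "L' * C = 1\<^sub>m r"
    using frlc F R L C unfolding L'_def
    by (simp add: mult_mat_assoc)
  define M where "M = L' * A * ?T L'"
  have M: "M \<in> carrier_mat r r" using L' A by (simp add: M_def)
  \<comment> \<open>As \<open>L'\<close> is a left inverse of \<open>C\<close>, the product
    \<open>C * L'\<close> is a projection onto the column space of \<open>A\<close>; by skewness its
    transpose fixes \<open>A\<close> from the right.\<close>
  have CLA: "C * L' * A = A"
  proof -
    have "C * L' * A = C * (L' * C) * F" unfolding eq
      using C L' F by (simp add: mult_mat_assoc)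
    then show ?thesis using L'C C eq by simp
  qed
  have "A = - ?T A" unfolding skew by simp
  also have "\<dots> = - ?T (C * L' * A)" unfolding CLA ..
  also have "?T (C * L' * A) = ?T A * ?T (C * L')"
    by (rule transpose_mult[of _ n n _ n]) (use C L' A in auto)
  also have "- (?T A * ?T (C * L')) = A * ?T (C * L')"
    unfolding skew using A C L' by simp
  also have "\<dots> = A * (?T L' * ?T C)" using C L' by (simp add: transpose_mult[of _ n r _ n])
  finally have Aeq: "A = A * (?T L' * ?T C)" .
  have "A = C * L' * (A * (?T L' * ?T C))" using CLA Aeq by metis
  also have "\<dots> = C * M * ?T C" unfolding M_def using C L' A
    by (simp add: mult_mat_assoc)
  finally have ACMC: "A = C * M * ?T C" .
  have "1\<^sub>m r = L * (C * M * ?T C) * R" using one ACMC by simp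
  also have "\<dots> = (L * C) * M * (?T C * R)"
    using L R C M by (simp add: mult_mat_assoc)
  finally have "det ((L * C) * M * (?T C * R)) = 1" by (metis det_one)
  moreover have "det ((L * C) * M * (?T C * R)) = det (L * C) * det M * det (?T C * R)"
    using cf M C R by (simp add: det_mult[of _ r])
  ultimately have dM: "det M \<noteq> 0" by auto
  have "?T M = - M"
  proof -
    have "?T M = ?T (?T L') * (?T A * ?T L')"
      unfolding M_def using L' A
      by (simp add: transpose_mult[of "L' * A" r n _ r] transpose_mult[of L' r n A n] del: assoc_mult_mat)
    also have "\<dots> = - M" unfolding skew M_def using L' A
      by (simp add: mult_mat_assoc)
    finally show ?thesis .
  qed
  then have "det M = det (- M)" using det_transpose[OF M] by simp
  also have "- M = (- 1) \<cdot>\<^sub>m M" by auto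
  also have "det \<dots> = (- 1) ^ r * det M" using M by simp
  finally have "(- 1 :: 'a) ^ r = 1" using dM by simp
  then show ?thesis using one_neq_neg_one by (cases "even r") auto
qed

section \<open>Nilpotent Jordan forms\<close>

definition excess :: "nat \<Rightarrow> nat list \<Rightarrow> nat" where
  "excess i d = (\<Sum>x\<leftarrow>d. x - i)"

abbreviation nilpotent_jordan :: "nat list \<Rightarrow> 'a :: {zero,one} mat" where
  "nilpotent_jordan d \<equiv> jordan_matrix (map (\<lambda>r. (r, 0)) d)"

lemma rank_ge_diag_block:
  fixes A B :: "'a :: field mat"
  assumes A: "A \<in> carrier_mat n n" and B: "B \<in> carrier_mat m m"
    and "rank_ge A r" and "rank_ge B s"
  shows "rank_ge (four_block_mat A (0\<^sub>m n m) (0\<^sub>m m n) B) (r + s)"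
proof -
  from assms obtain L R where L: "L \<in> carrier_mat r n" and R: "R \<in> carrier_mat n r"
    and LR: "L * A * R = 1\<^sub>m r" unfolding rank_ge_def by blast
  from assms obtain L' R' where L': "L' \<in> carrier_mat s m" and R': "R' \<in> carrier_mat m s"
    and LR': "L' * B * R' = 1\<^sub>m s" unfolding rank_ge_def by blast
  let ?L = "four_block_mat L (0\<^sub>m r m) (0\<^sub>m s n) L'"
  let ?R = "four_block_mat R (0\<^sub>m n s) (0\<^sub>m m r) R'"
  let ?A = "four_block_mat A (0\<^sub>m n m) (0\<^sub>m m n) B"
  have "?L * ?A = four_block_mat (L * A) (0\<^sub>m r m) (0\<^sub>m s n) (L' * B)"
    by (subst mult_four_block_mat[OF L _ _ L' A _ _ B]) (use A B L L' in auto)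
  moreover have "four_block_mat (L * A) (0\<^sub>m r m) (0\<^sub>m s n) (L' * B) * ?R
      = four_block_mat (L * A * R) (0\<^sub>m r s) (0\<^sub>m s r) (L' * B * R')"
    by (subst mult_four_block_mat[of _ r n _ m _ s _ _ r _ s]) (use A B L L' R R' in auto)
  ultimately have "?L * ?A * ?R = 1\<^sub>m (r + s)"
    using LR LR' four_block_one_mat by metis
  then show ?thesis using A B L L' R R' by (intro rank_geI[of ?L _ _ ?R]) auto
qed

lemma rank_le_diag_block:
  fixes A B :: "'a :: field mat"
  assumes A: "A \<in> carrier_mat n n" and B: "B \<in> carrier_mat m m"
    and "rank_le A r" and "rank_le B s"
  shows "rank_le (four_block_mat A (0\<^sub>m n m) (0\<^sub>m m n) B) (r + s)"
proof -
  from assms obtain C F where C: "C \<in> carrier_mat n r" and F: "F \<in> carrier_mat r n"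
    and AC: "A = C * F" unfolding rank_le_def by blast
  from assms obtain C' F' where C': "C' \<in> carrier_mat m s" and F': "F' \<in> carrier_mat s m"
    and BC: "B = C' * F'" unfolding rank_le_def by blast
  let ?C = "four_block_mat C (0\<^sub>m n s) (0\<^sub>m m r) C'"
  let ?F = "four_block_mat F (0\<^sub>m r m) (0\<^sub>m s n) F'"
  have "?C * ?F = four_block_mat (C * F) (0\<^sub>m n m) (0\<^sub>m m n) (C' * F')"
    by (subst mult_four_block_mat[OF C _ _ C' F _ _ F']) (use C C' F F' in auto)
  then show ?thesis using A B C F C' F' AC BC by (intro rank_leI[of ?C _ _ ?F]) auto
qed

lemma rank_jordan_block_zero_pow:
  "rank_ge (jordan_block m (0 :: 'a :: field) ^\<^sub>m i) (m - i)"
  "rank_le (jordan_block m (0 :: 'a :: field) ^\<^sub>m i) (m - i)"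
proof -
  let ?J = "jordan_block m (0 :: 'a) ^\<^sub>m i"
  show "rank_ge ?J (m - i)"
    by (rule rank_ge_monomial[of _ "\<lambda>a. a" _ "\<lambda>a. a + i" "\<lambda>_. 1"])
      (auto simp: jordan_block_zero_pow)
  define C where "C = mat m (m - i) (\<lambda>(a, b). if a = b then 1 else 0 :: 'a)"
  define F where "F = mat (m - i) m (\<lambda>(a, b). if b = a + i then 1 else 0 :: 'a)"
  have "?J = C * F"
  proof (rule eq_matI)
    fix a b assume "a < dim_row (C * F)" "b < dim_col (C * F)"
    then have ab: "a < m" "b < m" by (auto simp: C_def F_def)
    have "(C * F) $$ (a, b) = (\<Sum>k = 0..<m - i. (if a = k then (if b = k + i then 1 else 0) else 0))"
      using ab by (subst index_mult_mat) (auto simp: C_def F_def scalar_prod_def simp del: sum.delta sum.delta' intro!: sum.cong)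
    also have "\<dots> = (if a < m - i \<and> b = a + i then 1 else 0)" by (simp add: sum.delta)
    finally show "?J $$ (a, b) = (C * F) $$ (a, b)"
      using ab by (auto simp: jordan_block_zero_pow)
  qed (auto simp: C_def F_def)
  then show "rank_le ?J (m - i)" by (rule rank_leI[rotated 2]) (auto simp: C_def F_def)
qed

lemma jordan_matrix_pow_Cons:
  "jordan_matrix ((m, a) # xs) ^\<^sub>m i = four_block_mat (jordan_block m a ^\<^sub>m i)
     (0\<^sub>m m (sum_list (map fst xs))) (0\<^sub>m (sum_list (map fst xs)) m) (jordan_matrix xs ^\<^sub>m i)"
  unfolding jordan_matrix_Cons by (rule pow_four_block_mat) auto

lemma rank_nilpotent_jordan_pow:
  "rank_ge (nilpotent_jordan d ^\<^sub>m i :: 'a :: field mat) (excess i d)"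
  "rank_le (nilpotent_jordan d ^\<^sub>m i :: 'a :: field mat) (excess i d)"
proof -
  have "rank_ge (nilpotent_jordan d ^\<^sub>m i :: 'a mat) (excess i d) \<and>
    rank_le (nilpotent_jordan d ^\<^sub>m i :: 'a mat) (excess i d)"
  proof (induction d)
    case Nil
    have "jordan_matrix [] ^\<^sub>m i = (1\<^sub>m 0 :: 'a mat)"
      by (rule eq_matI) (auto simp: pow_mat_dim)
    then show ?case
      by (auto simp: excess_def intro: rank_geI[of "1\<^sub>m 0" _ _ "1\<^sub>m 0"] rank_leI[of "1\<^sub>m 0" _ _ "1\<^sub>m 0"])
  next
    case (Cons x d)
    have c: "jordan_block x (0 :: 'a) ^\<^sub>m i \<in> carrier_mat x x"
      "(nilpotent_jordan d ^\<^sub>m i :: 'a mat) \<in> carrier_mat (sum_list d) (sum_list d)"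
      using pow_carrier_mat[OF jordan_matrix_carrier] by (auto simp: o_def)
    show ?case
      using rank_ge_diag_block[OF c rank_jordan_block_zero_pow(1)]
        rank_le_diag_block[OF c rank_jordan_block_zero_pow(2)] Cons
      by (simp add: jordan_matrix_pow_Cons o_def excess_def)
  qed
  then show "rank_ge (nilpotent_jordan d ^\<^sub>m i :: 'a mat) (excess i d)"
    "rank_le (nilpotent_jordan d ^\<^sub>m i :: 'a mat) (excess i d)" by auto
qed

section \<open>Reordering Jordan blocks\<close>

lemma similar_diag_block_swap:
  fixes A B :: "'a :: comm_ring_1 mat"
  assumes A: "A \<in> carrier_mat n n" and B: "B \<in> carrier_mat m m"
  shows "similar_mat (four_block_mat A (0\<^sub>m n m) (0\<^sub>m m n) B)
    (four_block_mat B (0\<^sub>m m n) (0\<^sub>m n m) A)"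
proof -
  let ?P = "four_block_mat (0\<^sub>m n m) (1\<^sub>m n) (1\<^sub>m m) (0\<^sub>m m n) :: 'a mat"
  let ?Q = "four_block_mat (0\<^sub>m m n) (1\<^sub>m m) (1\<^sub>m n) (0\<^sub>m n m) :: 'a mat"
  let ?B = "four_block_mat B (0\<^sub>m m n) (0\<^sub>m n m) A"
  have PQ: "?P * ?Q = 1\<^sub>m (n + m)"
    by (subst mult_four_block_mat[of _ n m _ n _ m _ _ n _ m]) (auto simp: four_block_one_mat)
  have QP: "?Q * ?P = 1\<^sub>m (n + m)"
    by (subst mult_four_block_mat[of _ m n _ m _ n _ _ m _ n])
      (auto simp: four_block_one_mat add.commute)
  have "?P * ?B = four_block_mat (0\<^sub>m n m) A B (0\<^sub>m m n)"
    by (subst mult_four_block_mat[of _ n m _ n _ m _ _ m _ n]) (use A B in auto)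
  moreover have "four_block_mat (0\<^sub>m n m) A B (0\<^sub>m m n) * ?Q
    = four_block_mat A (0\<^sub>m n m) (0\<^sub>m m n) B"
    by (subst mult_four_block_mat[of _ n m _ n _ m _ _ n _ m]) (use A B in auto)
  ultimately have "four_block_mat A (0\<^sub>m n m) (0\<^sub>m m n) B = ?P * ?B * ?Q" by simp
  then show ?thesis using A B PQ QP
    by (intro similar_matI[of _ _ ?P ?Q "n + m"]) (auto simp: add.commute)
qed

lemma jordan_matrix_append:
  "jordan_matrix (xs @ ys) = four_block_mat (jordan_matrix xs)
     (0\<^sub>m (sum_list (map fst xs)) (sum_list (map fst ys)))
     (0\<^sub>m (sum_list (map fst ys)) (sum_list (map fst xs))) (jordan_matrix ys)"
proof -
  have "diag_block_mat (map (\<lambda>(n, a). jordan_block n a) zs) = jordan_matrix zs"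
    for zs :: "(nat \<times> 'a) list"
    by (simp add: jordan_matrix_def)
  then show ?thesis
    unfolding jordan_matrix_def[of "xs @ ys"] by (simp add: diag_block_mat_append Let_def)
qed

lemma similar_jordan_append:
  fixes xs ys :: "(nat \<times> 'a :: field) list"
  assumes "similar_mat (jordan_matrix xs) (jordan_matrix xs')"
    and "similar_mat (jordan_matrix ys) (jordan_matrix ys')"
  shows "similar_mat (jordan_matrix (xs @ ys)) (jordan_matrix (xs' @ ys'))"
proof -
  have "sum_list (map fst zs) = sum_list (map fst zs')"
    if "similar_mat (jordan_matrix zs) (jordan_matrix zs')" for zs zs' :: "(nat \<times> 'a) list"
    using similar_matD[OF that] by (metis carrier_matD(1) insert_subset jordan_matrix_dim(1))
  note dims = this[OF assms(1)] this[OF assms(2)]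
  show ?thesis unfolding jordan_matrix_append
    using similar_mat_four_block_0_0[OF assms jordan_matrix_carrier jordan_matrix_carrier]
    by (simp add: dims)
qed

lemma similar_jordan_swap:
  "similar_mat (jordan_matrix (xs @ ys) :: 'a :: field mat) (jordan_matrix (ys @ xs))"
  unfolding jordan_matrix_append by (rule similar_diag_block_swap) simp_all

lemma similar_jordan_mset:
  "mset xs = mset ys \<Longrightarrow> similar_mat (jordan_matrix xs :: 'a :: field mat) (jordan_matrix ys)"
proof (induction xs arbitrary: ys)
  case Nil
  then show ?case by (auto intro: similar_mat_refl[OF jordan_matrix_carrier])
next
  case (Cons x xs)
  have refl: "similar_mat (jordan_matrix zs :: 'a mat) (jordan_matrix zs)" for zs
    by (rule similar_mat_refl[OF jordan_matrix_carrier])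
  have "x \<in> set ys" using Cons.prems by (metis list.set_intros(1) set_mset_mset)
  then obtain as bs where ys: "ys = as @ x # bs" by (meson split_list)
  then have "mset xs = mset (as @ bs)" using Cons.prems by simp
  note IH = Cons.IH[OF this]
  have "similar_mat (jordan_matrix (x # xs) :: 'a mat) (jordan_matrix ((x # as) @ bs))"
    using similar_jordan_append[OF refl[of "[x]"] IH] by simp
  moreover have "similar_mat (jordan_matrix ((x # as) @ bs) :: 'a mat) (jordan_matrix ((as @ [x]) @ bs))"
    using similar_jordan_append[OF similar_jordan_swap[of "[x]" as] refl] by simp
  ultimately show ?case using similar_mat_trans by (fastforce simp: ys)
qed

text \<open>The existence theorem returns the blocks in no particular order, whereas a partition is
  sorted.\<close>

lemma jordan_nf_mset:
  fixes A :: "'a :: field mat"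
  assumes "jordan_nf A xs" and "mset xs = mset ys"
  shows "jordan_nf A ys"
  using assms similar_jordan_mset[OF assms(2)] similar_mat_trans mset_eq_setD[OF assms(2)]
  unfolding jordan_nf_def by metis

lemma similar_mat_carrier:
  assumes "similar_mat A B" and "A \<in> carrier_mat n n"
  shows "B \<in> carrier_mat n n"
  using assms similar_mat_witD2(5) unfolding similar_mat_def by blast

text \<open>The characteristic polynomial is a power of the variable, and each Jordan block
  contributes a divisor of it, so every eigenvalue is \<open>0\<close>. Sorting the block sizes
  gives the partition.\<close>

lemma strictly_upper_triangular_jordan:
  fixes A :: "complex mat"
  assumes A: "A \<in> carrier_mat N N" and up: "\<And>i j. i < N \<Longrightarrow> j \<le> i \<Longrightarrow> A $$ (i, j) = 0"
  obtains d where "partition_of N d" and "jordan_nf A (map (\<lambda>r. (r, 0)) d)"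
proof -
  have ut: "upper_triangular A" using A up by auto
  have "diag_mat A = replicate N 0"
    using A up by (intro nth_equalityI) (auto simp: diag_mat_def)
  then have cp: "char_poly A = [:0, 1:] ^ N"
    using char_poly_upper_triangular[OF A ut] by simp
  also have "\<dots> = (\<Prod>a\<leftarrow>replicate N 0. [:- a, 1 :: complex:])" by (induction N) auto
  finally obtain xs where xs: "jordan_nf A xs" using jordan_nf_exists[OF A, of "replicate N 0"] by blast
  have zero: "a = 0" if mem: "(m, a) \<in> set xs" for m a
  proof -
    \<comment> \<open>An empty block would contribute the factor \<open>1\<close> and leave its
      eigenvalue undetermined.\<close>
    have "0 \<notin> fst ` set xs" using xs unfolding jordan_nf_def by blast
    then have "m \<noteq> 0" using imageI[OF mem, of fst] by (metis fst_conv)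
    obtain ys zs where "xs = ys @ (m, a) # zs" using split_list[OF mem] by blast
    then have "[:- a, 1:] ^ m dvd (\<Prod>(m, a)\<leftarrow>xs. [:- a, 1:] ^ m)" by simp
    also have "\<dots> = [:0, 1:] ^ N" using jordan_nf_char_poly[OF xs] cp by (rule trans[OF sym])
    finally have dvd: "[:- a, 1:] ^ m dvd [:0, 1:] ^ N" .
    have "[:- a, 1:] dvd [:- a, 1:] ^ m" using \<open>m \<noteq> 0\<close> by (simp add: dvd_power)
    then have "[:- a, 1:] dvd [:0, 1:] ^ N" using dvd by (rule dvd_trans)
    then have "poly ([:0, 1:] ^ N) a = 0" unfolding poly_eq_0_iff_dvd .
    then show ?thesis by simp
  qed
  define d where "d = rev (sort (map fst xs))"
  have "map (\<lambda>r. (r, 0)) (map fst xs) = map (\<lambda>x. x) xs"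
    unfolding map_map using zero by (intro map_cong) (auto simp: o_def)
  moreover have "mset (map (\<lambda>r. (r, 0 :: complex)) d) = mset (map (\<lambda>r. (r, 0)) (map fst xs))"
    unfolding mset_map by (simp add: d_def)
  ultimately have "mset xs = mset (map (\<lambda>r. (r, 0)) d)" by simp
  with xs have nf: "jordan_nf A (map (\<lambda>r. (r, 0)) d)" by (rule jordan_nf_mset)
  have "sum_list d = N"
  proof -
    have "similar_mat A (nilpotent_jordan d)" using nf unfolding jordan_nf_def by simp
    from similar_mat_carrier[OF this A] show ?thesis by (auto simp: o_def dest: carrier_matD)
  qed
  moreover have "0 \<notin> fst ` set (map (\<lambda>r. (r, 0 :: complex)) d)"
    using nf unfolding jordan_nf_def by (rule conjunct1)
  then have "\<forall>x\<in>set d. 0 < x" by (auto simp: image_image intro!: gr0I)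
  moreover have "sorted_wrt (\<ge>) d" by (simp add: d_def sorted_wrt_rev)
  ultimately show ?thesis using nf that by (simp add: partition_of_def)
qed

lemma jordan_nf_similar:
  fixes A B :: "'a :: field mat"
  assumes "jordan_nf A xs" and "similar_mat B A"
  shows "jordan_nf B xs"
  using assms similar_mat_trans unfolding jordan_nf_def by blast

lemma jordan_nf_rank_pow:
  fixes A :: "'a :: field mat"
  assumes A: "A \<in> carrier_mat N N" and nf: "jordan_nf A (map (\<lambda>r. (r, 0)) d)"
  shows "rank_ge (A ^\<^sub>m i) (excess i d)" and "rank_le (A ^\<^sub>m i) (excess i d)"
proof -
  obtain P Q where "similar_mat_wit A (nilpotent_jordan d) P Q"
    using nf unfolding jordan_nf_def similar_mat_def by blast
  note wit = similar_mat_wit_pow[OF this, of i]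
  have Ai: "A ^\<^sub>m i \<in> carrier_mat N N" using A by simp
  define K where "K = (nilpotent_jordan d ^\<^sub>m i :: 'a mat)"
  note w = similar_mat_witD2[OF Ai wit, folded K_def]
  note QP = w(2) and eq = w(3) and K = w(5) and P = w(6) and Q = w(7)
  show "rank_le (A ^\<^sub>m i) (excess i d)"
    unfolding eq by (rule rank_le_mult[OF K P Q]) (simp add: K_def rank_nilpotent_jordan_pow)
  have "Q * (P * K * Q) * P = (Q * P) * K * (Q * P)"
    using P Q K by (simp add: mult_mat_assoc)
  also have "\<dots> = K" using K by (simp add: QP)
  finally have "rank_ge (Q * A ^\<^sub>m i * P) (excess i d)"
    unfolding eq using rank_nilpotent_jordan_pow(1)[of d i, where ?'a = 'a] by (simp add: K_def)
  then show "rank_ge (A ^\<^sub>m i) (excess i d)" by (rule rank_ge_mult[OF Ai Q P])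
qed

section \<open>Dominance order and the B-collapse\<close>

lemma part_antimono:
  assumes "sorted_wrt (\<ge>) d" and "1 \<le> j" and "j \<le> k"
  shows "part d k \<le> part d j"
proof (cases "k \<le> length d \<and> j < k")
  case True
  then have "j - 1 < k - 1" "k - 1 < length d" using assms by auto
  from sorted_wrt_nth_less[OF assms(1) this] show ?thesis using assms True
    by (simp add: part_def)
next
  case False
  then show ?thesis using assms by (auto simp: part_def)
qed

lemma excess_eq_sum_part:
  assumes "length d \<le> L"
  shows "excess i d = (\<Sum>j = 1..L. part d j - i)"
proof -
  have "excess i d = (\<Sum>j = 0..<length d. d ! j - i)"
    by (simp add: excess_def sum_list_sum_nth)
  also have "\<dots> = (\<Sum>j = 1..length d. part d j - i)"
    by (rule sum.reindex_bij_witness[of _ "\<lambda>j. j - 1" Suc]) (auto simp: part_def)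
  also have "\<dots> = (\<Sum>j = 1..L. part d j - i)"
    by (rule sum.mono_neutral_left) (use assms in \<open>auto simp: part_def\<close>)
  finally show ?thesis .
qed

text \<open>Each of the first \<open>l\<close> parts is at most \<open>i\<close> plus its excess
  over \<open>i\<close>. With the equality case that follows, \<open>excess i d\<close> is, for
  sorted \<open>d\<close>, the maximum over \<open>l\<close> of the sum of the first
  \<open>l\<close> parts minus \<open>i * l\<close>. This duality turns dominance into a comparison
  of excesses.\<close>

lemma sum_part_le_excess: "(\<Sum>j = 1..l. part d j) \<le> excess i d + i * l"
proof -
  let ?L = "max l (length d)"
  have "(\<Sum>j = 1..l. part d j) \<le> (\<Sum>j = 1..l. (part d j - i) + i)"
    by (rule sum_mono) simp
  also have "\<dots> = (\<Sum>j = 1..l. part d j - i) + i * l" by (simp add: sum.distrib)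
  also have "(\<Sum>j = 1..l. part d j - i) \<le> (\<Sum>j = 1..?L. part d j - i)"
    by (rule sum_mono2) auto
  finally show ?thesis by (simp add: excess_eq_sum_part[of d ?L])
qed

lemma sum_part_eq_excess:
  assumes "\<And>j. 1 \<le> j \<Longrightarrow> j \<le> l \<Longrightarrow> i \<le> part d j" and "\<And>j. l < j \<Longrightarrow> part d j \<le> i"
  shows "(\<Sum>j = 1..l. part d j) = excess i d + i * l"
proof -
  let ?L = "max l (length d)"
  have "(\<Sum>j = 1..l. part d j) = (\<Sum>j = 1..l. (part d j - i) + i)"
    by (rule sum.cong) (use assms(1) in auto)
  also have "\<dots> = (\<Sum>j = 1..l. part d j - i) + i * l" by (simp add: sum.distrib)
  also have "(\<Sum>j = 1..l. part d j - i) = (\<Sum>j = 1..?L. part d j - i)"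
    by (rule sum.mono_neutral_left) (use assms(2) in auto)
  finally show ?thesis by (simp add: excess_eq_sum_part[of d ?L])
qed

lemma obtain_part_threshold:
  assumes "sorted_wrt (\<ge>) d"
  obtains l where "\<And>j. 1 \<le> j \<Longrightarrow> j \<le> l \<Longrightarrow> i < part d j" and "\<And>j. l < j \<Longrightarrow> part d j \<le> i"
proof -
  define l where "l = (LEAST l. part d (Suc l) \<le> i)"
  have "part d (Suc (length d)) \<le> i" by (simp add: part_def)
  then have l: "part d (Suc l) \<le> i" unfolding l_def by (rule LeastI)
  show ?thesis
  proof (rule that)
    fix j :: nat assume "1 \<le> j" "j \<le> l"
    then have "j - 1 < l" by simp
    from not_less_Least[OF this[unfolded l_def]] \<open>1 \<le> j\<close> show "i < part d j" by simp
  next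
    fix j assume "l < j"
    then show "part d j \<le> i" using part_antimono[OF assms, of "Suc l" j] l by simp
  qed
qed

text \<open>Each direction combines the inequality for one partition with the equality case for the
  other: given \<open>i\<close>, cut \<open>f\<close> at its threshold; given \<open>l\<close>, let
  \<open>i\<close> be the \<open>l\<close>-th part of \<open>d\<close>.\<close>

lemma dominates_iff_excess:
  assumes d: "sorted_wrt (\<ge>) d" and f: "sorted_wrt (\<ge>) f"
  shows "dominates d f \<longleftrightarrow> (\<forall>i. excess i f \<le> excess i d)"
proof (intro iffI allI)
  fix i assume dom: "dominates d f"
  obtain l where "\<And>j. 1 \<le> j \<Longrightarrow> j \<le> l \<Longrightarrow> i < part f j" "\<And>j. l < j \<Longrightarrow> part f j \<le> i"
    using obtain_part_threshold[OF f] by metis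
  then have "excess i f + i * l = (\<Sum>j = 1..l. part f j)"
    using sum_part_eq_excess[of l i f] by (simp add: less_imp_le)
  also have "\<dots> \<le> (\<Sum>j = 1..l. part d j)" using dom by (simp add: dominates_def)
  also have "\<dots> \<le> excess i d + i * l" by (rule sum_part_le_excess)
  finally show "excess i f \<le> excess i d" by simp
next
  assume le: "\<forall>i. excess i f \<le> excess i d"
  show "dominates d f" unfolding dominates_def
  proof
    fix l :: nat
    show "(\<Sum>j = 1..l. part f j) \<le> (\<Sum>j = 1..l. part d j)"
    proof (cases "l = 0")
      case False
      let ?i = "part d l"
      have "(\<Sum>j = 1..l. part f j) \<le> excess ?i f + ?i * l" by (rule sum_part_le_excess)
      also have "\<dots> \<le> excess ?i d + ?i * l" using le by simp
      also have "\<dots> = (\<Sum>j = 1..l. part d j)"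
        by (rule sum_part_eq_excess[symmetric]) (use False part_antimono[OF d] in auto)
      finally show ?thesis .
    qed simp
  qed
qed

lemma partition_eqI:
  assumes d: "partition_of N d" and f: "partition_of M f" and eq: "\<And>j. 1 \<le> j \<Longrightarrow> part d j = part f j"
  shows "d = f"
proof (rule nth_equalityI)
  have *: "length a \<le> length b"
    if "\<forall>x\<in>set a. 0 < x" "\<And>j. 1 \<le> j \<Longrightarrow> part a j = part b j" for a b
  proof (rule ccontr)
    assume "\<not> length a \<le> length b"
    then have "part a (length a) > 0" "part b (length a) = 0" "1 \<le> length a"
      using that(1) nth_mem[of "length a - 1" a] by (auto simp: part_def)
    with that(2)[of "length a"] show False by simp
  qed
  show len: "length d = length f"
    using *[of d f] *[of f d] d f eq by (simp add: partition_of_def)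
  fix i assume "i < length d"
  with eq[of "Suc i"] len show "d ! i = f ! i" by (simp add: part_def)
qed

lemma dominates_antisym:
  assumes "partition_of N d" and "partition_of M f" and "dominates d f" and "dominates f d"
  shows "d = f"
proof (rule partition_eqI[OF assms(1,2)])
  fix j :: nat assume "1 \<le> j"
  then obtain k where j: "j = Suc k" by (cases j) auto
  have "(\<Sum>j = 1..l. part d j) = (\<Sum>j = 1..l. part f j)" for l
    using assms(3,4) by (auto simp: dominates_def intro: antisym)
  from this[of k] this[of "Suc k"] show "part d j = part f j" by (simp add: j)
qed

text \<open>As a function of \<open>i\<close>, the truncated difference \<open>y - i\<close> is
  piecewise linear with its only kink at \<open>i = y\<close>, so the second difference counts the
  parts sitting at the kink.\<close>

lemma excess_second_difference:
  "excess x d + excess (Suc (Suc x)) d = 2 * excess (Suc x) d + count_list d (Suc x)"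
  by (induction d) (auto simp: excess_def)

lemma excess_convex: "2 * excess (Suc x) d \<le> excess x d + excess (Suc (Suc x)) d"
  using excess_second_difference[of x d] by simp

lemma excess_eq_0: "(\<And>x. x \<in> set d \<Longrightarrow> x \<le> i) \<Longrightarrow> excess i d = 0"
  by (auto simp: excess_def)

text \<open>Modulo 2, the excesses at \<open>i\<close> and \<open>i + 2\<close> differ by the
  multiplicity of the part \<open>i + 1\<close>, which is even when \<open>i\<close> is odd. Since
  the excess vanishes for large \<open>i\<close>, parity propagates downwards from there.\<close>

lemma B_partition_iff_excess:
  assumes "partition_of (2 * n + 1) d"
  shows "B_partition n d \<longleftrightarrow> (\<forall>i. odd i \<longrightarrow> even (excess i d))"
proof
  assume B: "B_partition n d"
  show "\<forall>i. odd i \<longrightarrow> even (excess i d)"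
  proof (intro allI impI)
    fix i :: nat assume "odd i"
    then show "even (excess i d)"
    proof (induction "Max (insert 0 (set d)) - i" arbitrary: i rule: less_induct)
      case less
      show ?case
      proof (cases "i < Max (insert 0 (set d))")
        case True
        then have "even (excess (Suc (Suc i)) d)" using less by simp
        moreover have "even (count_list d (Suc i))" using B less.prems by (simp add: B_partition_def)
        ultimately show ?thesis using excess_second_difference[of i d]
          by (metis even_add dvd_triv_left)
      next
        case False
        then have "excess i d = 0" by (intro excess_eq_0) (auto simp: not_less)
        then show ?thesis by simp
      qed
    qed
  qed
next
  assume *: "\<forall>i. odd i \<longrightarrow> even (excess i d)"
  have "even (count_list d x)" if "even x" for x
  proof (cases x)
    case 0
    then have "count_list d x = 0" using assms by (auto simp: partition_of_def count_list_0_iff)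
    then show ?thesis by simp
  next
    case (Suc y)
    then have "even (excess y d)" "even (excess (Suc (Suc y)) d)" using * that by auto
    then show ?thesis using excess_second_difference[of y d] Suc by (metis even_add dvd_triv_left)
  qed
  then show "B_partition n d" using assms by (simp add: B_partition_def)
qed

text \<open>Exhibiting the maximum settles the definite description, as antisymmetry of dominance
  leaves no second candidate.\<close>

lemma B_collapse_eqI:
  assumes "B_partition n d" and "dominates P d"
    and "\<And>g. B_partition n g \<Longrightarrow> dominates P g \<Longrightarrow> dominates d g"
  shows "B_collapse n P = d"
  unfolding B_collapse_def
proof (rule the_equality)
  fix f assume f: "B_partition n f \<and> dominates P f \<and> (\<forall>g. B_partition n g \<and> dominates P g \<longrightarrow> dominates f g)"
  then have "dominates f d" "dominates d f" using assms by auto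
  moreover have "partition_of (2 * n + 1) f" "partition_of (2 * n + 1) d"
    using f assms(1) by (simp_all add: B_partition_def)
  ultimately show "f = d" using dominates_antisym by metis
qed (use assms in simp)

text \<open>Boxes counted by columns: a column of length \<open>c\<close> meets the first
  \<open>q\<close> rows in \<open>min c q\<close> boxes.\<close>

lemma sum_part_columns:
  assumes "\<And>j. 1 \<le> j \<Longrightarrow> part P j = (if j \<le> 2 * m + 1 then 1 else 0) + 2 * length (filter (\<lambda>x. j \<le> x) ns)"
  shows "(\<Sum>j = 1..q. part P j) = min (2 * m + 1) q + 2 * (\<Sum>x\<leftarrow>ns. min x q)"
proof (induction q)
  case 0
  then show ?case by (induction ns) auto
next
  case (Suc q)
  have "(\<Sum>x\<leftarrow>ns. min x (Suc q)) = (\<Sum>x\<leftarrow>ns. min x q) + length (filter (\<lambda>x. Suc q \<le> x) ns)"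
    by (induction ns) auto
  then show ?case using Suc assms[of "Suc q"] by (auto simp: min_def)
qed

text \<open>The lower bound on \<open>excess i d\<close> with \<open>q\<close> the number of parts of \<open>P\<close> exceeding \<open>i\<close> only
  falls short of \<open>excess i P\<close> when the latter is odd, and then parity and convexity of \<open>excess\<close>
  cost every B-partition below \<open>P\<close> the same unit.\<close>

lemma B_collapse_criterion:
  assumes P: "partition_of (2 * n + 1) P"
    and cols: "\<And>j. 1 \<le> j \<Longrightarrow> part P j = (if j \<le> 2 * m + 1 then 1 else 0) + 2 * length (filter (\<lambda>x. j \<le> x) ns)"
    and d: "B_partition n d"
    and upper: "\<And>i. excess i d \<le> excess i P"
    and lower: "\<And>i q. odd q \<or> q \<le> 2 * m + 1 \<Longrightarrow> (\<Sum>j = 1..q. part P j) \<le> excess i d + i * q"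
    and lower': "\<And>i q. (\<Sum>j = 1..q. part P j) \<le> excess i d + i * q + 1"
  shows "B_collapse n P = d"
proof (rule B_collapse_eqI[OF d])
  have sP: "sorted_wrt (\<ge>) P" and sd: "sorted_wrt (\<ge>) d"
    using P d by (auto simp: partition_of_def B_partition_def)
  show "dominates P d" using upper by (simp add: dominates_iff_excess[OF sP sd])
  fix g assume g: "B_partition n g" and Pg: "dominates P g"
  have sg: "sorted_wrt (\<ge>) g" and g': "partition_of (2 * n + 1) g"
    using g by (auto simp: partition_of_def B_partition_def)
  have gP: "excess i g \<le> excess i P" for i using Pg by (simp add: dominates_iff_excess[OF sP sg])
  have gev: "even (excess i g)" if "odd i" for i using g that B_partition_iff_excess[OF g'] by simp
  show "dominates d g" unfolding dominates_iff_excess[OF sd sg]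
  proof
    fix i
    show "excess i g \<le> excess i d"
    proof (cases "i = 0")
      case True
      have "excess 0 d = 2 * n + 1" "excess 0 g = 2 * n + 1"
        using d g by (simp_all add: excess_def B_partition_def partition_of_def)
      then show ?thesis using True by simp
    next
      case i: False
      obtain l where l1: "\<And>j. 1 \<le> j \<Longrightarrow> j \<le> l \<Longrightarrow> i < part P j" and l2: "\<And>j. l < j \<Longrightarrow> part P j \<le> i"
        using obtain_part_threshold[OF sP] by metis
      have eq: "(\<Sum>j = 1..l. part P j) = excess i P + i * l"
        by (rule sum_part_eq_excess) (use l1 l2 in \<open>auto simp: less_imp_le\<close>)
      show ?thesis
      proof (cases "odd l \<or> l \<le> 2 * m + 1")
        case True
        then show ?thesis using lower[OF True, of i] eq gP[of i] by simp
      next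
        case F1: False
        then have ev: "even l" and big: "2 * m + 1 < l" by auto
        show ?thesis
        proof (cases "part P (Suc l) = i")
          case True
          \<comment> \<open>A further part equal to \<open>i\<close> may be counted without changing
            the excess, and \<open>Suc l\<close> is odd.\<close>
          have "(\<Sum>j = 1..Suc l. part P j) = excess i P + i * Suc l" using eq True by simp
          then show ?thesis using lower[of "Suc l" i] ev gP[of i] by simp
        next
          case False
          with l2[of "Suc l"] have lt: "part P (Suc l) < i" by simp
          have l3: "part P j < i" if "l < j" for j
            using part_antimono[OF sP, of "Suc l" j] that lt by simp
          have "excess i P + i * l = 2 * m + 1 + 2 * (\<Sum>x\<leftarrow>ns. min x l)"
            using eq sum_part_columns[OF cols] big by simp
          then have oddP: "odd (excess i P)" using ev
            by (metis even_add even_mult_iff odd_one dvd_triv_left)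
          have "excess i g < excess i P"
          proof (cases "odd i")
            case True
            then have "excess i g \<noteq> excess i P" using gev oddP by metis
            then show ?thesis using gP[of i] by simp
          next
            case ie: False
            \<comment> \<open>Parity constrains \<open>g\<close> only at the odd neighbours of
              \<open>i\<close>. As no part of \<open>P\<close> equals \<open>i\<close>, the excess
              of \<open>P\<close> is linear across the three values, with slope \<open>- l\<close>;
              \<open>g\<close> misses it by a unit at both ends, hence by convexity also in the
              middle.\<close>
            obtain k where k: "i = Suc k" using i by (cases i) auto
            have e1: "(\<Sum>j = 1..l. part P j) = excess k P + k * l"
              by (rule sum_part_eq_excess) (use l1 l3 k in \<open>force+\<close>)
            have e2: "(\<Sum>j = 1..l. part P j) = excess (Suc i) P + Suc i * l"
              by (rule sum_part_eq_excess) (use l1 l3 in \<open>force+\<close>)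
            have a: "excess k P = excess i P + l" and b: "excess (Suc i) P + l = excess i P"
              using eq e1 e2 k by auto
            have "odd (excess k P)" "odd (excess (Suc i) P)" using a b ev oddP
              by (metis even_add)+
            moreover have "even (excess k g)" "even (excess (Suc i) g)" using gev ie k by auto
            ultimately have "excess k g \<noteq> excess k P" "excess (Suc i) g \<noteq> excess (Suc i) P" by metis+
            then have "excess k g < excess k P" "excess (Suc i) g < excess (Suc i) P"
              using gP[of k] gP[of "Suc i"] by auto
            then show ?thesis using excess_convex[of k g] a b k by simp
          qed
          then show ?thesis using lower'[of l i] eq by simp
        qed
      qed
    qed
  qed
qed

section \<open>Rank bounds on a dense subset\<close>

text \<open>Sizes are demanded for every argument, also outside the topology, so that the formulas
  for products and determinants hold as equations between functions.\<close>

definition mat_continuous :: "'a topology \<Rightarrow> nat \<Rightarrow> nat \<Rightarrow> ('a \<Rightarrow> complex mat) \<Rightarrow> bool" where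
  "mat_continuous T r c F \<longleftrightarrow> (\<forall>X. F X \<in> carrier_mat r c) \<and>
     (\<forall>i<r. \<forall>j<c. continuous_map T euclidean (\<lambda>X. F X $$ (i, j)))"

lemma continuous_map_complex_mult:
  fixes f g :: "'a \<Rightarrow> complex"
  assumes "continuous_map T euclidean f" and "continuous_map T euclidean g"
  shows "continuous_map T euclidean (\<lambda>x. f x * g x)"
  using assms by (simp add: continuous_map_atin tendsto_mult)

lemma continuous_map_complex_prod:
  fixes f :: "'a \<Rightarrow> 'b \<Rightarrow> complex"
  assumes "\<And>i. i \<in> S \<Longrightarrow> continuous_map T euclidean (\<lambda>x. f x i)"
  shows "continuous_map T euclidean (\<lambda>x. prod (f x) S)"
  using assms by (simp add: continuous_map_atin tendsto_prod)

lemma mat_continuous_mult: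
  assumes "mat_continuous T r k F" and "mat_continuous T k c G"
  shows "mat_continuous T r c (\<lambda>X. F X * G X)"
proof -
  have "continuous_map T euclidean (\<lambda>X. (F X * G X) $$ (i, j))" if ij: "i < r" "j < c" for i j
  proof -
    have "(F X * G X) $$ (i, j) = (\<Sum>l = 0..<k. F X $$ (i, l) * G X $$ (l, j))" for X
    proof -
      have "F X \<in> carrier_mat r k" "G X \<in> carrier_mat k c" using assms by (auto simp: mat_continuous_def)
      then show ?thesis using ij by (simp add: scalar_prod_def)
    qed
    moreover have "continuous_map T euclidean (\<lambda>X. \<Sum>l = 0..<k. F X $$ (i, l) * G X $$ (l, j))"
      using assms ij by (intro continuous_map_sum continuous_map_complex_mult) (auto simp: mat_continuous_def)
    ultimately show ?thesis by simp
  qed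
  moreover have "F X * G X \<in> carrier_mat r c" for X
    using assms mult_carrier_mat unfolding mat_continuous_def by blast
  ultimately show ?thesis by (simp add: mat_continuous_def)
qed

lemma mat_continuous_const: "A \<in> carrier_mat r c \<Longrightarrow> mat_continuous T r c (\<lambda>_. A)"
  by (simp add: mat_continuous_def)

lemma mat_continuous_pow:
  assumes F: "mat_continuous T N N F"
  shows "mat_continuous T N N (\<lambda>X. F X ^\<^sub>m i)"
proof (induction i)
  case 0
  have "dim_row (F X) = N" for X using F by (auto simp: mat_continuous_def)
  then show ?case using mat_continuous_const[of "1\<^sub>m N" N N T] by simp
next
  case (Suc i)
  then show ?case using mat_continuous_mult[OF Suc F] by simp
qed

lemma continuous_map_det:
  assumes "mat_continuous T r r F"
  shows "continuous_map T euclidean (\<lambda>X. det (F X))"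
proof -
  have "det (F X) = (\<Sum>p | p permutes {0..<r}. signof p * (\<Prod>i = 0..<r. F X $$ (i, p i)))" for X
    using assms by (intro det_def') (simp add: mat_continuous_def)
  moreover have "continuous_map T euclidean
      (\<lambda>X. \<Sum>p | p permutes {0..<r}. signof p * (\<Prod>i = 0..<r. F X $$ (i, p i)))"
    using assms permutes_in_image
    by (intro continuous_map_sum continuous_map_complex_mult continuous_map_complex_prod finite_permutations)
      (auto simp: mat_continuous_def)
  ultimately show ?thesis by simp
qed

lemma continuous_map_mat_entry:
  assumes "i < N" and "j < N"
  shows "continuous_map (mat_topology N) euclidean (\<lambda>A. A $$ (i, j))"
proof -
  let ?S = "{..<N} \<times> {..<N}"
  have "continuous_map (product_topology (\<lambda>_. euclidean) ?S) euclidean (\<lambda>f. f (i, j) :: complex)"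
    using continuous_map_product_projection[of "(i, j)" ?S "\<lambda>_. euclidean"] assms by auto
  from continuous_map_pullback[OF this, of "carrier_mat N N" "\<lambda>A. restrict (\<lambda>ij. A $$ ij) ?S"]
  show ?thesis using assms by (simp add: mat_topology_def o_def)
qed

lemma det_nonzero_rank_ge:
  fixes A :: "complex mat"
  assumes A: "A \<in> carrier_mat N N" and L: "L \<in> carrier_mat r N" and R: "R \<in> carrier_mat N r"
    and det: "det (L * A * R) \<noteq> 0"
  shows "rank_ge A r"
proof -
  have LAR: "L * A * R \<in> carrier_mat r r" using A L R by simp
  from det_non_zero_imp_unit[OF this det, of "()"] obtain B where B: "B \<in> carrier_mat r r"
    and BA: "B * (L * A * R) = 1\<^sub>m r"
    unfolding Units_def ring_mat_def by auto
  then have "rank_ge (L * A * R) r"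
    using LAR by (intro rank_geI[of B _ _ "1\<^sub>m r"]) auto
  then show ?thesis by (rule rank_ge_mult[OF A L R])
qed

text \<open>The certificate of \<open>Y\<close> has determinant 1. The same \<open>L\<close> and
  \<open>R\<close> certify the rank wherever this determinant is nonzero, which is an open
  neighbourhood of \<open>Y\<close> and therefore meets \<open>S\<close>.\<close>

lemma closure_rank_ge:
  fixes U S :: "complex mat set"
  assumes U: "U \<subseteq> carrier_mat N N" and cl: "subtopology (mat_topology N) U closure_of S = U"
    and Y: "Y \<in> U" and rank: "rank_ge (Y ^\<^sub>m i) r"
  obtains X where "X \<in> S" and "X \<in> U" and "rank_ge (X ^\<^sub>m i) r"
proof -
  let ?T = "subtopology (mat_topology N) U"
  have Yi: "Y ^\<^sub>m i \<in> carrier_mat N N" using Y U by auto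
  obtain L R where L: "L \<in> carrier_mat r N" and R: "R \<in> carrier_mat N r"
    and one: "L * Y ^\<^sub>m i * R = 1\<^sub>m r"
    using rank unfolding rank_ge_def carrier_matD[OF Yi] by (elim exE conjE)
  text \<open>The identity is made total by cutting \<open>X\<close> down to a matrix of the right size.\<close>
  define F where "F = (\<lambda>X :: complex mat. mat N N (\<lambda>ij. X $$ ij))"
  have FX: "F X = X" if "X \<in> U" for X
  proof -
    have "X \<in> carrier_mat N N" using that U by (rule rev_subsetD)
    then show ?thesis unfolding F_def by (intro eq_matI) auto
  qed
  have "mat_continuous ?T N N F"
    using continuous_map_from_subtopology[OF continuous_map_mat_entry]
    by (auto simp: mat_continuous_def F_def)
  then have "mat_continuous ?T r r (\<lambda>X. L * F X ^\<^sub>m i * R)"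
    using mat_continuous_mult[OF mat_continuous_mult[OF mat_continuous_const[OF L] mat_continuous_pow]
        mat_continuous_const[OF R]] by blast
  then have "continuous_map ?T euclidean (\<lambda>X. det (L * F X ^\<^sub>m i * R))"
    by (rule continuous_map_det)
  then have opn: "openin ?T {X \<in> topspace ?T. det (L * F X ^\<^sub>m i * R) \<in> - {0}}" (is "openin _ ?V")
    by (rule openin_continuous_map_preimage) auto
  have Ycl: "Y \<in> ?T closure_of S" using Y unfolding cl .
  then have "Y \<in> topspace ?T" using closure_of_subset_topspace[of ?T S] by (rule rev_subsetD)
  moreover have "det (L * F Y ^\<^sub>m i * R) \<noteq> 0" unfolding FX[OF Y] one by simp
  ultimately have "Y \<in> ?V" by simp
  then have "\<exists>X. X \<in> S \<and> X \<in> ?V"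
    using Ycl[unfolded in_closure_of, THEN conjunct2, rule_format, of ?V] opn by simp
  then obtain X where X: "X \<in> S" "X \<in> topspace ?T" "det (L * F X ^\<^sub>m i * R) \<noteq> 0"
    by (elim exE conjE) simp
  then have XU: "X \<in> U" by simp
  have "X ^\<^sub>m i \<in> carrier_mat N N" using XU U by auto
  from det_nonzero_rank_ge[OF this L R X(3)[unfolded FX[OF XU]]]
  show ?thesis by (rule that[OF X(1) XU])
qed

section \<open>Linear subspaces of matrices\<close>

definition lin_closed :: "nat \<Rightarrow> complex mat set \<Rightarrow> bool" where
  "lin_closed N W \<longleftrightarrow> W \<subseteq> carrier_mat N N \<and> 0\<^sub>m N N \<in> W \<and>
     (\<forall>X\<in>W. \<forall>Y\<in>W. X + Y \<in> W) \<and> (\<forall>c. \<forall>X\<in>W. c \<cdot>\<^sub>m X \<in> W)"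

lemma lin_closedD:
  assumes "lin_closed N W"
  shows "X \<in> W \<Longrightarrow> X \<in> carrier_mat N N" "0\<^sub>m N N \<in> W"
    "X \<in> W \<Longrightarrow> Y \<in> W \<Longrightarrow> X + Y \<in> W" "X \<in> W \<Longrightarrow> c \<cdot>\<^sub>m X \<in> W"
  using assms by (auto simp: lin_closed_def)

lemma subspace_iff_lin_closed:
  "VectorSpace.subspace class_ring W (mat_space N) \<longleftrightarrow> lin_closed N W"
proof -
  interpret matrix_vs N N "TYPE(complex)" .
  have "module class_ring (mat_space N)" by (rule module_axioms)
  have v: "vectorspace class_ring (mat_space N)" by (rule vectorspace_axioms)
  show ?thesis
  proof
    assume "VectorSpace.subspace class_ring W (mat_space N)"
    then have "submodule class_ring W (mat_space N)" by (simp add: subspace_def)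
    then show "lin_closed N W"
      by (auto simp: submodule_def lin_closed_def module_mat_simps)
  next
    assume W: "lin_closed N W"
    have "submodule class_ring W (mat_space N)"
      unfolding submodule_def using W \<open>module class_ring (mat_space N)\<close>
      by (auto simp: lin_closed_def module_mat_simps)
    then show "VectorSpace.subspace class_ring W (mat_space N)" using v by (simp add: subspace_def)
  qed
qed

lemma lin_closed_span:
  assumes "S \<subseteq> carrier_mat N N"
  shows "lin_closed N (mat_span N S)"
proof -
  interpret matrix_vs N N "TYPE(complex)" .
  show ?thesis using span_is_subspace[of S] assms by (simp add: subspace_iff_lin_closed)
qed

lemma mat_span_superset:
  assumes "S \<subseteq> carrier_mat N N"
  shows "S \<subseteq> mat_span N S"
proof -
  interpret matrix_vs N N "TYPE(complex)" .
  show ?thesis using in_own_span[of S] assms by simp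
qed

lemma mat_span_least:
  assumes "lin_closed N W" and "S \<subseteq> W"
  shows "mat_span N S \<subseteq> W"
proof -
  interpret matrix_vs N N "TYPE(complex)" .
  have "submodule class_ring W (mat_space N)"
    using assms(1) subspace_iff_lin_closed[of W N] by (simp add: subspace_def)
  then show ?thesis using span_is_subset[OF assms(2)] by blast
qed

section \<open>The orthogonal Lie algebra in coordinates\<close>

lemma form_mat_carrier [simp]: "form_mat n \<in> carrier_mat (2*n+1) (2*n+1)"
  by (simp add: form_mat_def)

lemma form_mat_dim [simp]: "dim_row (form_mat n) = 2*n+1" "dim_col (form_mat n) = 2*n+1"
  by (simp_all add: form_mat_def)

lemma form_mat_mult_index:
  assumes X: "X \<in> carrier_mat (2*n+1) (2*n+1)" and i: "i \<le> 2*n" and j: "j \<le> 2*n"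
  shows "(form_mat n * X) $$ (i, j) = X $$ (2*n - i, j)"
    and "(transpose_mat X * form_mat n) $$ (i, j) = X $$ (2*n - j, i)"
proof -
  have "(form_mat n * X) $$ (i, j) = (\<Sum>k = 0..<2*n+1. (if i + k = 2*n then 1 else 0) * X $$ (k, j))"
    using X i j by (simp add: form_mat_def scalar_prod_def)
  also have "\<dots> = (\<Sum>k = 0..<2*n+1. if k = 2*n - i then X $$ (k, j) else 0)"
    by (rule sum.cong) (use i in auto)
  also have "\<dots> = X $$ (2*n - i, j)" by simp
  finally show "(form_mat n * X) $$ (i, j) = X $$ (2*n - i, j)" .
  have "(transpose_mat X * form_mat n) $$ (i, j)
      = (\<Sum>k = 0..<2*n+1. X $$ (k, i) * (if k + j = 2*n then 1 else 0))"
    using X i j by (simp add: form_mat_def scalar_prod_def)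
  also have "\<dots> = (\<Sum>k = 0..<2*n+1. if k = 2*n - j then X $$ (k, i) else 0)"
    by (rule sum.cong) (use j in auto)
  also have "\<dots> = X $$ (2*n - j, i)" by simp
  finally show "(transpose_mat X * form_mat n) $$ (i, j) = X $$ (2*n - j, i)" .
qed

text \<open>The form is the antidiagonal permutation matrix, so the defining equation is skewness
  under reflection in the antidiagonal.\<close>

lemma so_odd_iff:
  "X \<in> so_odd n \<longleftrightarrow> X \<in> carrier_mat (2*n+1) (2*n+1) \<and>
     (\<forall>i j. i \<le> 2*n \<longrightarrow> j \<le> 2*n \<longrightarrow> X $$ (2*n - j, 2*n - i) = - X $$ (i, j))"
proof (cases "X \<in> carrier_mat (2*n+1) (2*n+1)")
  case X: True
  let ?Z = "transpose_mat X * form_mat n + form_mat n * X"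
  have entry: "?Z $$ (i, j) = X $$ (2*n - j, i) + X $$ (2*n - i, j)" if "i \<le> 2*n" "j \<le> 2*n" for i j
    using X that form_mat_mult_index[OF X that] by simp
  have "?Z = 0\<^sub>m (2*n+1) (2*n+1) \<longleftrightarrow> (\<forall>i j. i \<le> 2*n \<longrightarrow> j \<le> 2*n \<longrightarrow> ?Z $$ (i, j) = 0)"
  proof
    assume "\<forall>i j. i \<le> 2*n \<longrightarrow> j \<le> 2*n \<longrightarrow> ?Z $$ (i, j) = 0"
    then show "?Z = 0\<^sub>m (2*n+1) (2*n+1)" using X by (intro eq_matI) auto
  qed simp
  also have "\<dots> \<longleftrightarrow> (\<forall>i j. i \<le> 2*n \<longrightarrow> j \<le> 2*n \<longrightarrow> X $$ (2*n - j, i) + X $$ (2*n - i, j) = 0)"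
    using entry by simp
  also have "\<dots> \<longleftrightarrow> (\<forall>i j. i \<le> 2*n \<longrightarrow> j \<le> 2*n \<longrightarrow> X $$ (2*n - j, 2*n - i) = - X $$ (i, j))"
    (is "?l \<longleftrightarrow> ?r")
  proof
    assume l: ?l
    show ?r
    proof (intro allI impI)
      fix i j assume ij: "i \<le> 2*n" "j \<le> 2*n"
      then have "X $$ (2*n - j, 2*n - i) + X $$ (i, j) = 0"
        using l[rule_format, of "2*n - i" j] by simp
      then show "X $$ (2*n - j, 2*n - i) = - X $$ (i, j)" using ij by (simp add: add_eq_0_iff2)
    qed
  next
    assume r: ?r
    show ?l
    proof (intro allI impI)
      fix i j assume ij: "i \<le> 2*n" "j \<le> 2*n"
      then show "X $$ (2*n - j, i) + X $$ (2*n - i, j) = 0"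
        using r[rule_format, of "2*n - i" j] by simp
    qed
  qed
  finally show ?thesis using X by (simp add: so_odd_def)
qed (simp add: so_odd_def)

lemma so_odd_carrier: "X \<in> so_odd n \<Longrightarrow> X \<in> carrier_mat (2*n+1) (2*n+1)"
  by (simp add: so_odd_def)

lemma so_oddD:
  "X \<in> so_odd n \<Longrightarrow> i \<le> 2*n \<Longrightarrow> j \<le> 2*n \<Longrightarrow> X $$ (2*n - j, 2*n - i) = - X $$ (i, j)"
  by (simp add: so_odd_iff)

lemma so_odd_antidiagonal:
  assumes "X \<in> so_odd n" and "i \<le> 2*n"
  shows "X $$ (i, 2*n - i) = 0"
proof -
  have "X $$ (i, 2*n - i) = - X $$ (i, 2*n - i)" using so_oddD[OF assms(1), of i "2*n - i"] assms by simp
  then show ?thesis by simp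
qed

lemma lin_closed_so_odd: "lin_closed (2*n+1) (so_odd n)"
  unfolding lin_closed_def
proof (intro conjI ballI allI)
  show "so_odd n \<subseteq> carrier_mat (2*n+1) (2*n+1)" using so_odd_carrier by auto
  show "0\<^sub>m (2*n+1) (2*n+1) \<in> so_odd n" by (simp add: so_odd_iff)
  fix X Y :: "complex mat" and c assume "X \<in> so_odd n" "Y \<in> so_odd n"
  then show "X + Y \<in> so_odd n" by (auto simp: so_odd_iff)
next
  fix X :: "complex mat" and c assume "X \<in> so_odd n"
  then show "c \<cdot>\<^sub>m X \<in> so_odd n" by (auto simp: so_odd_iff)
qed

lemma mult_mat_index:
  assumes "X \<in> carrier_mat (2*n+1) (2*n+1)" and "Y \<in> carrier_mat (2*n+1) (2*n+1)"
    and "i \<le> 2*n" and "j \<le> 2*n"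
  shows "(X * Y) $$ (i, j) = (\<Sum>k\<le>2*n. X $$ (i, k) * (Y $$ (k, j) :: complex))"
  using assms by (simp add: scalar_prod_def atLeast0LessThan lessThan_Suc_atMost)

lemma lie_bracket_carrier [simp]:
  "X \<in> carrier_mat N N \<Longrightarrow> Y \<in> carrier_mat N N \<Longrightarrow> lie_bracket X Y \<in> carrier_mat N N"
  unfolding lie_bracket_def by (intro minus_carrier_mat mult_carrier_mat[of _ N N])

lemma lie_bracket_index:
  assumes "X \<in> carrier_mat (2*n+1) (2*n+1)" and "Y \<in> carrier_mat (2*n+1) (2*n+1)"
    and "i \<le> 2*n" and "j \<le> 2*n"
  shows "lie_bracket X Y $$ (i, j) = (\<Sum>k\<le>2*n. X $$ (i, k) * Y $$ (k, j)) - (\<Sum>k\<le>2*n. Y $$ (i, k) * X $$ (k, j))"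
  using assms mult_mat_index[OF assms] mult_mat_index[OF assms(2,1,3,4)] by (simp add: lie_bracket_def)

lemma lie_bracket_so_odd:
  assumes X: "X \<in> so_odd n" and Y: "Y \<in> so_odd n"
  shows "lie_bracket X Y \<in> so_odd n"
  unfolding so_odd_iff
proof (intro conjI allI impI)
  note c = so_odd_carrier[OF X] so_odd_carrier[OF Y]
  show "lie_bracket X Y \<in> carrier_mat (2*n+1) (2*n+1)" using c by simp
  fix i j assume ij: "i \<le> 2*n" "j \<le> 2*n"
  \<comment> \<open>Reversing the summation index applies the reflection to both factors; the two
    signs cancel and the factors change places.\<close>
  have flip: "(\<Sum>k\<le>2*n. A $$ (2*n - j, k) * B $$ (k, 2*n - i)) = (\<Sum>k\<le>2*n. B $$ (i, k) * A $$ (k, j))"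
    if A: "A \<in> so_odd n" and B: "B \<in> so_odd n" for A B
  proof (rule sum.reindex_bij_witness[of _ "\<lambda>k. 2*n - k" "\<lambda>k. 2*n - k"])
    fix k assume "k \<in> {..2*n}"
    then show "B $$ (i, 2*n - k) * A $$ (2*n - k, j) = A $$ (2*n - j, k) * B $$ (k, 2*n - i)"
      using ij so_oddD[OF A, of "2*n - k" j] so_oddD[OF B, of i "2*n - k"] by simp
  qed auto
  show "lie_bracket X Y $$ (2*n - j, 2*n - i) = - lie_bracket X Y $$ (i, j)"
    using flip[OF X Y] flip[OF Y X] ij by (simp add: lie_bracket_index[OF c])
qed

section \<open>The Cartan subalgebra and its adjoint action\<close>

definition diag_elt :: "nat \<Rightarrow> (nat \<Rightarrow> complex) \<Rightarrow> complex mat" where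
  "diag_elt n h = mat (2*n+1) (2*n+1) (\<lambda>(i, j). if i = j then h i else 0)"

lemma diag_elt_cartan:
  assumes "\<And>i. i \<le> 2*n \<Longrightarrow> h (2*n - i) = - h i"
  shows "diag_elt n h \<in> cartan n"
proof -
  have "diag_elt n h $$ (2*n - j, 2*n - i) = - diag_elt n h $$ (i, j)" if "i \<le> 2*n" "j \<le> 2*n" for i j
    using that assms[of i] assms[of j] by (auto simp: diag_elt_def)
  then have "diag_elt n h \<in> so_odd n" unfolding so_odd_iff by (simp add: diag_elt_def)
  then show ?thesis by (auto simp: cartan_def diagonal_mat_def diag_elt_def)
qed

lemma diag_elt_index [simp]: "i \<le> 2*n \<Longrightarrow> diag_elt n h $$ (i, i) = h i"
  by (simp add: diag_elt_def)

lemma cartan_so_odd: "H \<in> cartan n \<Longrightarrow> H \<in> so_odd n"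
  by (simp add: cartan_def)

lemma cartanD:
  assumes "H \<in> cartan n" and "i \<le> 2*n"
  shows "H $$ (2*n - i, 2*n - i) = - H $$ (i, i)"
    and "j \<le> 2*n \<Longrightarrow> i \<noteq> j \<Longrightarrow> H $$ (i, j) = 0"
  using assms so_oddD[of H n i i] so_odd_carrier[of H n]
  by (auto simp: cartan_def diagonal_mat_def)

lemma lie_bracket_cartan:
  assumes H: "H \<in> cartan n" and X: "X \<in> carrier_mat (2*n+1) (2*n+1)"
    and ij: "i \<le> 2*n" "j \<le> 2*n"
  shows "lie_bracket H X $$ (i, j) = (H $$ (i, i) - H $$ (j, j)) * X $$ (i, j)"
proof -
  have c: "H \<in> carrier_mat (2*n+1) (2*n+1)" using H cartan_so_odd so_odd_carrier by blast
  have "(\<Sum>k\<le>2*n. H $$ (i, k) * X $$ (k, j)) = (\<Sum>k\<le>2*n. if k = i then H $$ (i, i) * X $$ (i, j) else 0)"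
    by (rule sum.cong) (use ij cartanD(2)[OF H ij(1)] in auto)
  moreover have "(\<Sum>k\<le>2*n. X $$ (i, k) * H $$ (k, j)) = (\<Sum>k\<le>2*n. if k = j then H $$ (j, j) * X $$ (i, j) else 0)"
    by (rule sum.cong) (use ij cartanD(2)[OF H] in auto)
  ultimately show ?thesis using ij by (simp add: lie_bracket_index[OF c X ij] algebra_simps)
qed

text \<open>Half the sum of the positive coroots. Every simple root takes the value 1 on it, and its
  diagonal entries are pairwise distinct.\<close>

definition height_elt :: "nat \<Rightarrow> complex mat" where
  "height_elt n = diag_elt n (\<lambda>i. of_nat n - of_nat i)"

lemma height_elt: "height_elt n \<in> cartan n"
  "i \<le> 2*n \<Longrightarrow> height_elt n $$ (i, i) = of_nat n - of_nat i"
  unfolding height_elt_def by (rule diag_elt_cartan) (auto simp: of_nat_diff)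

section \<open>Root vectors\<close>

text \<open>A matrix unit minus its mirror image. The two terms cancel for
  \<open>i + j = 2*n\<close>, and for \<open>i = j\<close> the matrix is diagonal.\<close>

definition root_vec :: "nat \<Rightarrow> nat \<Rightarrow> nat \<Rightarrow> complex mat" where
  "root_vec n i j = mat (2*n+1) (2*n+1) (\<lambda>(a, b).
     (if a = i \<and> b = j then 1 else 0) - (if a = 2*n - j \<and> b = 2*n - i then 1 else 0))"

text \<open>The coordinates of the weights of the standard representation, with \<open>e\<^bsub>2n-i\<^esub> = - e\<^sub>i\<close>.\<close>

definition std_weight :: "nat \<Rightarrow> nat \<Rightarrow> nat \<Rightarrow> complex" where
  "std_weight n i t = (if t = i then 1 else 0) - (if t = 2*n - i then 1 else 0)"

definition root_wt :: "nat \<Rightarrow> nat \<Rightarrow> nat \<Rightarrow> complex vec" where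
  "root_wt n i j = vec n (\<lambda>t. std_weight n i t - std_weight n j t)"

lemma root_vec_index [simp]:
  "a \<le> 2*n \<Longrightarrow> b \<le> 2*n \<Longrightarrow> root_vec n i j $$ (a, b) =
     (if a = i \<and> b = j then 1 else 0) - (if a = 2*n - j \<and> b = 2*n - i then 1 else 0)"
  by (simp add: root_vec_def)

lemma root_vec_carrier [simp]: "root_vec n i j \<in> carrier_mat (2*n+1) (2*n+1)"
  by (simp add: root_vec_def)

lemma root_vec_so_odd:
  assumes "i \<le> 2*n" and "j \<le> 2*n"
  shows "root_vec n i j \<in> so_odd n"
  unfolding so_odd_iff
proof (intro conjI allI impI)
  fix a b assume ab: "a \<le> 2*n" "b \<le> 2*n"
  have "2*n - b = i \<and> 2*n - a = j \<longleftrightarrow> a = 2*n - j \<and> b = 2*n - i"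
    "2*n - b = 2*n - j \<and> 2*n - a = 2*n - i \<longleftrightarrow> a = i \<and> b = j"
    using ab assms by auto
  then show "root_vec n i j $$ (2*n - b, 2*n - a) = - root_vec n i j $$ (a, b)"
    using ab by simp
qed (rule root_vec_carrier)

lemma sum_std_weight:
  assumes H: "H \<in> cartan n" and i: "i \<le> 2*n"
  shows "(\<Sum>t<n. std_weight n i t * H $$ (t, t)) = H $$ (i, i)"
proof -
  have "(\<Sum>t<n. std_weight n i t * H $$ (t, t))
      = (\<Sum>t<n. if t = i then H $$ (t, t) else 0) - (\<Sum>t<n. if t = 2*n - i then H $$ (t, t) else 0)"
    unfolding std_weight_def sum_subtractf[symmetric] by (rule sum.cong) auto
  also have "\<dots> = (if i < n then H $$ (i, i) else 0) - (if n < i then H $$ (2*n - i, 2*n - i) else 0)"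
    using i by auto
  also have "\<dots> = H $$ (i, i)" using cartanD(1)[OF H i] by (cases "i = n") (auto simp: not_less)
  finally show ?thesis .
qed

lemma weight_value_root_wt:
  assumes "H \<in> cartan n" and "i \<le> 2*n" and "j \<le> 2*n"
  shows "weight_value n (root_wt n i j) H = H $$ (i, i) - H $$ (j, j)"
  using sum_std_weight[OF assms(1,2)] sum_std_weight[OF assms(1,3)]
  by (simp add: weight_value_def root_wt_def left_diff_distrib sum_subtractf)

lemma root_vec_root_space:
  assumes ij: "i \<le> 2*n" "j \<le> 2*n"
  shows "root_vec n i j \<in> root_space n (root_wt n i j)"
  unfolding root_space_def
proof (intro CollectI conjI ballI)
  show "root_vec n i j \<in> so_odd n" by (rule root_vec_so_odd[OF ij])
  fix H assume H: "H \<in> cartan n"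
  have Hc: "H \<in> carrier_mat (2*n+1) (2*n+1)" using H cartan_so_odd so_odd_carrier by blast
  show "lie_bracket H (root_vec n i j) = weight_value n (root_wt n i j) H \<cdot>\<^sub>m root_vec n i j"
    unfolding weight_value_root_wt[OF H ij]
  proof (rule eq_matI)
    fix a b assume "a < dim_row ((H $$ (i, i) - H $$ (j, j)) \<cdot>\<^sub>m root_vec n i j)"
      "b < dim_col ((H $$ (i, i) - H $$ (j, j)) \<cdot>\<^sub>m root_vec n i j)"
    then have ab: "a \<le> 2*n" "b \<le> 2*n" by (auto simp: root_vec_def)
    show "lie_bracket H (root_vec n i j) $$ (a, b) = ((H $$ (i, i) - H $$ (j, j)) \<cdot>\<^sub>m root_vec n i j) $$ (a, b)"
      using ab ij cartanD(1)[OF H ij(1)] cartanD(1)[OF H ij(2)] root_vec_carrier[of n i j, THEN carrier_matD(1)]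
        root_vec_carrier[of n i j, THEN carrier_matD(2)]
      by (auto simp: lie_bracket_cartan[OF H root_vec_carrier ab])
  qed (use Hc in \<open>auto simp: lie_bracket_def root_vec_def\<close>)
qed

lemma root_wt_roots:
  assumes ij: "i \<le> 2*n" "j \<le> 2*n" and ne: "i \<noteq> j" "i + j \<noteq> 2*n"
  shows "root_wt n i j \<in> roots n"
  unfolding roots_def
proof (intro CollectI conjI)
  show "root_wt n i j \<in> carrier_vec n" by (simp add: root_wt_def)
  show "root_wt n i j \<noteq> 0\<^sub>v n"
  proof
    assume "root_wt n i j = 0\<^sub>v n"
    then have "weight_value n (root_wt n i j) (height_elt n) = 0" by (simp add: weight_value_def)
    then have "(of_nat j :: complex) = of_nat i" using ij by (simp add: weight_value_root_wt height_elt)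
    then show False using ne by simp
  qed
  have "root_vec n i j $$ (i, j) = 1" using ij ne by auto
  moreover have "0\<^sub>m (2*n+1) (2*n+1) $$ (i, j) = (0 :: complex)" using ij by simp
  ultimately have "root_vec n i j \<noteq> 0\<^sub>m (2*n+1) (2*n+1)" by (metis one_neq_zero)
  then show "root_space n (root_wt n i j) \<noteq> {0\<^sub>m (2*n+1) (2*n+1)}"
    using root_vec_root_space[OF ij] by auto
qed

section \<open>Roots in the basis of simple roots\<close>

lemma simple_root_eq:
  assumes "1 \<le> r" and "r \<le> n"
  shows "simple_root n r = root_wt n (r - 1) r"
  using assms by (intro eq_vecI) (auto simp: simple_root_def root_wt_def std_weight_def unit_vec_def)

lemma root_wt_reflect:
  assumes "n < r" and "r \<le> 2*n"
  shows "root_wt n (r - 1) r = root_wt n (2*n - r) (2*n + 1 - r)"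
  using assms by (intro eq_vecI) (auto simp: root_wt_def std_weight_def)

lemma simple_root_inj: "inj_on (simple_root n) {1..n}"
proof (rule linorder_inj_onI')
  fix r s assume rs: "r \<in> {1..n}" "s \<in> {1..n}" "r < s"
  then have "root_wt n (r - 1) r $ (r - 1) = 1" "root_wt n (s - 1) s $ (r - 1) = 0"
    by (auto simp: root_wt_def std_weight_def)
  then show "simple_root n r \<noteq> simple_root n s"
    using simple_root_eq[of r n] simple_root_eq[of s n] rs by (metis atLeastAtMost_iff zero_neq_one)
qed

text \<open>The coefficients of \<open>e\<^sub>i - e\<^sub>j\<close>, \<open>i \<le> j\<close>, in the basis of simple roots: the sum telescopes over
  the steps \<open>r - 1, r\<close> with \<open>i < r \<le> j\<close>, and steps beyond the middle are reflected.\<close>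

definition root_coeff :: "nat \<Rightarrow> nat \<Rightarrow> nat \<Rightarrow> nat \<Rightarrow> nat" where
  "root_coeff n i j s = (if i < s \<and> s \<le> j then 1 else 0) +
     (if i < 2*n + 1 - s \<and> 2*n + 1 - s \<le> j then 1 else 0)"

lemma root_wt_telescope:
  assumes "i \<le> j" and "j \<le> 2*n" and "t < n"
  shows "root_wt n i j $ t = (\<Sum>s = 1..n. of_nat (root_coeff n i j s) * simple_root n s $ t)"
proof -
  define a where "a r = root_wt n (r - 1) r $ t" for r
  have "root_wt n i j $ t = (\<Sum>r\<in>{i<..j}. a r)"
    using assms(1)
  proof (induction j rule: dec_induct)
    case (step k)
    then have "{i<..Suc k} = insert (Suc k) {i<..k}" by auto
    moreover have "root_wt n i (Suc k) $ t = root_wt n i k $ t + a (Suc k)"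
      using assms(3) by (simp add: a_def root_wt_def)
    ultimately show ?case using step.IH by (simp add: add.commute)
  qed (use assms(3) in \<open>simp add: root_wt_def\<close>)
  also have "\<dots> = (\<Sum>r\<in>{1..2*n}. if i < r \<and> r \<le> j then a r else 0)"
    by (rule sum.mono_neutral_cong_left) (use assms in auto)
  also have "\<dots> = (\<Sum>r\<in>{1..n}. if i < r \<and> r \<le> j then a r else 0)
      + (\<Sum>r\<in>{n<..2*n}. if i < r \<and> r \<le> j then a r else 0)"
  proof -
    have "{1..2*n} = {1..n} \<union> {n<..2*n}" by auto
    then show ?thesis by (simp only:) (rule sum.union_disjoint, auto)
  qed
  also have "(\<Sum>r\<in>{n<..2*n}. if i < r \<and> r \<le> j then a r else 0)
      = (\<Sum>s\<in>{1..n}. if i < 2*n + 1 - s \<and> 2*n + 1 - s \<le> j then a s else 0)"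
  proof (rule sum.reindex_bij_witness[of _ "\<lambda>s. 2*n + 1 - s" "\<lambda>r. 2*n + 1 - r"])
    fix r assume r: "r \<in> {n<..2*n}"
    then have "a (2*n + 1 - r) = a r"
      using root_wt_reflect[of n r] by (simp add: a_def)
    then show "(if i < 2*n + 1 - (2*n + 1 - r) \<and> 2*n + 1 - (2*n + 1 - r) \<le> j then a (2*n + 1 - r) else 0)
        = (if i < r \<and> r \<le> j then a r else 0)" using r by simp
  qed auto
  also have "(\<Sum>r\<in>{1..n}. if i < r \<and> r \<le> j then a r else 0)
      + (\<Sum>s\<in>{1..n}. if i < 2*n + 1 - s \<and> 2*n + 1 - s \<le> j then a s else 0)
      = (\<Sum>s = 1..n. of_nat (root_coeff n i j s) * simple_root n s $ t)"
    unfolding sum.distrib[symmetric]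
  proof (rule sum.cong)
    fix s assume "s \<in> {1..n}"
    then have "simple_root n s $ t = a s" by (simp add: simple_root_eq a_def)
    then show "(if i < s \<and> s \<le> j then a s else 0) + (if i < 2*n + 1 - s \<and> 2*n + 1 - s \<le> j then a s else 0)
        = of_nat (root_coeff n i j s) * simple_root n s $ t" by (simp add: root_coeff_def)
  qed simp
  finally show ?thesis .
qed

lemma sum_simple_roots:
  "(\<Sum>\<alpha>\<in>simple_roots n. f \<alpha>) = (\<Sum>s = 1..n. f (simple_root n s))"
  unfolding simple_roots_def sum.reindex[OF simple_root_inj] o_def ..

text \<open>Linear combinations of roots are indexed by the root vectors themselves, so the
  coefficients are carried over along the injection \<open>simple_root\<close>.\<close>

definition root_coeff_fun :: "nat \<Rightarrow> nat \<Rightarrow> nat \<Rightarrow> complex vec \<Rightarrow> nat" where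
  "root_coeff_fun n i j \<alpha> = root_coeff n i j (the_inv_into {1..n} (simple_root n) \<alpha>)"

lemma root_coeff_fun_simple_root:
  "s \<in> {1..n} \<Longrightarrow> root_coeff_fun n i j (simple_root n s) = root_coeff n i j s"
  unfolding root_coeff_fun_def the_inv_into_f_f[OF simple_root_inj] ..

lemma root_wt_combination:
  assumes "i \<le> j" and "j \<le> 2*n"
  shows "root_wt n i j = vec n (\<lambda>t. \<Sum>\<alpha>\<in>simple_roots n. of_nat (root_coeff_fun n i j \<alpha>) * vec_index \<alpha> t)"
proof (rule eq_vecI)
  fix t assume "t < dim_vec (vec n (\<lambda>t. \<Sum>\<alpha>\<in>simple_roots n. of_nat (root_coeff_fun n i j \<alpha>) * vec_index \<alpha> t))"
  then have t: "t < n" by simp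
  have "(\<Sum>\<alpha>\<in>simple_roots n. of_nat (root_coeff_fun n i j \<alpha>) * vec_index \<alpha> t)
      = (\<Sum>s = 1..n. of_nat (root_coeff n i j s) * simple_root n s $ t)"
    unfolding sum_simple_roots by (rule sum.cong) (simp_all add: root_coeff_fun_simple_root)
  then show "root_wt n i j $ t = vec n (\<lambda>t. \<Sum>\<alpha>\<in>simple_roots n. of_nat (root_coeff_fun n i j \<alpha>) * vec_index \<alpha> t) $ t"
    using root_wt_telescope[OF assms t] t by simp
qed (simp add: root_wt_def)

lemma root_wt_uminus: "root_wt n j i = - root_wt n i j"
  by (rule eq_vecI) (auto simp: root_wt_def)

lemma root_wt_positive:
  assumes "i < j" and "j \<le> 2*n" and "i + j \<noteq> 2*n"
  shows "root_wt n i j \<in> positive_roots n"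
  unfolding positive_roots_def
  using root_wt_roots[of i n j] root_wt_combination[of i j n] assms by auto

lemma weight_value_combination:
  assumes "finite S"
  shows "weight_value n (vec n (\<lambda>t. \<Sum>\<alpha>\<in>S. c \<alpha> * vec_index \<alpha> t)) H = (\<Sum>\<alpha>\<in>S. c \<alpha> * weight_value n \<alpha> H)"
proof -
  have "weight_value n (vec n (\<lambda>t. \<Sum>\<alpha>\<in>S. c \<alpha> * vec_index \<alpha> t)) H
      = (\<Sum>i<n. \<Sum>\<alpha>\<in>S. c \<alpha> * (vec_index \<alpha> i * H $$ (i, i)))"
    by (auto simp: weight_value_def sum_distrib_right mult.assoc intro!: sum.cong)
  also have "\<dots> = (\<Sum>\<alpha>\<in>S. \<Sum>i<n. c \<alpha> * (vec_index \<alpha> i * H $$ (i, i)))" by (rule sum.swap)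
  finally show ?thesis by (simp add: weight_value_def sum_distrib_left)
qed

lemma finite_simple_roots: "finite (simple_roots n)"
  by (simp add: simple_roots_def)

lemma weight_value_simple_root:
  assumes "H \<in> cartan n" and "1 \<le> r" and "r \<le> n"
  shows "weight_value n (simple_root n r) H = H $$ (r - 1, r - 1) - H $$ (r, r)"
  using assms by (simp add: simple_root_eq weight_value_root_wt)

text \<open>Bracketing with \<open>H\<close> multiplies the entry at \<open>(i, j)\<close> by
  \<open>H $$ (i, i) - H $$ (j, j)\<close>, so one nonzero entry reveals the weight.\<close>

lemma root_space_entry:
  assumes "X \<in> root_space n w" and H: "H \<in> cartan n" and ij: "i \<le> 2*n" "j \<le> 2*n"
    and "X $$ (i, j) \<noteq> 0"
  shows "H $$ (i, i) - H $$ (j, j) = weight_value n w H"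
proof -
  have X: "X \<in> carrier_mat (2*n+1) (2*n+1)" and "lie_bracket H X = weight_value n w H \<cdot>\<^sub>m X"
    using assms(1) H so_odd_carrier by (auto simp: root_space_def)
  then have "lie_bracket H X $$ (i, j) = weight_value n w H * X $$ (i, j)" using ij by simp
  then show ?thesis using lie_bracket_cartan[OF H X ij] assms(5) by simp
qed

text \<open>Subtracting \<open>X $$ (i, j)\<close> times the root vector clears that entry together
  with its mirror image and creates no new one. The two positions differ, because antidiagonal
  entries vanish. The induction is on the number of nonzero entries.\<close>

lemma lin_closed_root_vec:
  assumes W: "lin_closed (2*n+1) W" and X: "X \<in> so_odd n"
    and vec: "\<And>i j. i \<le> 2*n \<Longrightarrow> j \<le> 2*n \<Longrightarrow> X $$ (i, j) \<noteq> 0 \<Longrightarrow> root_vec n i j \<in> W"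
  shows "X \<in> W"
  using X vec
proof (induction "card {(i, j). i \<le> 2*n \<and> j \<le> 2*n \<and> X $$ (i, j) \<noteq> 0}" arbitrary: X rule: less_induct)
  case less
  let ?S = "\<lambda>X. {(i, j). i \<le> 2*n \<and> j \<le> 2*n \<and> X $$ (i, j) \<noteq> (0 :: complex)}"
  have fin: "finite (?S Z)" for Z by (rule finite_subset[of _ "{..2*n} \<times> {..2*n}"]) auto
  have Xc: "X \<in> carrier_mat (2*n+1) (2*n+1)" using less.prems so_odd_carrier by blast
  show ?case
  proof (cases "?S X = {}")
    case True
    then have "X = 0\<^sub>m (2*n+1) (2*n+1)" using Xc by (intro eq_matI) auto
    then show ?thesis using lin_closedD(2)[OF W] by simp
  next
    case False
    then obtain i j where ij: "i \<le> 2*n" "j \<le> 2*n" and nz: "X $$ (i, j) \<noteq> 0" by auto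
    then have anti: "j \<noteq> 2*n - i" using so_odd_antidiagonal[OF less.prems(1)] by auto
    define Y where "Y = X + (- X $$ (i, j)) \<cdot>\<^sub>m root_vec n i j"
    have Y: "Y \<in> so_odd n"
      unfolding Y_def using lin_closedD[OF lin_closed_so_odd] less.prems(1) root_vec_so_odd[OF ij] by blast
    have Yab: "Y $$ (a, b) = X $$ (a, b) - X $$ (i, j) * root_vec n i j $$ (a, b)"
      if "a \<le> 2*n" "b \<le> 2*n" for a b
      using that Xc root_vec_carrier[of n i j] unfolding Y_def
      by (subst index_add_mat) (auto simp: root_vec_def)
    have sub: "?S Y \<subseteq> ?S X"
      using Yab ij nz so_oddD[OF less.prems(1) ij] by (auto split: if_splits)
    have "(i, j) \<in> ?S X - ?S Y" using Yab[OF ij] ij nz anti by auto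
    then have "?S Y \<subset> ?S X" using sub by blast
    then have "card (?S Y) < card (?S X)" by (rule psubset_card_mono[OF fin])
    moreover have "root_vec n a b \<in> W" if "a \<le> 2*n" "b \<le> 2*n" "Y $$ (a, b) \<noteq> 0" for a b
      using that sub less.prems(2) by auto
    ultimately have YW: "Y \<in> W" using less.hyps[OF _ Y] by auto
    have "X = Y + X $$ (i, j) \<cdot>\<^sub>m root_vec n i j"
      using Xc root_vec_carrier[of n i j] unfolding Y_def by (intro eq_matI) auto
    then show ?thesis using lin_closedD[OF W] YW less.prems(2)[OF ij nz] by metis
  qed
qed

section \<open>The nilradical of a standard parabolic\<close>

definition block_nilpotent :: "nat \<Rightarrow> (nat \<Rightarrow> nat) \<Rightarrow> complex mat set" where
  "block_nilpotent n blk =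
     {X \<in> so_odd n. \<forall>i j. i \<le> 2*n \<longrightarrow> j \<le> 2*n \<longrightarrow> blk j \<le> blk i \<longrightarrow> X $$ (i, j) = 0}"

definition block_upper :: "nat \<Rightarrow> (nat \<Rightarrow> nat) \<Rightarrow> complex mat set" where
  "block_upper n blk =
     {X \<in> so_odd n. \<forall>i j. i \<le> 2*n \<longrightarrow> j \<le> 2*n \<longrightarrow> blk j < blk i \<longrightarrow> X $$ (i, j) = 0}"

text \<open>\<open>blk i\<close> numbers the block of the basis vector \<open>i\<close> in the flag stabilised by the parabolic.\<close>

locale parabolic_blocks =
  fixes n :: nat and I :: "complex vec set" and blk :: "nat \<Rightarrow> nat" and K :: nat
  assumes I: "I \<subseteq> simple_roots n"
    and mono: "i \<le> j \<Longrightarrow> j \<le> 2*n \<Longrightarrow> blk i \<le> blk j"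
    and refl: "i \<le> 2*n \<Longrightarrow> blk (2*n - i) + blk i = K"
    and cut: "1 \<le> r \<Longrightarrow> r \<le> n \<Longrightarrow> simple_root n r \<in> I \<longleftrightarrow> blk (r - 1) = blk r"

lemma lin_closed_block_upper: "lin_closed (2*n+1) (block_upper n blk)"
  unfolding lin_closed_def
proof (intro conjI ballI allI)
  note so = lin_closedD[OF lin_closed_so_odd]
  show "block_upper n blk \<subseteq> carrier_mat (2*n+1) (2*n+1)"
    using so(1) unfolding block_upper_def by blast
  show "0\<^sub>m (2*n+1) (2*n+1) \<in> block_upper n blk" using so(2) by (simp add: block_upper_def)
  fix X assume X: "X \<in> block_upper n blk"
  then have Xc: "X \<in> carrier_mat (2*n+1) (2*n+1)" using so(1) unfolding block_upper_def by blast
  show "c \<cdot>\<^sub>m X \<in> block_upper n blk" for c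
    using X Xc so(4)[of X n c] by (simp add: block_upper_def)
  fix Y assume Y: "Y \<in> block_upper n blk"
  then have Yc: "Y \<in> carrier_mat (2*n+1) (2*n+1)" using so(1) unfolding block_upper_def by blast
  show "X + Y \<in> block_upper n blk"
    using X Y Xc Yc so(3)[of X n Y] by (simp add: block_upper_def)
qed

lemma lin_closed_block_nilpotent: "lin_closed (2*n+1) (block_nilpotent n blk)"
  unfolding lin_closed_def
proof (intro conjI ballI allI)
  note so = lin_closedD[OF lin_closed_so_odd]
  show "block_nilpotent n blk \<subseteq> carrier_mat (2*n+1) (2*n+1)"
    using so(1) unfolding block_nilpotent_def by blast
  show "0\<^sub>m (2*n+1) (2*n+1) \<in> block_nilpotent n blk" using so(2) by (simp add: block_nilpotent_def)
  fix X assume X: "X \<in> block_nilpotent n blk"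
  then have Xc: "X \<in> carrier_mat (2*n+1) (2*n+1)" using so(1) unfolding block_nilpotent_def by blast
  show "c \<cdot>\<^sub>m X \<in> block_nilpotent n blk" for c
    using X Xc so(4)[of X n c] by (simp add: block_nilpotent_def)
  fix Y assume Y: "Y \<in> block_nilpotent n blk"
  then have Yc: "Y \<in> carrier_mat (2*n+1) (2*n+1)" using so(1) unfolding block_nilpotent_def by blast
  show "X + Y \<in> block_nilpotent n blk"
    using X Y Xc Yc so(3)[of X n Y] by (simp add: block_nilpotent_def)
qed

lemma lin_closed_lower_central:
  assumes "lin_closed N \<aa>"
  shows "lin_closed N (lower_central N \<aa> k)"
proof (induction k)
  case 0
  then show ?case using assms by simp
next
  case (Suc k)
  have "{lie_bracket X Y | X Y. X \<in> \<aa> \<and> Y \<in> lower_central N \<aa> k} \<subseteq> carrier_mat N N"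
    using lin_closedD(1)[OF assms] lin_closedD(1)[OF Suc] by auto
  then show ?case unfolding lower_central.simps by (rule lin_closed_span)
qed

text \<open>Up to a nonzero scalar \<open>F\<close> equals its bracket with \<open>H\<close>. So it
  lies in the ideal, and by the same equation it then reappears in every term of the lower central
  series.\<close>

lemma nilpotent_ideal_no_eigenvector:
  assumes ideal: "lie_ideal N \<aa> \<pp>" and nil: "lie_nilpotent N \<aa>" and H: "H \<in> \<aa>" and F: "F \<in> \<pp>" "F \<in> carrier_mat N N"
    and eig: "lie_bracket H F = c \<cdot>\<^sub>m F" and c: "c \<noteq> 0"
  shows "F = 0\<^sub>m N N"
proof -
  have a: "lin_closed N \<aa>" using ideal by (simp add: lie_ideal_def subspace_iff_lin_closed)
  have Hc: "H \<in> carrier_mat N N" using H lin_closedD(1)[OF a] by simp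
  have scale: "(1 / c) \<cdot>\<^sub>m (c \<cdot>\<^sub>m F) = F" using F c by (intro eq_matI) auto
  have "lie_bracket F H \<in> \<aa>" using ideal H F by (simp add: lie_ideal_def)
  also have "lie_bracket F H = (- 1) \<cdot>\<^sub>m lie_bracket H F"
    using F Hc unfolding lie_bracket_def by (intro eq_matI) auto
  finally have "(- 1) \<cdot>\<^sub>m (c \<cdot>\<^sub>m F) \<in> \<aa>" by (simp add: eig)
  then have "(- (1 / c)) \<cdot>\<^sub>m ((- 1) \<cdot>\<^sub>m (c \<cdot>\<^sub>m F)) \<in> \<aa>" using lin_closedD(4)[OF a] by blast
  also have "(- (1 / c)) \<cdot>\<^sub>m ((- 1) \<cdot>\<^sub>m (c \<cdot>\<^sub>m F)) = F" using F c by (intro eq_matI) auto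
  finally have Fa: "F \<in> \<aa>" .
  have "F \<in> lower_central N \<aa> k" for k
  proof (induction k)
    case (Suc k)
    let ?S = "{lie_bracket X Y | X Y. X \<in> \<aa> \<and> Y \<in> lower_central N \<aa> k}"
    have S: "?S \<subseteq> carrier_mat N N"
      using lin_closedD(1)[OF a] lin_closedD(1)[OF lin_closed_lower_central[OF a]] by auto
    have "lie_bracket H F \<in> ?S" using H Suc by blast
    then have "c \<cdot>\<^sub>m F \<in> lower_central N \<aa> (Suc k)"
      using mat_span_superset[OF S] eig by auto
    then show ?case using lin_closedD(4)[OF lin_closed_lower_central[OF a], of "c \<cdot>\<^sub>m F" "Suc k" "1 / c"]
      unfolding scale by simp
  qed (simp add: Fa)
  then show ?thesis using nil unfolding lie_nilpotent_def by (metis singletonD)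
qed

context parabolic_blocks
begin

lemma generators_carrier:
  "cartan n \<union> (\<Union>w\<in>generated_roots n I. root_space n w) \<subseteq> carrier_mat (2*n+1) (2*n+1)"
  "levi_factor n I \<union> (\<Union>w\<in>positive_roots n. root_space n w) \<subseteq> carrier_mat (2*n+1) (2*n+1)"
proof -
  show 1: "cartan n \<union> (\<Union>w\<in>generated_roots n I. root_space n w) \<subseteq> carrier_mat (2*n+1) (2*n+1)"
    using so_odd_carrier cartan_so_odd by (fastforce simp: root_space_def)
  have "levi_factor n I \<subseteq> carrier_mat (2*n+1) (2*n+1)"
    unfolding levi_factor_def using lin_closed_span[OF 1] by (simp add: lin_closed_def)
  moreover have "(\<Union>w\<in>positive_roots n. root_space n w) \<subseteq> carrier_mat (2*n+1) (2*n+1)"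
    using so_odd_carrier by (fastforce simp: root_space_def)
  ultimately show "levi_factor n I \<union> (\<Union>w\<in>positive_roots n. root_space n w) \<subseteq> carrier_mat (2*n+1) (2*n+1)"
    by blast
qed

lemma lin_closed_parabolic: "lin_closed (2*n+1) (standard_parabolic n I)"
  unfolding standard_parabolic_def by (rule lin_closed_span[OF generators_carrier(2)])

lemma levi_subset_parabolic: "levi_factor n I \<subseteq> standard_parabolic n I"
  unfolding standard_parabolic_def using mat_span_superset[OF generators_carrier(2)] by blast

lemma cartan_subset_parabolic: "cartan n \<subseteq> standard_parabolic n I"
  using mat_span_superset[OF generators_carrier(1)] levi_subset_parabolic
  unfolding levi_factor_def by blast

lemma blk_const_between:
  assumes "i \<le> j" and "j \<le> 2*n" and "blk i = blk j" and "i < s" and "s \<le> j"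
  shows "blk (s - 1) = blk s"
proof -
  have "s - 1 \<le> 2*n" "i \<le> s - 1" "s - 1 \<le> s" "s \<le> 2*n" using assms by auto
  then have "blk i \<le> blk (s - 1)" "blk (s - 1) \<le> blk s" "blk s \<le> blk j"
    using mono assms by blast+
  then show ?thesis using assms(3) by linarith
qed

text \<open>A simple root occurring in \<open>e\<^sub>i - e\<^sub>j\<close> is a step between
  \<open>i\<close> and \<open>j\<close> or the mirror image of one, and \<open>blk\<close> is
  constant along the whole stretch.\<close>

lemma root_coeff_levi:
  assumes ij: "i \<le> j" "j \<le> 2*n" and eq: "blk i = blk j" and s: "1 \<le> s" "s \<le> n"
    and nz: "root_coeff n i j s \<noteq> 0"
  shows "simple_root n s \<in> I"
proof -
  have "blk (s - 1) = blk s"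
  proof (cases "i < s \<and> s \<le> j")
    case True
    then show ?thesis using blk_const_between ij eq by blast
  next
    case False
    then have "i < 2*n + 1 - s" "2*n + 1 - s \<le> j" using nz by (auto simp: root_coeff_def split: if_splits)
    from blk_const_between[OF ij eq this] have "blk (2*n - s) = blk (2*n - (s - 1))"
      using s by simp
    moreover have "s - 1 \<le> 2*n" "s \<le> 2*n" using s by auto
    ultimately show ?thesis using refl[of s] refl[of "s - 1"] by simp
  qed
  then show ?thesis using cut s by simp
qed

lemma root_wt_generated:
  assumes ij: "i \<le> 2*n" "j \<le> 2*n" and ne: "i \<noteq> j" "i + j \<noteq> 2*n" and eq: "blk i = blk j"
  shows "root_wt n i j \<in> generated_roots n I"
proof -
  have le: "root_wt n a b = vec n (\<lambda>t. \<Sum>\<alpha>\<in>I. of_int (int (root_coeff_fun n a b \<alpha>)) * vec_index \<alpha> t)"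
    if ab: "a \<le> b" "b \<le> 2*n" "blk a = blk b" for a b
  proof -
    have "root_coeff_fun n a b \<alpha> = 0" if "\<alpha> \<in> simple_roots n - I" for \<alpha>
      using that root_coeff_levi[OF ab] by (force simp: simple_roots_def root_coeff_fun_simple_root)
    then have "(\<Sum>\<alpha>\<in>simple_roots n. of_nat (root_coeff_fun n a b \<alpha>) * vec_index \<alpha> t)
      = (\<Sum>\<alpha>\<in>I. of_int (int (root_coeff_fun n a b \<alpha>)) * vec_index \<alpha> t)" for t
      using I by (intro sum.mono_neutral_cong_right finite_simple_roots) auto
    then show ?thesis unfolding root_wt_combination[OF ab(1,2)] by presburger
  qed
  have "\<exists>c :: complex vec \<Rightarrow> int. root_wt n i j = vec n (\<lambda>t. \<Sum>\<alpha>\<in>I. of_int (c \<alpha>) * vec_index \<alpha> t)"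
  proof (cases "i \<le> j")
    case True
    then show ?thesis using le[of i j] ij eq
      by (intro exI[of _ "\<lambda>\<alpha>. int (root_coeff_fun n i j \<alpha>)"]) simp
  next
    case False
    then have "root_wt n j i = vec n (\<lambda>t. \<Sum>\<alpha>\<in>I. of_int (int (root_coeff_fun n j i \<alpha>)) * vec_index \<alpha> t)"
      using le[of j i] ij eq by simp
    then have "root_wt n i j = vec n (\<lambda>t. \<Sum>\<alpha>\<in>I. of_int (- int (root_coeff_fun n j i \<alpha>)) * vec_index \<alpha> t)"
      unfolding root_wt_uminus[of n i j] by (intro eq_vecI) (auto simp: sum_negf)
    then show ?thesis by (intro exI[of _ "\<lambda>\<alpha>. - int (root_coeff_fun n j i \<alpha>)"])
  qed
  then show ?thesis using root_wt_roots[OF ij ne] by (simp add: generated_roots_def)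
qed

lemma root_vec_parabolic:
  assumes ij: "i \<le> 2*n" "j \<le> 2*n" and ne: "i \<noteq> j" and le: "blk i \<le> blk j"
  shows "root_vec n i j \<in> standard_parabolic n I"
proof (cases "i + j = 2*n")
  case True
  then have "2*n - j = i" "2*n - i = j" using ij by auto
  then have "root_vec n i j = 0\<^sub>m (2*n+1) (2*n+1)" by (intro eq_matI) (auto simp: root_vec_def)
  then show ?thesis using lin_closedD(2)[OF lin_closed_parabolic] by simp
next
  case anti: False
  note space = root_vec_root_space[OF ij]
  show ?thesis
  proof (cases "blk i = blk j")
    case True
    have "root_vec n i j \<in> levi_factor n I"
      using root_wt_generated[OF ij ne anti True] mat_span_superset[OF generators_carrier(1)] space
      unfolding levi_factor_def by blast
    then show ?thesis using levi_subset_parabolic by blast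
  next
    case False
    then have "i < j" using le mono[of j i] ij by (cases "i < j") auto
    then have "root_wt n i j \<in> positive_roots n" by (rule root_wt_positive[OF _ ij(2) anti])
    then show ?thesis using mat_span_superset[OF generators_carrier(2)] space
      unfolding standard_parabolic_def by blast
  qed
qed

lemma block_nilpotent_subset_parabolic: "block_nilpotent n blk \<subseteq> standard_parabolic n I"
proof
  fix X assume X: "X \<in> block_nilpotent n blk"
  show "X \<in> standard_parabolic n I"
  proof (rule lin_closed_root_vec[OF lin_closed_parabolic])
    show "X \<in> so_odd n" using X by (simp add: block_nilpotent_def)
    fix i j assume ij: "i \<le> 2*n" "j \<le> 2*n" "X $$ (i, j) \<noteq> 0"
    then have "blk i < blk j" using X by (force simp: block_nilpotent_def)
    then show "root_vec n i j \<in> standard_parabolic n I" using root_vec_parabolic[of i j] ij by force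
  qed
qed

text \<open>A central element of the Levi factor that separates the blocks. Its entries are
  \<open>K - 2 * blk i\<close>, written as a difference that is visibly antisymmetric under
  reflection.\<close>

definition block_elt :: "complex mat" where
  "block_elt = diag_elt n (\<lambda>i. of_nat (blk (2*n - i)) - of_nat (blk i))"

lemma block_elt: "block_elt \<in> cartan n"
  "i \<le> 2*n \<Longrightarrow> j \<le> 2*n \<Longrightarrow>
     block_elt $$ (i, i) - block_elt $$ (j, j) = 2 * (of_nat (blk j) - of_nat (blk i))"
proof -
  show "block_elt \<in> cartan n" unfolding block_elt_def by (rule diag_elt_cartan) auto
  assume ij: "i \<le> 2*n" "j \<le> 2*n"
  have "of_nat (blk (2*n - k)) = of_nat K - (of_nat (blk k) :: complex)" if "k \<le> 2*n" for k
    using refl[OF that] by (metis add_diff_cancel_right' of_nat_add)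
  then show "block_elt $$ (i, i) - block_elt $$ (j, j) = 2 * (of_nat (blk j) - of_nat (blk i))"
    using ij by (simp add: block_elt_def)
qed

text \<open>Two Cartan elements locate the entries: \<open>block_elt\<close> has value 0 on the
  roots of the Levi factor, which confines them to the diagonal blocks, and
  \<open>height_elt\<close> has nonnegative value on positive roots, which puts them on or above the
  diagonal.\<close>

lemma parabolic_subset_block_upper: "standard_parabolic n I \<subseteq> block_upper n blk"
proof -
  have cartan: "cartan n \<subseteq> block_upper n blk"
    using cartan_so_odd cartanD(2) by (fastforce simp: block_upper_def)
  have gen: "root_space n w \<subseteq> block_upper n blk" if w: "w \<in> generated_roots n I" for w
  proof
    fix X assume X: "X \<in> root_space n w"
    obtain c :: "complex vec \<Rightarrow> int" where w: "w = vec n (\<lambda>t. \<Sum>\<alpha>\<in>I. of_int (c \<alpha>) * vec_index \<alpha> t)"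
      using w by (auto simp: generated_roots_def)
    have "weight_value n \<alpha> block_elt = 0" if \<alpha>: "\<alpha> \<in> I" for \<alpha>
    proof -
      have "\<alpha> \<in> simple_root n ` {1..n}" using \<alpha> I by (auto simp: simple_roots_def)
      then obtain r where r: "1 \<le> r" "r \<le> n" "\<alpha> = simple_root n r" by auto
      then show ?thesis using cut[of r] \<alpha> weight_value_simple_root[OF block_elt(1), of r]
          block_elt(2)[of "r - 1" r] by simp
    qed
    then have "weight_value n w block_elt = 0"
      unfolding w using weight_value_combination[of I n "\<lambda>\<alpha>. of_int (c \<alpha>)"] finite_subset[OF I finite_simple_roots]
      by simp
    then have "blk i = blk j" if "i \<le> 2*n" "j \<le> 2*n" "X $$ (i, j) \<noteq> 0" for i j
      using root_space_entry[OF X block_elt(1) that] block_elt(2)[OF that(1,2)] by simp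
    then show "X \<in> block_upper n blk" using X by (force simp: block_upper_def root_space_def)
  qed
  have pos: "root_space n w \<subseteq> block_upper n blk" if w: "w \<in> positive_roots n" for w
  proof
    fix X assume X: "X \<in> root_space n w"
    obtain c :: "complex vec \<Rightarrow> nat" where w: "w = vec n (\<lambda>t. \<Sum>\<alpha>\<in>simple_roots n. of_nat (c \<alpha>) * vec_index \<alpha> t)"
      using w by (auto simp: positive_roots_def)
    have "weight_value n \<alpha> (height_elt n) = 1" if \<alpha>: "\<alpha> \<in> simple_roots n" for \<alpha>
    proof -
      obtain r where r: "1 \<le> r" "r \<le> n" "\<alpha> = simple_root n r"
        using \<alpha> by (auto simp: simple_roots_def)
      then show ?thesis using weight_value_simple_root[OF height_elt(1), of r] height_elt(2)[of r n]
          height_elt(2)[of "r - 1" n] by (simp add: of_nat_diff)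
    qed
    then have "weight_value n w (height_elt n) = of_nat (\<Sum>\<alpha>\<in>simple_roots n. c \<alpha>)"
      unfolding w using weight_value_combination[OF finite_simple_roots, of n "\<lambda>\<alpha>. of_nat (c \<alpha>)"]
      by simp
    then have "i \<le> j" if "i \<le> 2*n" "j \<le> 2*n" "X $$ (i, j) \<noteq> 0" for i j
    proof -
      have "(of_nat j :: complex) - of_nat i = of_nat (\<Sum>\<alpha>\<in>simple_roots n. c \<alpha>)"
        using root_space_entry[OF X height_elt(1) that] height_elt(2) that
          \<open>weight_value n w (height_elt n) = of_nat (\<Sum>\<alpha>\<in>simple_roots n. c \<alpha>)\<close> by simp
      then have "(of_nat j :: complex) = of_nat (i + (\<Sum>\<alpha>\<in>simple_roots n. c \<alpha>))"
        by (simp add: algebra_simps)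
      then have "j = i + (\<Sum>\<alpha>\<in>simple_roots n. c \<alpha>)" by (rule of_nat_eq_iff[THEN iffD1])
      then show ?thesis by simp
    qed
    then have "blk i \<le> blk j" if "i \<le> 2*n" "j \<le> 2*n" "X $$ (i, j) \<noteq> 0" for i j
      using that mono by blast
    then show "X \<in> block_upper n blk" using X by (force simp: block_upper_def root_space_def)
  qed
  have "levi_factor n I \<subseteq> block_upper n blk"
    unfolding levi_factor_def
    by (rule mat_span_least[OF lin_closed_block_upper]) (use cartan gen in blast)
  then show ?thesis unfolding standard_parabolic_def
    by (intro mat_span_least[OF lin_closed_block_upper]) (use pos in blast)
qed

lemma block_nilpotent_ideal: "lie_ideal (2*n+1) (block_nilpotent n blk) (standard_parabolic n I)"
  unfolding lie_ideal_def subspace_iff_lin_closed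
proof (intro conjI ballI)
  show "lin_closed (2*n+1) (block_nilpotent n blk)" by (rule lin_closed_block_nilpotent)
  show "block_nilpotent n blk \<subseteq> standard_parabolic n I" by (rule block_nilpotent_subset_parabolic)
  fix X Y assume "X \<in> standard_parabolic n I" and Y: "Y \<in> block_nilpotent n blk"
  then have X: "X \<in> block_upper n blk" using parabolic_subset_block_upper by blast
  have so: "X \<in> so_odd n" "Y \<in> so_odd n" using X Y by (auto simp: block_upper_def block_nilpotent_def)
  note c = so[THEN so_odd_carrier]
  have "lie_bracket X Y $$ (i, j) = 0" if ij: "i \<le> 2*n" "j \<le> 2*n" and le: "blk j \<le> blk i" for i j
  proof -
    have zero: "X $$ (i, k) * Y $$ (k, j) = 0 \<and> Y $$ (i, k) * X $$ (k, j) = 0" if "k \<le> 2*n" for k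
    proof -
      have "X $$ (i, k) = 0 \<or> blk i \<le> blk k" "X $$ (k, j) = 0 \<or> blk k \<le> blk j"
        "Y $$ (k, j) = 0 \<or> blk k < blk j" "Y $$ (i, k) = 0 \<or> blk i < blk k"
        using X Y ij that by (auto simp: block_upper_def block_nilpotent_def not_less not_le)
      then show ?thesis using le by auto
    qed
    have "(\<Sum>k\<le>2*n. X $$ (i, k) * Y $$ (k, j)) = 0" "(\<Sum>k\<le>2*n. Y $$ (i, k) * X $$ (k, j)) = 0"
      using zero by (auto intro: sum.neutral simp del: mult_eq_0_iff)
    then show ?thesis by (simp add: lie_bracket_index[OF c ij])
  qed
  then show "lie_bracket X Y \<in> block_nilpotent n blk"
    using lie_bracket_so_odd[OF so] by (simp add: block_nilpotent_def)
qed

text \<open>Each further bracket moves the support at least one more block away from the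
  diagonal.\<close>

lemma lower_central_block_nilpotent:
  "lower_central (2*n+1) (block_nilpotent n blk) k \<subseteq>
     {X \<in> carrier_mat (2*n+1) (2*n+1). \<forall>i j. i \<le> 2*n \<longrightarrow> j \<le> 2*n \<longrightarrow> blk j \<le> blk i + k \<longrightarrow> X $$ (i, j) = 0}"
proof (induction k)
  case 0
  then show ?case using so_odd_carrier by (auto simp: block_nilpotent_def)
next
  case (Suc k)
  let ?W = "{X \<in> carrier_mat (2*n+1) (2*n+1). \<forall>i j. i \<le> 2*n \<longrightarrow> j \<le> 2*n \<longrightarrow> blk j \<le> blk i + Suc k \<longrightarrow> X $$ (i, j) = (0 :: complex)}"
  have "lin_closed (2*n+1) ?W" by (auto simp: lin_closed_def)
  moreover have "lie_bracket X Y \<in> ?W"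
    if X: "X \<in> block_nilpotent n blk" and Yk: "Y \<in> lower_central (2*n+1) (block_nilpotent n blk) k" for X Y
  proof -
    have Y: "Y \<in> carrier_mat (2*n+1) (2*n+1)"
      and Y0: "\<And>i j. i \<le> 2*n \<Longrightarrow> j \<le> 2*n \<Longrightarrow> blk j \<le> blk i + k \<Longrightarrow> Y $$ (i, j) = 0"
      using Yk Suc.IH by auto
    have Xc: "X \<in> carrier_mat (2*n+1) (2*n+1)" using X so_odd_carrier by (simp add: block_nilpotent_def)
    have "lie_bracket X Y $$ (i, j) = 0"
      if ij: "i \<le> 2*n" "j \<le> 2*n" and le: "blk j \<le> blk i + Suc k" for i j
    proof -
      have zero: "X $$ (i, l) * Y $$ (l, j) = 0 \<and> Y $$ (i, l) * X $$ (l, j) = 0" if l: "l \<le> 2*n" for l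
      proof -
        have "X $$ (i, l) = 0 \<or> blk i < blk l" "X $$ (l, j) = 0 \<or> blk l < blk j"
          using X ij l by (auto simp: block_nilpotent_def not_less)
        moreover have "Y $$ (l, j) = 0 \<or> blk l + k < blk j" "Y $$ (i, l) = 0 \<or> blk i + k < blk l"
          using Y0[OF l ij(2)] Y0[OF ij(1) l] by (auto simp: not_less)
        ultimately show ?thesis using le by auto
      qed
      have "(\<Sum>k\<le>2*n. X $$ (i, k) * Y $$ (k, j)) = 0" "(\<Sum>k\<le>2*n. Y $$ (i, k) * X $$ (k, j)) = 0"
        using zero by (auto intro: sum.neutral simp del: mult_eq_0_iff)
      then show ?thesis by (simp add: lie_bracket_index[OF Xc Y ij])
    qed
    then show ?thesis using Xc Y by simp
  qed
  ultimately show ?case unfolding lower_central.simps by (intro mat_span_least) auto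
qed

lemma block_nilpotent_nilpotent: "lie_nilpotent (2*n+1) (block_nilpotent n blk)"
proof -
  let ?L = "lower_central (2*n+1) (block_nilpotent n blk) K"
  have "0\<^sub>m (2*n+1) (2*n+1) \<in> ?L"
    using lin_closedD(2)[OF lin_closed_lower_central[OF lin_closed_block_nilpotent]] .
  moreover have "X = 0\<^sub>m (2*n+1) (2*n+1)" if "X \<in> ?L" for X
  proof -
    have X: "X \<in> carrier_mat (2*n+1) (2*n+1)"
      and X0: "\<And>i j. i \<le> 2*n \<Longrightarrow> j \<le> 2*n \<Longrightarrow> blk j \<le> blk i + K \<Longrightarrow> X $$ (i, j) = 0"
      using that lower_central_block_nilpotent[of K] by auto
    have "blk j \<le> blk i + K" if "j \<le> 2*n" for i j using refl[OF that] by simp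
    then show ?thesis using X X0 by (intro eq_matI) auto
  qed
  ultimately have "?L = {0\<^sub>m (2*n+1) (2*n+1)}" by blast
  then show ?thesis unfolding lie_nilpotent_def by blast
qed

text \<open>Weight isolation: the product of the operators \<open>ad H - c\<close>, \<open>c \<noteq> 0\<close>, where \<open>H\<close> has distinct
  diagonal entries, kills all off-diagonal entries of \<open>X\<close> and scales the diagonal.\<close>

lemma ideal_weight_product:
  assumes ideal: "lie_ideal (2*n+1) \<aa> (standard_parabolic n I)" and X: "X \<in> \<aa>" and C: "finite C"
  shows "\<exists>Y\<in>\<aa>. \<forall>i j. i \<le> 2*n \<longrightarrow> j \<le> 2*n \<longrightarrow>
     Y $$ (i, j) = (\<Prod>c\<in>C. of_nat j - of_nat i - c) * X $$ (i, j)"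
  using C
proof induction
  case empty
  then show ?case using X by auto
next
  case (insert c C)
  have a: "lin_closed (2*n+1) \<aa>" using ideal by (simp add: lie_ideal_def subspace_iff_lin_closed)
  from insert.IH obtain Y where Y: "Y \<in> \<aa>" and Yij: "\<And>i j. i \<le> 2*n \<Longrightarrow> j \<le> 2*n \<Longrightarrow>
     Y $$ (i, j) = (\<Prod>c\<in>C. of_nat j - of_nat i - c) * X $$ (i, j)" by blast
  have Yc: "Y \<in> carrier_mat (2*n+1) (2*n+1)" using Y lin_closedD(1)[OF a] by simp
  let ?H = "height_elt n"
  have "?H \<in> standard_parabolic n I" using height_elt(1) cartan_subset_parabolic by blast
  then have HY: "lie_bracket ?H Y \<in> \<aa>" using ideal Y by (simp add: lie_ideal_def)
  let ?Z = "lie_bracket ?H Y + (- c) \<cdot>\<^sub>m Y"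
  have "?Z \<in> \<aa>" using lin_closedD(3,4)[OF a] HY Y by blast
  moreover have "?Z $$ (i, j) = (\<Prod>c\<in>insert c C. of_nat j - of_nat i - c) * X $$ (i, j)"
    if ij: "i \<le> 2*n" "j \<le> 2*n" for i j
  proof -
    have "?Z $$ (i, j) = lie_bracket ?H Y $$ (i, j) - c * Y $$ (i, j)" using ij Yc by simp
    then show ?thesis
      using ij insert.hyps by (simp add: lie_bracket_cartan[OF height_elt(1) Yc ij] height_elt(2) Yij algebra_simps)
  qed
  ultimately show ?case by blast
qed

text \<open>Weight isolation puts a rescaled diagonal part of \<open>X\<close> into the ideal. Were
  it nonzero, it would have a root vector in the parabolic as an eigenvector with nonzero
  eigenvalue, which a nilpotent ideal forbids.\<close>

lemma ideal_diagonal_zero: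
  assumes ideal: "lie_ideal (2*n+1) \<aa> (standard_parabolic n I)" and nil: "lie_nilpotent (2*n+1) \<aa>"
    and X: "X \<in> \<aa>" and i: "i \<le> 2*n"
  shows "X $$ (i, i) = 0"
proof (rule ccontr)
  assume nz: "X $$ (i, i) \<noteq> 0"
  have sub: "\<aa> \<subseteq> block_upper n blk"
    using ideal parabolic_subset_block_upper by (auto simp: lie_ideal_def)
  define C where "C = (\<lambda>(k, l). of_nat l - of_nat k :: complex) ` {(k, l). k \<le> 2*n \<and> l \<le> 2*n \<and> k \<noteq> l}"
  have "finite {(k, l). k \<le> 2*n \<and> l \<le> 2*n \<and> k \<noteq> l}"
    by (rule finite_subset[of _ "{..2*n} \<times> {..2*n}"]) auto
  then have fin: "finite C" by (simp add: C_def)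
  obtain Y where Y: "Y \<in> \<aa>" and Yij: "\<And>i j. i \<le> 2*n \<Longrightarrow> j \<le> 2*n \<Longrightarrow>
     Y $$ (i, j) = (\<Prod>c\<in>C. of_nat j - of_nat i - c) * X $$ (i, j)"
    using ideal_weight_product[OF ideal X fin] by blast
  have Yso: "Y \<in> so_odd n" using Y sub by (auto simp: block_upper_def)
  have "0 \<notin> C" by (auto simp: C_def)
  then have "Y $$ (i, i) \<noteq> 0" using Yij[OF i i] nz fin by (auto simp: prod_zero_iff)
  have "Y $$ (k, l) = 0" if "k \<le> 2*n" "l \<le> 2*n" "k \<noteq> l" for k l
  proof -
    have "of_nat l - of_nat k \<in> C" using that by (force simp: C_def)
    then have "(\<Prod>c\<in>C. of_nat l - of_nat k - c) = 0" using fin by (intro prod_zero) auto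
    then show ?thesis using Yij that by simp
  qed
  then have Yh: "Y \<in> cartan n" using Yso so_odd_carrier[OF Yso] by (auto simp: cartan_def diagonal_mat_def)
  \<comment> \<open>Reflection negates diagonal entries, so a nonzero one may be taken in the first
    half; the middle one vanishes.\<close>
  define k where "k = (if i < n then i else 2*n - i)"
  have k: "k \<le> 2*n" "Y $$ (k, k) \<noteq> 0"
    using \<open>Y $$ (i, i) \<noteq> 0\<close> cartanD(1)[OF Yh i] i by (auto simp: k_def)
  have Ynn: "Y $$ (n, n) = 0" using so_odd_antidiagonal[OF Yso, of n] by simp
  then have "k \<noteq> n" using k by auto
  then have kn: "k < n" using i by (auto simp: k_def split: if_splits)
  \<comment> \<open>A vector for the short positive root \<open>e\<^sub>k\<close>. As
    \<open>Y\<close> vanishes at the middle index, its eigenvalue is the single entry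
    \<open>Y $$ (k, k)\<close>.\<close>
  let ?F = "root_vec n k n"
  have "lie_bracket Y ?F = Y $$ (k, k) \<cdot>\<^sub>m ?F"
    using root_vec_root_space[of k n n] Yh weight_value_root_wt[OF Yh, of k n] Ynn kn by (simp add: root_space_def)
  moreover have "?F \<in> standard_parabolic n I"
    using root_vec_parabolic[of k n] kn mono[of k n] by simp
  ultimately have "?F = 0\<^sub>m (2*n+1) (2*n+1)"
    using nilpotent_ideal_no_eigenvector[OF ideal nil Y _ root_vec_carrier] k(2) by blast
  then have "?F $$ (k, n) = 0\<^sub>m (2*n+1) (2*n+1) $$ (k, n)" by simp
  then show False using kn by simp
qed

text \<open>A nonzero off-diagonal entry inside a diagonal block could be carried to the diagonal by
  bracketing with the opposite root vector, which also belongs to the Levi factor.\<close>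

lemma nilpotent_ideal_subset:
  assumes ideal: "lie_ideal (2*n+1) \<aa> (standard_parabolic n I)" and nil: "lie_nilpotent (2*n+1) \<aa>"
  shows "\<aa> \<subseteq> block_nilpotent n blk"
proof
  fix X assume X: "X \<in> \<aa>"
  have Xu: "X \<in> block_upper n blk"
    using ideal X parabolic_subset_block_upper by (auto simp: lie_ideal_def)
  then have Xso: "X \<in> so_odd n" by (simp add: block_upper_def)
  note Xc = so_odd_carrier[OF Xso]
  have "X $$ (i, j) = 0" if ij: "i \<le> 2*n" "j \<le> 2*n" and le: "blk j \<le> blk i" for i j
  proof (rule ccontr)
    assume nz: "X $$ (i, j) \<noteq> 0"
    then have eq: "blk i = blk j" using Xu ij le by (force simp: block_upper_def)
    have ne: "i \<noteq> j" using nz ideal_diagonal_zero[OF ideal nil X] ij by auto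
    have anti: "j \<noteq> 2*n - i" using nz so_odd_antidiagonal[OF Xso ij(1)] by auto
    let ?F = "root_vec n j i"
    have "?F \<in> standard_parabolic n I" using root_vec_parabolic[of j i] ij ne eq by simp
    then have "lie_bracket ?F X \<in> \<aa>" using ideal X by (simp add: lie_ideal_def)
    then have zero: "lie_bracket ?F X $$ (k, k) = 0" if "k \<le> 2*n" for k
      using ideal_diagonal_zero[OF ideal nil] that by blast
    show False
    \<comment> \<open>The bracket is read off at \<open>(j, j)\<close>. For \<open>j = n\<close>
      that entry is always zero by skewness, and \<open>(i, i)\<close> is used instead.\<close>
    proof (cases "j = n")
      case False
      have "(\<Sum>k\<le>2*n. ?F $$ (j, k) * X $$ (k, j)) = (\<Sum>k\<le>2*n. if k = i then X $$ (i, j) else 0)"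
        by (rule sum.cong) (use ij anti in auto)
      moreover have "(\<Sum>k\<le>2*n. X $$ (j, k) * ?F $$ (k, j)) = 0"
        by (rule sum.neutral) (use ij ne False in auto)
      ultimately show False
        using zero[OF ij(2)] nz ij by (simp add: lie_bracket_index[OF root_vec_carrier Xc ij(2) ij(2)])
    next
      case True
      then have "i \<noteq> n" using ne by simp
      then have "(\<Sum>k\<le>2*n. ?F $$ (i, k) * X $$ (k, i)) = 0"
        by (intro sum.neutral) (use ij ne in auto)
      moreover have "(\<Sum>k\<le>2*n. X $$ (i, k) * ?F $$ (k, i)) = (\<Sum>k\<le>2*n. if k = j then X $$ (i, j) else 0)"
        by (rule sum.cong) (use ij anti in auto)
      ultimately show False
        using zero[OF ij(1)] nz ij by (simp add: lie_bracket_index[OF root_vec_carrier Xc ij(1) ij(1)])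
    qed
  qed
  then show "X \<in> block_nilpotent n blk" using Xso by (simp add: block_nilpotent_def)
qed

lemma nilradical_eq: "nilradical (2*n+1) (standard_parabolic n I) = block_nilpotent n blk"
  unfolding nilradical_def
  using nilpotent_ideal_subset block_nilpotent_ideal block_nilpotent_nilpotent by blast

end

section \<open>Powers of strictly block triangular matrices\<close>

lemma rank_le_entries:
  fixes A :: "'a :: field mat"
  assumes "\<And>j. j < dim_col A \<Longrightarrow> \<exists>w. \<forall>a < dim_row A. A $$ (a, j) = (\<Sum>l<r. g l a * w l)"
  shows "rank_le A r"
proof -
  from assms have "\<forall>j. \<exists>w. j < dim_col A \<longrightarrow> (\<forall>a < dim_row A. A $$ (a, j) = (\<Sum>l<r. g l a * w l))"
    by blast
  from choice[OF this] obtain w where w: "\<And>j a. j < dim_col A \<Longrightarrow> a < dim_row A \<Longrightarrow> A $$ (a, j) = (\<Sum>l<r. g l a * w j l)"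
    by auto
  define C where "C = mat (dim_row A) r (\<lambda>(a, l). g l a)"
  define F where "F = mat r (dim_col A) (\<lambda>(l, j). w j l)"
  have "A = C * F"
    by (rule eq_matI) (simp_all add: C_def F_def w scalar_prod_def atLeast0LessThan)
  then show ?thesis by (rule rank_leI[rotated 2]) (simp_all add: C_def F_def)
qed

text \<open>Column \<open>c\<close> of \<open>X\<^sup>j\<close> lies in the span of the columns \<open>c'\<close> of \<open>X\<close> to the power
  \<open>k - |{t \<in> S. blk c' < t}|\<close> with \<open>blk c' \<notin> S\<close>, as soon as \<open>j\<close> is at least that exponent for \<open>c\<close>:
  multiplying by \<open>X\<close> moves to lower blocks, and passing through a block of \<open>S\<close> gains one power.\<close>

lemma rank_le_block_pow:
  fixes X :: "'a :: field mat"
  assumes X: "X \<in> carrier_mat N N"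
    and up: "\<And>i j. i < N \<Longrightarrow> j < N \<Longrightarrow> blk j \<le> blk i \<Longrightarrow> X $$ (i, j) = 0"
    and S: "finite S" "card S \<le> k"
  shows "rank_le (X ^\<^sub>m k) (card {c. c < N \<and> blk c \<notin> (S :: nat set)})"
proof -
  define r where "r = card {c. c < N \<and> blk c \<notin> S}"
  define cs where "cs = sorted_list_of_set {c. c < N \<and> blk c \<notin> S}"
  have cs: "set cs = {c. c < N \<and> blk c \<notin> S}" "length cs = r" by (simp_all add: cs_def r_def)
  define s where "s b = card {t \<in> S. b < t}" for b
  define g where "g l a = (X ^\<^sub>m (k - s (blk (cs ! l)))) $$ (a, cs ! l)" for l a
  define V where "V f \<longleftrightarrow> (\<exists>w. \<forall>a<N. f a = (\<Sum>l<r. g l a * w l))" for f :: "nat \<Rightarrow> 'a"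
  have V_sum: "V (\<lambda>a. \<Sum>i<N. f i a)" if f: "\<And>i. i < N \<Longrightarrow> V (f i)" for f
  proof -
    from f have "\<forall>i. \<exists>w. i < N \<longrightarrow> (\<forall>a<N. f i a = (\<Sum>l<r. g l a * w l))" unfolding V_def by blast
    from choice[OF this] obtain w where w: "\<And>i a. i < N \<Longrightarrow> a < N \<Longrightarrow> f i a = (\<Sum>l<r. g l a * w i l)" by auto
    have "(\<Sum>i<N. f i a) = (\<Sum>l<r. g l a * (\<Sum>i<N. w i l))" if "a < N" for a
    proof -
      have "(\<Sum>i<N. f i a) = (\<Sum>i<N. \<Sum>l<r. g l a * w i l)" using w that by simp
      also have "\<dots> = (\<Sum>l<r. \<Sum>i<N. g l a * w i l)" by (rule sum.swap)
      finally show ?thesis by (simp add: sum_distrib_left)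
    qed
    then show ?thesis unfolding V_def by (intro exI[of _ "\<lambda>l. \<Sum>i<N. w i l"]) simp
  qed
  have V_scale: "V (\<lambda>a. f a * c)" if f: "V f" for f c
  proof -
    from f obtain w where "\<forall>a<N. f a = (\<Sum>l<r. g l a * w l)" unfolding V_def by blast
    then show ?thesis unfolding V_def
      by (intro exI[of _ "\<lambda>l. w l * c"]) (simp add: sum_distrib_right mult.assoc)
  qed
  have V_zero: "V (\<lambda>a. 0)" unfolding V_def by (intro exI[of _ "\<lambda>_. 0"]) simp
  have s_mono: "s b \<le> s b'" if "b' \<le> b" for b b'
    unfolding s_def using S that by (intro card_mono) auto
  have s_strict: "s b < s b'" if "b' < b" "b \<in> S" for b b'
    unfolding s_def using S that by (intro psubset_card_mono) auto
  have step: "V (\<lambda>a. (X ^\<^sub>m Suc j) $$ (a, c))"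
    if c: "c < N" and IH: "\<And>c'. c' < N \<Longrightarrow> blk c' < blk c \<Longrightarrow> V (\<lambda>a. (X ^\<^sub>m j) $$ (a, c'))" for j c
  proof -
    have "V (\<lambda>a. \<Sum>c'<N. (X ^\<^sub>m j) $$ (a, c') * X $$ (c', c))"
    proof (rule V_sum)
      fix c' assume c': "c' < N"
      show "V (\<lambda>a. (X ^\<^sub>m j) $$ (a, c') * X $$ (c', c))"
      proof (cases "blk c' < blk c")
        case True
        then show ?thesis using IH[OF c'] V_scale by blast
      next
        case False
        then show ?thesis using up[OF c' c] V_zero by simp
      qed
    qed
    moreover have "(X ^\<^sub>m Suc j) $$ (a, c) = (\<Sum>c'<N. (X ^\<^sub>m j) $$ (a, c') * X $$ (c', c))" if "a < N" for a
      using X c that pow_carrier_mat[OF X, of j] by (simp add: scalar_prod_def atLeast0LessThan)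
    ultimately show ?thesis unfolding V_def by simp
  qed
  have main: "V (\<lambda>a. (X ^\<^sub>m j) $$ (a, c))" if "c < N" "k - s (blk c) \<le> j" for c j
    using that
  proof (induction "blk c" arbitrary: c j rule: less_induct)
    case less
    show ?case
    proof (cases "blk c \<in> S")
      case True
      \<comment> \<open>The block of \<open>c\<close> is not counted in its own \<open>s\<close>, so
        the required exponent is positive and one factor \<open>X\<close> can be split off.\<close>
      have "s (blk c) < card S" unfolding s_def using S True by (intro psubset_card_mono) auto
      then obtain j' where j: "j = Suc j'" using S(2) less.prems(2) by (cases j) auto
      have "V (\<lambda>a. (X ^\<^sub>m j') $$ (a, c'))" if c': "c' < N" "blk c' < blk c" for c'
        using less.hyps[OF c'(2) c'(1)] s_strict[OF c'(2) True] less.prems(2) j by simp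
      then show ?thesis unfolding j by (rule step[OF less.prems(1)])
    next
      case False
      show ?thesis
      proof (cases "j = k - s (blk c)")
        case True
        \<comment> \<open>At exactly this exponent the column is itself one of the
          generators.\<close>
        have "c \<in> set cs" using False less.prems(1) cs by simp
        then obtain l where l: "l < r" "cs ! l = c" using cs(2) by (auto simp: in_set_conv_nth)
        have "(X ^\<^sub>m j) $$ (a, c) = (\<Sum>l'<r. g l' a * (if l' = l then 1 else 0))" for a
          using l True by (simp add: g_def if_distrib[of "\<lambda>z. _ * z"] cong: if_cong)
        then show ?thesis unfolding V_def by (intro exI allI impI)
      next
        case ne: False
        then obtain j' where j: "j = Suc j'" "k - s (blk c) \<le> j'" using less.prems(2) by (cases j) auto
        have "V (\<lambda>a. (X ^\<^sub>m j') $$ (a, c'))" if c': "c' < N" "blk c' < blk c" for c'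
          using less.hyps[OF c'(2) c'(1)] s_mono[of "blk c'" "blk c"] c' j by simp
        then show ?thesis unfolding j(1) by (rule step[OF less.prems(1)])
      qed
    qed
  qed
  have dims: "dim_row (X ^\<^sub>m k) = N" "dim_col (X ^\<^sub>m k) = N"
    using carrier_matD[OF pow_carrier_mat[OF X]] by auto
  have "rank_le (X ^\<^sub>m k) r"
  proof (rule rank_le_entries[where g = g])
    fix j assume "j < dim_col (X ^\<^sub>m k)"
    then have "V (\<lambda>a. (X ^\<^sub>m k) $$ (a, j))" using main[of j k] dims by simp
    then show "\<exists>w. \<forall>a < dim_row (X ^\<^sub>m k). (X ^\<^sub>m k) $$ (a, j) = (\<Sum>l<r. g l a * w l)"
      unfolding V_def dims .
  qed
  then show ?thesis by (simp add: r_def)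
qed

section \<open>Odd powers in the orthogonal Lie algebra\<close>

lemma so_odd_pow_index:
  assumes X: "X \<in> so_odd n" and ab: "a \<le> 2*n" "b \<le> 2*n"
  shows "(X ^\<^sub>m i) $$ (2*n - b, 2*n - a) = (- 1) ^ i * (X ^\<^sub>m i) $$ (a, b)"
  using ab
proof (induction i arbitrary: a b)
  case 0
  have "dim_row X = 2*n+1" using so_odd_carrier[OF X] by simp
  then show ?case using 0 by auto
next
  case (Suc i)
  note Xc = so_odd_carrier[OF X]
  note Xi = pow_carrier_mat[OF Xc, of i]
  have "(X ^\<^sub>m Suc i) $$ (2*n - b, 2*n - a) = (\<Sum>k\<le>2*n. (X ^\<^sub>m i) $$ (2*n - b, k) * X $$ (k, 2*n - a))"
    using mult_mat_index[OF Xi Xc, of "2*n - b" "2*n - a"] by simp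
  also have "\<dots> = (\<Sum>k\<le>2*n. (- 1) ^ Suc i * (X $$ (a, k) * (X ^\<^sub>m i) $$ (k, b)))"
  proof (rule sum.reindex_bij_witness[of _ "\<lambda>k. 2*n - k" "\<lambda>k. 2*n - k"])
    fix k assume "k \<in> {..2*n}"
    then show "(- 1) ^ Suc i * (X $$ (a, 2*n - k) * (X ^\<^sub>m i) $$ (2*n - k, b))
        = (X ^\<^sub>m i) $$ (2*n - b, k) * X $$ (k, 2*n - a)"
      using Suc.IH[of "2*n - k" b] so_oddD[OF X, of a "2*n - k"] Suc.prems by simp
  qed auto
  also have "\<dots> = (- 1) ^ Suc i * (X * X ^\<^sub>m i) $$ (a, b)"
    unfolding mult_mat_index[OF Xc Xi Suc.prems] by (simp add: sum_distrib_left)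
  also have "X * X ^\<^sub>m i = X ^\<^sub>m Suc i"
  proof (induction i)
    case (Suc i)
    then show ?case using Xc pow_carrier_mat[OF Xc, of i]
      by (metis assoc_mult_mat pow_mat.simps(2))
  qed (use Xc in simp)
  finally show ?case .
qed

lemma form_mat_square: "form_mat n * form_mat n = 1\<^sub>m (2*n+1)"
proof (rule eq_matI)
  fix i j assume "i < dim_row (1\<^sub>m (2*n+1))" "j < dim_col (1\<^sub>m (2*n+1))"
  then have ij: "i \<le> 2*n" "j \<le> 2*n" by auto
  then show "(form_mat n * form_mat n) $$ (i, j) = 1\<^sub>m (2*n+1) $$ (i, j)"
    using form_mat_mult_index(1)[OF form_mat_carrier ij] by (auto simp: form_mat_def)
qed simp_all

text \<open>Multiplication by the form, an involution, preserves rank and turns an odd power of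
  \<open>X\<close> into a skew-symmetric matrix in the ordinary sense.\<close>

lemma so_odd_pow_rank_even:
  assumes X: "X \<in> so_odd n" and i: "odd i"
    and ge: "rank_ge (X ^\<^sub>m i) r" and le: "rank_le (X ^\<^sub>m i) r"
  shows "even r"
proof -
  let ?J = "form_mat n" let ?N = "2*n+1"
  note Xi = pow_carrier_mat[OF so_odd_carrier[OF X], of i]
  have "(X ^\<^sub>m i) $$ (2*n - b, 2*n - a) = - (X ^\<^sub>m i) $$ (a, b)" if "a \<le> 2*n" "b \<le> 2*n" for a b
    using so_odd_pow_index[OF X that] i by simp
  then have so: "X ^\<^sub>m i \<in> so_odd n" using Xi unfolding so_odd_iff by blast
  define A where "A = ?J * X ^\<^sub>m i"
  have A: "A \<in> carrier_mat ?N ?N" unfolding A_def by (rule mult_carrier_mat[OF form_mat_carrier Xi])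
  have Aij: "A $$ (a, b) = (X ^\<^sub>m i) $$ (2*n - a, b)" if "a \<le> 2*n" "b \<le> 2*n" for a b
    unfolding A_def by (rule form_mat_mult_index(1)[OF Xi that])
  have "transpose_mat A = - A"
  proof (rule eq_matI)
    fix a b assume "a < dim_row (- A)" "b < dim_col (- A)"
    then have ab: "a \<le> 2*n" "b \<le> 2*n" using A by auto
    have "A $$ (b, a) = - A $$ (a, b)"
      using so_oddD[OF so, of "2*n - a" b] ab by (simp add: Aij)
    then show "transpose_mat A $$ (a, b) = (- A) $$ (a, b)" using ab A by simp
  qed (use A in auto)
  moreover have "rank_le A r"
    using rank_le_mult[OF Xi form_mat_carrier one_carrier_mat le] right_mult_one_mat[OF A]
    unfolding A_def by metis
  moreover have "rank_ge A r"
  proof (rule rank_ge_mult[OF A form_mat_carrier one_carrier_mat])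
    have "?J * A = ?J * ?J * X ^\<^sub>m i"
      unfolding A_def by (rule assoc_mult_mat[OF form_mat_carrier form_mat_carrier Xi, symmetric])
    then have "?J * A = X ^\<^sub>m i" unfolding form_mat_square left_mult_one_mat[OF Xi] .
    then show "rank_ge (?J * A * 1\<^sub>m ?N) r" using ge right_mult_one_mat[OF Xi] by metis
  qed
  ultimately show ?thesis by (intro skew_rank_even[OF A])
qed

section \<open>A nilpotent element of large rank\<close>

locale symmetric_subset =
  fixes n q :: nat and U :: "nat set"
  assumes U: "U \<subseteq> {..2*n}"
    and sym: "c \<in> U \<Longrightarrow> 2*n - c \<in> U"
    and parity: "even (card U + q)"
begin

definition pos :: "nat \<Rightarrow> nat" where "pos x = card {u \<in> U. u < x}"

lemma finite_U: "finite U"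
  using U by (rule finite_subset) simp

lemma pos_strict:
  assumes "x \<in> U" and "x < y"
  shows "pos x < pos y"
  unfolding pos_def using assms finite_U by (intro psubset_card_mono) auto

lemma pos_inj: "inj_on pos U"
proof (rule inj_onI)
  fix x y assume "x \<in> U" "y \<in> U" "pos x = pos y"
  then show "x = y" using pos_strict[of x y] pos_strict[of y x] by (cases x y rule: linorder_cases) auto
qed

lemma pos_less: "x \<in> U \<Longrightarrow> pos x < card U"
  unfolding pos_def using finite_U by (intro psubset_card_mono) auto

lemma pos_surj:
  assumes "a < card U"
  obtains x where "x \<in> U" and "pos x = a"
proof -
  have "pos ` U = {..<card U}"
    using pos_less finite_U by (intro card_subset_eq) (auto simp: card_image[OF pos_inj])
  then show ?thesis using assms that by (metis imageE lessThan_iff)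
qed

text \<open>Reflection reverses the order of \<open>U\<close>, so the elements before the mirror
  image of \<open>x\<close> correspond to those after \<open>x\<close>.\<close>

lemma pos_reflect:
  assumes "x \<in> U"
  shows "pos (2*n - x) + pos x + 1 = card U"
proof -
  have "bij_betw (\<lambda>u. 2*n - u) {u \<in> U. x < u} {u \<in> U. u < 2*n - x}"
    by (rule bij_betw_byWitness[of _ "\<lambda>u. 2*n - u"]) (use U sym assms in auto)
  then have "pos (2*n - x) = card {u \<in> U. x < u}" unfolding pos_def by (rule bij_betw_same_card[symmetric])
  moreover have "U = insert x ({u \<in> U. u < x} \<union> {u \<in> U. x < u})" using assms by auto
  then have "card U = card (insert x ({u \<in> U. u < x} \<union> {u \<in> U. x < u}))" by simp
  then have "card U = Suc (card {u \<in> U. u < x} + card {u \<in> U. x < u})"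
    using finite_U by (simp add: card_Un_disjoint disjoint_iff)
  ultimately show ?thesis by (simp add: pos_def)
qed

text \<open>The signs are antisymmetric under the reflection, which puts the matrix into \<open>so_odd n\<close>; no
  entry is its own mirror image because \<open>card U - q\<close> is even.\<close>

definition shift_mat :: "complex mat" where
  "shift_mat = mat (2*n+1) (2*n+1) (\<lambda>(x, y). if x \<in> U \<and> y \<in> U \<and> pos y = pos x + q
     then (if 2 * pos x + q < card U then 1 else - 1) else 0)"

lemma shift_mat_carrier [simp]: "shift_mat \<in> carrier_mat (2*n+1) (2*n+1)"
  by (simp add: shift_mat_def)

lemma shift_mat_index:
  "x \<le> 2*n \<Longrightarrow> y \<le> 2*n \<Longrightarrow> shift_mat $$ (x, y) = (if x \<in> U \<and> y \<in> U \<and> pos y = pos x + q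
     then (if 2 * pos x + q < card U then 1 else - 1) else 0)"
  by (simp add: shift_mat_def)

lemma shift_mat_so_odd: "shift_mat \<in> so_odd n"
  unfolding so_odd_iff
proof (intro conjI allI impI)
  fix x y assume xy: "x \<le> 2*n" "y \<le> 2*n"
  have U_iff: "2*n - c \<in> U \<longleftrightarrow> c \<in> U" if "c \<le> 2*n" for c
    using sym[of c] sym[of "2*n - c"] that by auto
  show "shift_mat $$ (2*n - y, 2*n - x) = - shift_mat $$ (x, y)"
  proof (cases "x \<in> U \<and> y \<in> U")
    case True
    note r = pos_reflect[OF conjunct1[OF True]] pos_reflect[OF conjunct2[OF True]]
    have "pos (2*n - x) = pos (2*n - y) + q \<longleftrightarrow> pos y = pos x + q" using r by linarith
    \<comment> \<open>The boundary case \<open>2 * pos x + q = card U - 1\<close>, where both sides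
      would have the same sign, is excluded by parity.\<close>
    moreover have "2 * pos (2*n - y) + q < card U \<longleftrightarrow> \<not> 2 * pos x + q < card U" if "pos y = pos x + q"
      using r that parity by presburger
    ultimately show ?thesis using True xy by (simp add: shift_mat_index U_iff)
  next
    case False
    then show ?thesis using xy by (auto simp: shift_mat_index U_iff)
  qed
qed (rule shift_mat_carrier)

text \<open>Only one path of \<open>i\<close> steps, each of length \<open>q\<close>, leads from
  \<open>x\<close> to \<open>y\<close>, so the signs cannot cancel.\<close>

lemma shift_mat_pow_index:
  assumes "x \<in> U" and "y \<in> U"
  shows "(shift_mat ^\<^sub>m i) $$ (x, y) \<noteq> 0 \<longleftrightarrow> pos y = pos x + i * q"
  using assms(2)
proof (induction i arbitrary: y)
  case 0
  have "x \<le> 2*n" "y \<le> 2*n" using assms(1) 0 U by auto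
  moreover have "dim_row shift_mat = 2*n+1" using shift_mat_carrier by blast
  ultimately show ?case using inj_on_eq_iff[OF pos_inj 0 assms(1)] by auto
next
  case (Suc i)
  have xy: "x \<le> 2*n" "y \<le> 2*n" using assms(1) Suc.prems U by auto
  note c = pow_carrier_mat[OF shift_mat_carrier, of i]
  have eq: "(shift_mat ^\<^sub>m Suc i) $$ (x, y) = (\<Sum>z\<le>2*n. (shift_mat ^\<^sub>m i) $$ (x, z) * shift_mat $$ (z, y))"
    using mult_mat_index[OF c shift_mat_carrier xy] by simp
  have nz: "(shift_mat ^\<^sub>m i) $$ (x, z) * shift_mat $$ (z, y) \<noteq> 0 \<longleftrightarrow>
      z \<in> U \<and> pos z = pos x + i * q \<and> pos y = pos z + q" if "z \<le> 2*n" for z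
    using that xy Suc by (auto simp: shift_mat_index)
  show ?case
  proof (cases "pos y = pos x + Suc i * q")
    case True
    have "pos x + i * q < card U" using True pos_less[OF Suc.prems] by simp
    then obtain z where z: "z \<in> U" "pos z = pos x + i * q" by (rule pos_surj)
    have z2: "z \<le> 2*n" using z U by auto
    have "(\<Sum>z'\<le>2*n. (shift_mat ^\<^sub>m i) $$ (x, z') * shift_mat $$ (z', y))
        = (\<Sum>z'\<in>{z}. (shift_mat ^\<^sub>m i) $$ (x, z') * shift_mat $$ (z', y))"
    proof (rule sum.mono_neutral_right)
      show "\<forall>z'\<in>{..2*n} - {z}. (shift_mat ^\<^sub>m i) $$ (x, z') * shift_mat $$ (z', y) = 0"
        using nz inj_on_eq_iff[OF pos_inj _ z(1)] z(2) by fastforce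
    qed (use z2 in auto)
    then show ?thesis using eq nz[OF z2] z True by simp
  next
    case False
    have "(\<Sum>z\<le>2*n. (shift_mat ^\<^sub>m i) $$ (x, z) * shift_mat $$ (z, y)) = 0"
      by (rule sum.neutral) (use nz False in force)
    then show ?thesis using eq False by simp
  qed
qed

lemma shift_mat_rank: "rank_ge (shift_mat ^\<^sub>m i) (card U - i * q)"
proof -
  have "\<forall>a. \<exists>x. a < card U \<longrightarrow> x \<in> U \<and> pos x = a" using pos_surj by metis
  from choice[OF this] obtain e where e: "\<And>a. a < card U \<Longrightarrow> e a \<in> U \<and> pos (e a) = a" by auto
  have dims: "dim_row (shift_mat ^\<^sub>m i) = 2*n+1" "dim_col (shift_mat ^\<^sub>m i) = 2*n+1"
    using pow_carrier_mat[OF shift_mat_carrier, of i] by auto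
  have e2: "e a < 2*n+1" if "a < card U" for a using e[OF that] U by force
  show ?thesis
  proof (rule rank_ge_monomial[of _ e _ "\<lambda>a. e (a + i * q)" "\<lambda>a. (shift_mat ^\<^sub>m i) $$ (e a, e (a + i * q))"])
    fix a assume a: "a < card U - i * q"
    then have a2: "a < card U" "a + i * q < card U" by auto
    show "e a < dim_row (shift_mat ^\<^sub>m i)" "e (a + i * q) < dim_col (shift_mat ^\<^sub>m i)"
      unfolding dims using e2 a2 by auto
    show "(shift_mat ^\<^sub>m i) $$ (e a, e (a + i * q)) \<noteq> 0"
      using shift_mat_pow_index[of "e a" "e (a + i * q)" i] e a2 by simp
    fix b assume "b < card U - i * q"
    then have b2: "b + i * q < card U" by auto
    show "(shift_mat ^\<^sub>m i) $$ (e a, e (b + i * q)) = (if a = b then (shift_mat ^\<^sub>m i) $$ (e a, e (a + i * q)) else 0)"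
      using shift_mat_pow_index[of "e a" "e (b + i * q)" i] e a2 b2 by auto
  qed
qed

text \<open>A nonzero entry jumps over \<open>q\<close> places, so \<open>q + 1\<close> elements of
  \<open>U\<close> lie from \<open>x\<close> through \<open>y\<close>. They cannot all belong to one
  block.\<close>

lemma shift_mat_block_nilpotent:
  assumes mono: "\<And>i j. i \<le> j \<Longrightarrow> j \<le> 2*n \<Longrightarrow> blk i \<le> (blk j :: nat)"
    and small: "\<And>b. card {c \<in> U. blk c = b} \<le> q"
  shows "shift_mat \<in> block_nilpotent n blk"
proof -
  have "shift_mat $$ (x, y) = 0" if xy: "x \<le> 2*n" "y \<le> 2*n" and le: "blk y \<le> blk x" for x y
  proof (rule ccontr)
    assume "shift_mat $$ (x, y) \<noteq> 0"
    then have U: "x \<in> U" "y \<in> U" and p: "pos y = pos x + q"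
      using xy by (auto simp: shift_mat_index split: if_splits)
    have "x \<le> y" using pos_strict[OF U(2), of x] p by (cases "x \<le> y") auto
    have sub: "{u \<in> U. x \<le> u \<and> u \<le> y} \<subseteq> {c \<in> U. blk c = blk y}"
      using mono le xy by (auto intro!: antisym intro: order.trans)
    have "{u \<in> U. u < y} = {u \<in> U. u < x} \<union> {u \<in> U. x \<le> u \<and> u < y}" using \<open>x \<le> y\<close> by auto
    then have "pos y = pos x + card {u \<in> U. x \<le> u \<and> u < y}"
      unfolding pos_def using finite_U by (simp add: card_Un_disjoint disjoint_iff)
    moreover have "{u \<in> U. x \<le> u \<and> u \<le> y} = insert y {u \<in> U. x \<le> u \<and> u < y}"
      using \<open>x \<le> y\<close> U by auto
    then have "card {u \<in> U. x \<le> u \<and> u \<le> y} = Suc (card {u \<in> U. x \<le> u \<and> u < y})"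
      using finite_U by simp
    ultimately have "q < card {u \<in> U. x \<le> u \<and> u \<le> y}" using p by simp
    also have "\<dots> \<le> card {c \<in> U. blk c = blk y}" by (rule card_mono[OF _ sub]) (simp add: finite_U)
    finally show False using small[of "blk y"] by simp
  qed
  then show ?thesis using shift_mat_so_odd by (simp add: block_nilpotent_def)
qed

end

section \<open>The blocks of a parabolic of type B\<close>

text \<open>The flag stabilised by the parabolic has blocks of sizes \<open>ns\<close>, then \<open>2m + 1\<close>, then \<open>ns\<close> reversed.\<close>

locale composition =
  fixes ns :: "nat list" and m :: nat
  assumes pos: "x \<in> set ns \<Longrightarrow> 0 < x"
begin

definition psum :: "nat \<Rightarrow> nat" where "psum t = sum_list (take t ns)"

definition rk :: nat where "rk = sum_list ns + m"

text \<open>Counts the positions up to \<open>c\<close> at which a new block starts: at the partial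
  sums in the first half, at their mirror images shifted by one in the second.\<close>

definition blk :: "nat \<Rightarrow> nat" where
  "blk c = card {t \<in> {1..length ns}. psum t \<le> c} + card {t \<in> {1..length ns}. 2*rk + 1 - psum t \<le> c}"

definition block :: "nat \<Rightarrow> nat set" where "block b = {c. c \<le> 2*rk \<and> blk c = b}"

lemma psum_Suc: "t < length ns \<Longrightarrow> psum (Suc t) = psum t + ns ! t"
  by (simp add: psum_def take_Suc_conv_app_nth)

lemma psum_mono: "t \<le> t' \<Longrightarrow> psum t \<le> psum t'"
proof -
  assume "t \<le> t'"
  then have "take t' ns = take t ns @ take (t' - t) (drop t ns)"
    by (metis le_add_diff_inverse take_add)
  then show ?thesis by (simp add: psum_def)
qed

lemma psum_strict:
  assumes "t < t'" and "t' \<le> length ns"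
  shows "psum t < psum t'"
proof -
  have "psum t < psum (Suc t)" using psum_Suc[of t] pos[of "ns ! t"] assms by simp
  also have "\<dots> \<le> psum t'" using assms by (intro psum_mono) simp
  finally show ?thesis .
qed

lemma psum_length: "psum (length ns) = sum_list ns"
  by (simp add: psum_def)

lemma psum_le: "psum t \<le> sum_list ns"
  using psum_mono[of t "max t (length ns)"] by (simp add: psum_def)

lemma psum_0: "psum 0 = 0"
  by (simp add: psum_def)

lemma blk_mono: "i \<le> j \<Longrightarrow> blk i \<le> blk j"
  unfolding blk_def by (intro add_mono card_mono) auto

text \<open>A block start is passed at the mirror image of \<open>c\<close> exactly when the
  mirrored start is not yet passed at \<open>c\<close>, so the two counts are complementary.\<close>

lemma blk_reflect:
  assumes "c \<le> 2*rk"
  shows "blk (2*rk - c) + blk c = 2 * length ns"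
proof -
  let ?T = "{1..length ns}"
  have le: "psum t \<le> rk" for t using psum_le[of t] by (simp add: rk_def)
  have compl: "card (?T - A) + card A = length ns" if "A \<subseteq> ?T" for A
    using card_mono[OF _ that] finite_subset[OF that] that by (simp add: card_Diff_subset)
  have 1: "{t \<in> ?T. psum t \<le> 2*rk - c} = ?T - {t \<in> ?T. 2*rk + 1 - psum t \<le> c}"
    using assms le by auto
  have 2: "{t \<in> ?T. 2*rk + 1 - psum t \<le> 2*rk - c} = ?T - {t \<in> ?T. psum t \<le> c}"
    using assms le by auto
  have "card {t \<in> ?T. psum t \<le> 2*rk - c} + card {t \<in> ?T. 2*rk + 1 - psum t \<le> c} = length ns"
    unfolding 1 by (rule compl) auto
  moreover have "card {t \<in> ?T. 2*rk + 1 - psum t \<le> 2*rk - c} + card {t \<in> ?T. psum t \<le> c} = length ns"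
    unfolding 2 by (rule compl) auto
  ultimately show ?thesis by (simp add: blk_def)
qed

lemma psum_locate:
  assumes "c < sum_list ns"
  obtains b where "b < length ns" and "psum b \<le> c" and "c < psum (Suc b)"
proof -
  define P where "P b \<longleftrightarrow> c < psum (Suc b)" for b
  have "ns \<noteq> []" using assms by auto
  then have "P (length ns - 1)" using assms by (simp add: P_def psum_length)
  then have L: "P (LEAST b. P b)" "(LEAST b. P b) \<le> length ns - 1" by (auto intro: LeastI Least_le)
  have "psum (LEAST b. P b) \<le> c"
  proof (cases "LEAST b. P b")
    case (Suc b)
    then have "\<not> P b" using not_less_Least[of b P] by simp
    then show ?thesis using Suc by (simp add: P_def)
  qed (simp add: psum_0)
  moreover have "(LEAST b. P b) < length ns" using L(2) \<open>ns \<noteq> []\<close> by (cases ns) auto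
  ultimately show ?thesis using that L(1) unfolding P_def by blast
qed

lemma blk_lower_half:
  assumes b: "b < length ns" and c: "psum b \<le> c" "c < psum (Suc b)"
  shows "blk c = b"
proof -
  have "c < sum_list ns" using c psum_le[of "Suc b"] by simp
  then have "c < 2*rk + 1 - psum t" for t using psum_le[of t] by (simp add: rk_def)
  then have "{t \<in> {1..length ns}. 2*rk + 1 - psum t \<le> c} = {}"
    by (auto simp: not_le)
  moreover have "{t \<in> {1..length ns}. psum t \<le> c} = {1..b}"
  proof -
    have "t \<le> b" if "psum t \<le> c" for t
      using psum_mono[of "Suc b" t] that c by (cases "t \<le> b") auto
    moreover have "psum t \<le> c" if "t \<le> b" for t using psum_mono[OF that] c by simp
    ultimately show ?thesis using b by force
  qed
  ultimately show ?thesis by (simp add: blk_def)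
qed

lemma blk_middle:
  assumes "sum_list ns \<le> c" and "c \<le> 2*rk - sum_list ns"
  shows "blk c = length ns"
proof -
  have "{t \<in> {1..length ns}. psum t \<le> c} = {1..length ns}" using assms psum_le le_trans by blast
  moreover have "2*rk + 1 - psum t > c" for t
    using psum_le[of t] assms by (simp add: rk_def)
  then have "{t \<in> {1..length ns}. 2*rk + 1 - psum t \<le> c} = {}" by (auto simp: not_le)
  ultimately show ?thesis by (simp add: blk_def)
qed

lemma block_lower:
  assumes b: "b < length ns"
  shows "block b = {psum b..<psum (Suc b)}"
proof
  show "{psum b..<psum (Suc b)} \<subseteq> block b"
    using blk_lower_half[OF b] psum_le[of "Suc b"] by (auto simp: block_def rk_def)
  show "block b \<subseteq> {psum b..<psum (Suc b)}"
  proof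
    fix c assume c: "c \<in> block b"
    have "c < sum_list ns"
    proof (rule ccontr)
      assume "\<not> c < sum_list ns"
      then have "blk (sum_list ns) \<le> blk c" by (intro blk_mono) simp
      moreover have "blk (sum_list ns) = length ns" by (rule blk_middle) (auto simp: rk_def)
      ultimately show False using c b by (simp add: block_def)
    qed
    then obtain b' where "b' < length ns" "psum b' \<le> c" "c < psum (Suc b')" by (rule psum_locate)
    moreover from this have "b' = b" using blk_lower_half c by (simp add: block_def)
    ultimately show "c \<in> {psum b..<psum (Suc b)}" by simp
  qed
qed

lemma block_reflect: "c \<in> block b \<Longrightarrow> 2*rk - c \<in> block (2 * length ns - b)"
  using blk_reflect[of c] by (auto simp: block_def)

lemma block_middle: "block (length ns) = {sum_list ns..2*rk - sum_list ns}"
proof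
  show "{sum_list ns..2*rk - sum_list ns} \<subseteq> block (length ns)"
    using blk_middle by (auto simp: block_def)
  have low: "sum_list ns \<le> c" if c: "c \<in> block (length ns)" for c
  proof (rule ccontr)
    assume "\<not> sum_list ns \<le> c"
    then obtain b where "b < length ns" "psum b \<le> c" "c < psum (Suc b)" using psum_locate[of c] by auto
    then show False using blk_lower_half[of b c] c by (simp add: block_def)
  qed
  show "block (length ns) \<subseteq> {sum_list ns..2*rk - sum_list ns}"
  proof
    fix c assume c: "c \<in> block (length ns)"
    have "2*rk - c \<in> block (length ns)" using block_reflect[OF c] by simp
    then have "sum_list ns \<le> 2*rk - c" by (rule low)
    then show "c \<in> {sum_list ns..2*rk - sum_list ns}"
      using low[OF c] c by (auto simp: block_def)
  qed
qed

lemma finite_block: "finite (block b)"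
  unfolding block_def by (rule finite_subset[of _ "{..2*rk}"]) auto

lemma card_block_reflect:
  assumes "b \<le> 2 * length ns"
  shows "card (block (2 * length ns - b)) = card (block b)"
proof (rule bij_betw_same_card[symmetric])
  show "bij_betw (\<lambda>c. 2*rk - c) (block b) (block (2 * length ns - b))"
  proof (rule bij_betw_byWitness[of _ "\<lambda>c. 2*rk - c"])
    show "(\<lambda>c. 2*rk - c) ` block (2 * length ns - b) \<subseteq> block b"
      using block_reflect[of _ "2 * length ns - b"] assms by auto
  qed (use block_reflect in \<open>auto simp: block_def\<close>)
qed

lemma card_block:
  "b < length ns \<Longrightarrow> card (block b) = ns ! b"
  "card (block (length ns)) = 2*m + 1"
  using block_lower[of b] psum_Suc[of b] block_middle by (auto simp: rk_def)

lemma sum_upto_reflect: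
  "(\<Sum>b\<le>2 * length ns. g b) = g (length ns) + (\<Sum>b<length ns. g b) + (\<Sum>b<length ns. g (2 * length ns - b))"
  for g :: "nat \<Rightarrow> nat"
proof -
  have "{..2 * length ns} = insert (length ns) ({..<length ns} \<union> {length ns<..2 * length ns})" by auto
  then have "(\<Sum>b\<le>2 * length ns. g b)
      = g (length ns) + ((\<Sum>b<length ns. g b) + (\<Sum>b\<in>{length ns<..2 * length ns}. g b))"
    by (simp only:) (subst sum.insert, auto intro!: sum.union_disjoint)
  also have "(\<Sum>b\<in>{length ns<..2 * length ns}. g b) = (\<Sum>b<length ns. g (2 * length ns - b))"
    by (rule sum.reindex_bij_witness[of _ "\<lambda>b. 2 * length ns - b" "\<lambda>b. 2 * length ns - b"]) auto
  finally show ?thesis by simp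
qed

lemma sum_block_sizes:
  "(\<Sum>b\<le>2 * length ns. f (card (block b))) = f (2*m + 1) + 2 * (\<Sum>x\<leftarrow>ns. f x)"
  for f :: "nat \<Rightarrow> nat"
proof -
  have "(\<Sum>b<length ns. f (card (block b))) = (\<Sum>x\<leftarrow>ns. f x)"
    by (simp add: card_block sum_list_sum_nth atLeast0LessThan)
  moreover have "(\<Sum>b<length ns. f (card (block (2 * length ns - b)))) = (\<Sum>b<length ns. f (card (block b)))"
    by (rule sum.cong) (simp_all add: card_block_reflect)
  ultimately show ?thesis
    using sum_upto_reflect[of "\<lambda>b. f (card (block b))"] by (simp add: card_block)
qed

text \<open>This is the length of row \<open>j\<close> in the diagram whose columns are the block
  sizes.\<close>

lemma card_block_ge:
  assumes "1 \<le> j"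
  shows "card {b. b \<le> 2 * length ns \<and> j \<le> card (block b)}
    = (if j \<le> 2*m + 1 then 1 else 0) + 2 * length (filter (\<lambda>x. j \<le> x) ns)"
proof -
  have "card {b. b \<le> 2 * length ns \<and> j \<le> card (block b)}
      = (\<Sum>b\<in>{b. b \<le> 2 * length ns \<and> j \<le> card (block b)}. 1)" by simp
  also have "\<dots> = (\<Sum>b\<le>2 * length ns. if j \<le> card (block b) then 1 else 0)"
    by (rule sum.mono_neutral_cong_left) auto
  also have "\<dots> = (if j \<le> 2*m + 1 then 1 else 0) + 2 * (\<Sum>x\<leftarrow>ns. if j \<le> x then 1 else 0)"
    by (rule sum_block_sizes)
  also have "(\<Sum>x\<leftarrow>ns. if j \<le> x then 1 else (0 :: nat)) = length (filter (\<lambda>x. j \<le> x) ns)"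
    by (induction ns) auto
  finally show ?thesis .
qed

lemma card_by_blocks:
  assumes "A \<subseteq> {..2*rk}"
  shows "card A = (\<Sum>b\<le>2 * length ns. card (A \<inter> block b))"
proof -
  have "A = (\<Union>b\<in>{..2 * length ns}. A \<inter> block b)"
  proof -
    have "c \<in> block (blk c)" "blk c \<le> 2 * length ns" if "c \<in> A" for c
      using that assms blk_reflect[of c] by (auto simp: block_def)
    then show ?thesis by blast
  qed
  then have "card A = card (\<Union>b\<in>{..2 * length ns}. A \<inter> block b)" by simp
  also have "\<dots> = (\<Sum>b\<le>2 * length ns. card (A \<inter> block b))"
    using finite_block by (intro card_UN_disjoint) (auto simp: block_def)
  finally show ?thesis .
qed

text \<open>For even \<open>q\<close> the middle index \<open>rk\<close> is left out to get the parity right.\<close>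

lemma middle_subset:
  obtains T where "T \<subseteq> block (length ns)" and "\<And>c. c \<in> T \<Longrightarrow> 2*rk - c \<in> T" and "card T \<le> q"
    and "even (card T + q)" and "min (2*m + 1) q \<le> card T + (if odd q \<or> q \<le> 2*m + 1 then 0 else 1)"
proof -
  \<comment> \<open>Radius of an interval about the middle index that fits into the middle block.
    For odd \<open>q\<close> its \<open>2 * h + 1\<close> elements number exactly
    \<open>min (2*m + 1) q\<close>.\<close>
  define h where "h = min m (q div 2)"
  define J where "J = {rk - h..rk + h}"
  have h: "h \<le> m" "h \<le> rk" by (auto simp: rk_def h_def)
  have "sum_list ns + h \<le> rk" using h by (simp add: rk_def)
  then have sub: "J \<subseteq> block (length ns)" by (auto simp: block_middle J_def)
  have card: "card J = 2 * h + 1" using h by (simp add: J_def)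
  have sym: "2*rk - c \<in> J" if "c \<in> J" for c using that h(2) by (auto simp: J_def)
  show ?thesis
  proof (cases "odd q")
    case True
    then obtain a where q: "q = 2 * a + 1" by (rule oddE)
    have "min (2*m + 1) q \<le> card J" "card J \<le> q" "even (card J + q)"
      unfolding card h_def q by (simp_all add: min_def)
    then show ?thesis using that[OF sub sym] by simp
  next
    case False
    then obtain a where q: "q = 2 * a" using evenE by blast
    have "rk \<in> J" by (simp add: J_def)
    \<comment> \<open>For even \<open>q\<close> there remain \<open>min (2*m) q\<close> elements,
      one below \<open>min (2*m + 1) q\<close> only if \<open>q > 2*m + 1\<close>.\<close>
    then have card': "card (J - {rk}) = 2 * h" using card by (simp add: J_def)
    have sym': "2*rk - c \<in> J - {rk}" if "c \<in> J - {rk}" for c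
    proof -
      have "c \<le> 2*rk" using that h(2) by (simp add: J_def)
      then show ?thesis using sym[of c] that by auto
    qed
    have le: "min (2*m + 1) q \<le> card (J - {rk}) + (if odd q \<or> q \<le> 2*m + 1 then 0 else 1)"
    proof (cases "q \<le> 2*m + 1")
      case True
      then have "a \<le> m" using q by presburger
      then show ?thesis unfolding card' h_def q by (simp add: min_def)
    next
      case False
      then show ?thesis unfolding card' h_def q by (simp add: min_def)
    qed
    have "card (J - {rk}) \<le> q" "even (card (J - {rk}) + q)"
      unfolding card' h_def q by (simp_all add: min_def)
    moreover have "J - {rk} \<subseteq> block (length ns)" using sub by blast
    ultimately show ?thesis using that[OF _ sym'] le by blast
  qed
qed

text \<open>The other blocks come in mirror pairs: any \<open>min (card (block b)) q\<close>
  elements are chosen in one and reflected into its partner. They contribute an even number, so the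
  middle block alone decides the parity.\<close>

lemma obtain_symmetric_subset:
  obtains U where "symmetric_subset rk q U" and "\<And>b. card {c \<in> U. blk c = b} \<le> q"
    and "(\<Sum>b\<le>2 * length ns. min (card (block b)) q) \<le> card U + (if odd q \<or> q \<le> 2*m + 1 then 0 else 1)"
proof -
  obtain Tm where Tm: "Tm \<subseteq> block (length ns)" and Tm_sym: "\<And>c. c \<in> Tm \<Longrightarrow> 2*rk - c \<in> Tm"
    and Tm_q: "card Tm \<le> q" and Tm_par: "even (card Tm + q)"
    and Tm_card: "min (2*m + 1) q \<le> card Tm + (if odd q \<or> q \<le> 2*m + 1 then 0 else 1)"
    by (rule middle_subset[of q]) (rule that)
  have "\<exists>T. T \<subseteq> block b \<and> card T = min (card (block b)) q" for b
    by (metis min.cobounded1 obtain_subset_with_card_n)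
  then obtain T where T: "\<And>b. T b \<subseteq> block b" "\<And>b. card (T b) = min (card (block b)) q" by metis
  define R where "R c = 2*rk - c" for c
  define V where "V b = (if b < length ns then T b else if b = length ns then Tm
    else if b \<le> 2 * length ns then R ` T (2 * length ns - b) else {})" for b
  have R_inj: "inj_on R (block b)" for b by (auto simp: R_def block_def inj_on_def)
  have Vb: "V b \<subseteq> block b" for b
  proof -
    have "R c \<in> block b" if "c \<in> T (2 * length ns - b)" "b \<le> 2 * length ns" for c
      using block_reflect[of c "2 * length ns - b"] T(1) that by (auto simp: R_def)
    then show ?thesis using T(1) Tm by (auto simp: V_def)
  qed
  have V_sym: "2*rk - c \<in> V (2 * length ns - b)" if "c \<in> V b" "b \<le> 2 * length ns" for c b
  proof -
    have "2*rk - R d = d" if "d \<in> block b'" for d b' using that by (simp add: R_def block_def)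
    then show ?thesis using that T(1) Tm_sym
      by (cases "b < length ns"; cases "b = length ns") (fastforce simp: V_def R_def)+
  qed
  have V_card: "card (V b) = min (card (block b)) q" if "b \<noteq> length ns" "b \<le> 2 * length ns" for b
    using that T(2)[of b] T(2)[of "2 * length ns - b"] card_block_reflect[OF that(2)]
      card_image[OF inj_on_subset[OF R_inj T(1)], of "2 * length ns - b"]
    by (auto simp: V_def)
  define U where "U = (\<Union>b\<le>2 * length ns. V b)"
  have UV: "U \<inter> block b = V b" if "b \<le> 2 * length ns" for b
    using Vb that by (fastforce simp: U_def block_def)
  have sub: "U \<subseteq> {..2*rk}" using Vb by (fastforce simp: U_def block_def)
  have cardU: "card U = card Tm + 2 * (\<Sum>b<length ns. min (card (block b)) q)"
  proof -
    have "card U = (\<Sum>b\<le>2 * length ns. card (V b))"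
      unfolding card_by_blocks[OF sub] by (rule sum.cong) (auto simp: UV)
    also have "\<dots> = card Tm + (\<Sum>b<length ns. card (V b)) + (\<Sum>b<length ns. card (V (2 * length ns - b)))"
      unfolding sum_upto_reflect by (simp add: V_def)
    also have "(\<Sum>b<length ns. card (V b)) = (\<Sum>b<length ns. min (card (block b)) q)"
      by (rule sum.cong) (auto simp: V_card)
    also have "(\<Sum>b<length ns. card (V (2 * length ns - b))) = (\<Sum>b<length ns. min (card (block b)) q)"
      by (rule sum.cong) (auto simp: V_card card_block_reflect)
    finally show ?thesis by simp
  qed
  show ?thesis
  proof (rule that[of U])
    show "symmetric_subset rk q U"
    proof
      show "U \<subseteq> {..2*rk}" by (rule sub)
      show "2*rk - c \<in> U" if "c \<in> U" for c
      proof -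
        from that obtain b where b: "b \<le> 2 * length ns" "c \<in> V b" by (auto simp: U_def)
        have "2 * length ns - b \<in> {..2 * length ns}" by simp
        then show ?thesis using V_sym[OF b(2,1)] unfolding U_def by blast
      qed
      show "even (card U + q)" using Tm_par by (simp add: cardU)
    qed
    show "card {c \<in> U. blk c = b} \<le> q" for b
    proof (cases "b \<le> 2 * length ns")
      case True
      have "{c \<in> U. blk c = b} = V b" using UV[OF True] sub by (auto simp: block_def)
      then show ?thesis using V_card[of b] True Tm_q by (cases "b = length ns") (auto simp: V_def)
    next
      case False
      have "blk c \<le> 2 * length ns" if "c \<in> U" for c using that sub blk_reflect[of c] by auto
      then have empty: "{c \<in> U. blk c = b} = {}" using False by auto
      show ?thesis unfolding empty by simp
    qed
    have "(\<Sum>b<length ns. min (card (block (2 * length ns - b))) q) = (\<Sum>b<length ns. min (card (block b)) q)"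
      by (rule sum.cong) (auto simp: card_block_reflect)
    then have "(\<Sum>b\<le>2 * length ns. min (card (block b)) q)
      = min (2*m + 1) q + 2 * (\<Sum>b<length ns. min (card (block b)) q)"
      unfolding sum_upto_reflect by (simp add: card_block)
    then show "(\<Sum>b\<le>2 * length ns. min (card (block b)) q)
      \<le> card U + (if odd q \<or> q \<le> 2*m + 1 then 0 else 1)"
      using Tm_card by (simp add: cardU)
  qed
qed

text \<open>The rank bound is attained by taking for \<open>S\<close> the \<open>i\<close> largest blocks.\<close>

lemma block_nilpotent_rank_le:
  assumes P: "sorted_wrt (\<ge>) P"
    and cols: "\<And>j. 1 \<le> j \<Longrightarrow> part P j = (if j \<le> 2*m + 1 then 1 else 0) + 2 * length (filter (\<lambda>x. j \<le> x) ns)"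
    and X: "X \<in> block_nilpotent rk blk"
  shows "rank_le (X ^\<^sub>m i) (excess i P)"
proof -
  let ?B = "{..2 * length ns}"
  let ?ge = "\<lambda>j. {b. b \<le> 2 * length ns \<and> j \<le> card (block b)}"
  have Xc: "X \<in> carrier_mat (2*rk + 1) (2*rk + 1)"
    using X so_odd_carrier by (simp add: block_nilpotent_def)
  have up: "X $$ (a, b) = 0" if "a < 2*rk + 1" "b < 2*rk + 1" "blk b \<le> blk a" for a b
    using X that by (simp add: block_nilpotent_def)
  have ge: "card (?ge j) = part P j" if "1 \<le> j" for j
    using card_block_ge[OF that] cols[OF that] by simp
  have fin: "finite (?ge j)" for j by simp
  obtain l where l1: "\<And>j. 1 \<le> j \<Longrightarrow> j \<le> l \<Longrightarrow> i < part P j" and l2: "\<And>j. l < j \<Longrightarrow> part P j \<le> i"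
    using obtain_part_threshold[OF P] by metis
  \<comment> \<open>\<open>S\<close> takes all blocks larger than \<open>l\<close> and fills up with
    blocks of size \<open>l\<close>, which is possible since part \<open>l + 1\<close> is at most
    \<open>i\<close> and part \<open>l\<close> exceeds it. For \<open>l = 0\<close> there are at
    most \<open>i\<close> nonempty blocks; \<open>S\<close> takes them all and the rank bound is
    0.\<close>
  have "\<exists>S. S \<subseteq> ?B \<and> ?ge (Suc l) \<subseteq> S \<and> S \<subseteq> ?ge l \<and> card S \<le> i \<and> (1 \<le> l \<longrightarrow> card S = i)"
  proof (cases "l = 0")
    case True
    then show ?thesis using ge[of 1] l2[of 1] by (intro exI[of _ "?ge 1"]) auto
  next
    case False
    then have "card (?ge (Suc l)) \<le> i" "i \<le> card (?ge l)"
      using ge[of l] ge[of "Suc l"] l1[of l] l2[of "Suc l"] by auto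
    moreover have "?ge (Suc l) \<subseteq> ?ge l" by auto
    ultimately obtain S where S: "?ge (Suc l) \<subseteq> S" "S \<subseteq> ?ge l" "card S = i"
      using exists_subset_between[of "?ge (Suc l)" i "?ge l"] by auto
    then show ?thesis by (intro exI[of _ S]) auto
  qed
  then obtain S where S: "S \<subseteq> ?B" "?ge (Suc l) \<subseteq> S" "S \<subseteq> ?ge l" "card S \<le> i" "1 \<le> l \<Longrightarrow> card S = i"
    by blast
  have finS: "finite S" using S(1) finite_subset by blast
  have "card {c. c < 2*rk + 1 \<and> blk c \<notin> S} = (\<Sum>b\<in>?B - S. card (block b))"
  proof -
    have "card {c. c < 2*rk + 1 \<and> blk c \<notin> S}
        = (\<Sum>b\<le>2 * length ns. card ({c. c < 2*rk + 1 \<and> blk c \<notin> S} \<inter> block b))"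
      by (rule card_by_blocks) auto
    also have "\<dots> = (\<Sum>b\<in>?B - S. card (block b))"
    proof (rule sum.mono_neutral_cong_right)
      show "card ({c. c < 2*rk + 1 \<and> blk c \<notin> S} \<inter> block b) = card (block b)" if "b \<in> ?B - S" for b
        using that by (intro arg_cong[of _ _ card]) (auto simp: block_def)
      show "\<forall>b\<in>?B - (?B - S). card ({c. c < 2*rk + 1 \<and> blk c \<notin> S} \<inter> block b) = 0"
        by (auto simp: block_def)
    qed auto
    finally show ?thesis .
  qed
  also have "\<dots> + i * l = (\<Sum>b\<in>?B - S. min (card (block b)) l) + (\<Sum>b\<in>S. min (card (block b)) l)"
  proof -
    \<comment> \<open>Blocks outside \<open>S\<close> have size at most \<open>l\<close>, those
      inside at least \<open>l\<close>; both sums are thus cut off at \<open>l\<close>.\<close>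
    have a: "(\<Sum>b\<in>?B - S. card (block b)) = (\<Sum>b\<in>?B - S. min (card (block b)) l)"
      by (rule sum.cong) (use S(2) in \<open>force simp: min_def\<close>)+
    have "(\<Sum>b\<in>S. min (card (block b)) l) = (\<Sum>b\<in>S. l)"
      by (rule sum.cong) (use S(3) in auto)
    then have "(\<Sum>b\<in>S. min (card (block b)) l) = card S * l" by simp
    moreover have "card S * l = i * l" using S(5) by (cases l) simp_all
    ultimately show ?thesis using a by linarith
  qed
  also have "\<dots> = (\<Sum>b\<le>2 * length ns. min (card (block b)) l)"
    using S(1) by (intro sum.subset_diff[symmetric]) auto
  also have "\<dots> = (\<Sum>j = 1..l. part P j)"
    using sum_part_columns[OF cols, of l] sum_block_sizes[of "\<lambda>x. min x l"] by simp
  also have "\<dots> = excess i P + i * l"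
    by (rule sum_part_eq_excess) (use l1 l2 in \<open>auto simp: less_imp_le\<close>)
  finally have "card {c. c < 2*rk + 1 \<and> blk c \<notin> S} = excess i P" by simp
  then show ?thesis using rank_le_block_pow[where blk = blk, OF Xc up finS S(4)] by simp
qed

lemma block_nilpotent_rank_ge:
  assumes cols: "\<And>j. 1 \<le> j \<Longrightarrow> part P j = (if j \<le> 2*m + 1 then 1 else 0) + 2 * length (filter (\<lambda>x. j \<le> x) ns)"
  obtains Y r where "Y \<in> block_nilpotent rk blk" and "rank_ge (Y ^\<^sub>m i) r"
    and "(\<Sum>j = 1..q. part P j) \<le> r + i * q + (if odd q \<or> q \<le> 2*m + 1 then 0 else 1)"
proof -
  obtain U where U: "symmetric_subset rk q U" and small: "\<And>b. card {c \<in> U. blk c = b} \<le> q"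
    and card: "(\<Sum>b\<le>2 * length ns. min (card (block b)) q) \<le> card U + (if odd q \<or> q \<le> 2*m + 1 then 0 else 1)"
    using obtain_symmetric_subset[of q] by blast
  interpret symmetric_subset rk q U by (rule U)
  have "(\<Sum>j = 1..q. part P j) = (\<Sum>b\<le>2 * length ns. min (card (block b)) q)"
    using sum_part_columns[OF cols, of q] sum_block_sizes[of "\<lambda>x. min x q"] by simp
  then show ?thesis
    using that[OF shift_mat_block_nilpotent[OF blk_mono small] shift_mat_rank[of i]] card by simp
qed

end

text \<open>For \<open>r \<le> n\<close> the count \<open>blk\<close> jumps between
  \<open>r - 1\<close> and \<open>r\<close> exactly when \<open>r\<close> is a partial sum, that is,
  when the \<open>r\<close>-th simple root is missing from \<open>I\<close>.\<close>

lemma (in composition) parabolic_blocks_blk: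
  assumes type: "parabolic_type n I xs" and xs: "butlast xs = ns" "last xs = m"
  shows "n = rk" and "parabolic_blocks n I blk (2 * length ns)"
proof -
  have "xs \<noteq> []" using type by (simp add: parabolic_type_def)
  then have xs': "xs = ns @ [m]" using xs append_butlast_last_id by metis
  show n: "n = rk" using type by (simp add: parabolic_type_def xs' rk_def)
  have I: "I \<subseteq> simple_roots n" using type by (simp add: parabolic_type_def)
  have "sum_list (take t xs) = psum t" if "t \<le> length ns" for t
    using that by (simp add: xs' psum_def)
  then have "(\<lambda>t. simple_root n (sum_list (take t xs))) ` {1..length ns} = simple_root n ` psum ` {1..length ns}"
    unfolding image_image by (intro image_cong) auto
  moreover have "{t. 1 \<le> t \<and> t < length xs} = {1..length ns}" by (auto simp: xs')
  ultimately have diff: "simple_roots n - I = simple_root n ` psum ` {1..length ns}"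
    using type by (simp add: parabolic_type_def setcompr_eq_image)
  have psum_range: "psum ` {1..length ns} \<subseteq> {1..n}"
  proof (intro image_subsetI)
    fix t assume "t \<in> {1..length ns}"
    then have "0 < psum t" using psum_strict[of 0 t] by (simp add: psum_0)
    then show "psum t \<in> {1..n}" using psum_le[of t] by (simp add: n rk_def)
  qed
  have cut: "simple_root n r \<in> I \<longleftrightarrow> blk (r - 1) = blk r" if r: "1 \<le> r" "r \<le> n" for r
  proof -
    let ?A = "\<lambda>c. {t \<in> {1..length ns}. psum t \<le> c}"
    have "c < 2*rk + 1 - psum t" if "c \<le> n" for c t
      using that psum_le[of t] by (simp add: n rk_def)
    then have "{t \<in> {1..length ns}. 2*rk + 1 - psum t \<le> c} = {}" if "c \<le> n" for c
      using that by (auto simp: not_le)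
    then have blk: "blk c = card (?A c)" if "c \<le> n" for c using that by (simp add: blk_def)
    have sub: "?A (r - 1) \<subseteq> ?A r" by auto
    have "simple_root n r \<in> I \<longleftrightarrow> r \<notin> psum ` {1..length ns}"
    proof -
      have "simple_root n r \<in> simple_roots n" using r by (simp add: simple_roots_def)
      then have "simple_root n r \<in> I \<longleftrightarrow> simple_root n r \<notin> simple_root n ` psum ` {1..length ns}"
        using diff by blast
      also have "\<dots> \<longleftrightarrow> r \<notin> psum ` {1..length ns}"
        using inj_on_image_mem_iff[OF simple_root_inj _ psum_range, of r] r by simp
      finally show ?thesis .
    qed
    also have "\<dots> \<longleftrightarrow> ?A (r - 1) = ?A r"
    proof
      assume "r \<notin> psum ` {1..length ns}"
      then have "psum t \<le> r - 1 \<longleftrightarrow> psum t \<le> r" if "t \<in> {1..length ns}" for t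
        using that by (cases "psum t = r") auto
      then show "?A (r - 1) = ?A r" by auto
    next
      assume eq: "?A (r - 1) = ?A r"
      have "psum t \<noteq> r" if "t \<in> {1..length ns}" for t
      proof
        assume "psum t = r"
        then have "t \<in> ?A (r - 1)" unfolding eq using that by simp
        then have "psum t \<le> r - 1" by simp
        then show False using \<open>psum t = r\<close> r(1) by linarith
      qed
      then show "r \<notin> psum ` {1..length ns}" by blast
    qed
    also have "\<dots> \<longleftrightarrow> card (?A (r - 1)) = card (?A r)"
      using card_subset_eq[OF _ sub] by auto
    also have "\<dots> \<longleftrightarrow> blk (r - 1) = blk r" using blk r by simp
    finally show ?thesis .
  qed
  show "parabolic_blocks n I blk (2 * length ns)"
    using I blk_mono blk_reflect cut by unfold_locales (simp_all add: n)
qed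

section \<open>Reading off the partition\<close>

text \<open>Both sides say that the box in row \<open>j\<close> and column \<open>i\<close> belongs
  to the diagram.\<close>

lemma le_part_iff:
  assumes "sorted_wrt (\<ge>) p" and "1 \<le> i" and "1 \<le> j"
  shows "i \<le> part p j \<longleftrightarrow> j \<le> length (filter (\<lambda>x. i \<le> x) p)"
proof -
  let ?F = "{k. k < length p \<and> i \<le> p ! k}"
  have len: "length (filter (\<lambda>x. i \<le> x) p) = card ?F" by (rule length_filter_conv_card)
  show ?thesis
  proof
    assume le: "i \<le> part p j"
    then have j: "j \<le> length p" using assms(2) by (auto simp: part_def split: if_splits)
    have "{..<j} \<subseteq> ?F"
    proof
      fix k assume "k \<in> {..<j}"
      then have "part p j \<le> part p (Suc k)" by (intro part_antimono[OF assms(1)]) auto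
      then show "k \<in> ?F" using le j \<open>k \<in> {..<j}\<close> by (simp add: part_def)
    qed
    then have "card {..<j} \<le> card ?F" by (intro card_mono) auto
    then show "j \<le> length (filter (\<lambda>x. i \<le> x) p)" using len by simp
  next
    assume j: "j \<le> length (filter (\<lambda>x. i \<le> x) p)"
    show "i \<le> part p j"
    proof (rule ccontr)
      assume "\<not> i \<le> part p j"
      have "?F \<subseteq> {..<j - 1}"
      proof
        fix k assume k: "k \<in> ?F"
        have "k < j - 1"
        proof (rule ccontr)
          assume "\<not> k < j - 1"
          then have "part p (Suc k) \<le> part p j" by (intro part_antimono[OF assms(1,3)]) auto
          then show False using k \<open>\<not> i \<le> part p j\<close> by (simp add: part_def)
        qed
        then show "k \<in> {..<j - 1}" by simp
      qed
      then have "card ?F \<le> card {..<j - 1}" by (intro card_mono) auto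
      then show False using j len assms(3) by simp
    qed
  qed
qed

lemma part_eq_transpose:
  assumes p: "sorted_wrt (\<ge>) p" and j: "1 \<le> j"
  shows "part p j = length (filter (\<lambda>c. j \<le> c) (transpose_partition p))"
proof -
  let ?M = "foldr max p 0"
  have max: "x \<le> ?M" if "x \<in> set p" for x using that by (induction p) auto
  have "part p j \<le> ?M" using max[of "p ! (j - 1)"] j by (auto simp: part_def)
  have "length (filter (\<lambda>c. j \<le> c) (transpose_partition p))
      = length (filter (\<lambda>i. j \<le> length (filter (\<lambda>x. i \<le> x) p)) [1..<Suc ?M])"
    by (simp add: transpose_partition_def filter_map o_def del: upt_Suc)
  also have "\<dots> = card (set (filter (\<lambda>i. j \<le> length (filter (\<lambda>x. i \<le> x) p)) [1..<Suc ?M]))"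
    by (rule distinct_card[symmetric]) (rule distinct_filter, rule distinct_upt)
  also have "set (filter (\<lambda>i. j \<le> length (filter (\<lambda>x. i \<le> x) p)) [1..<Suc ?M]) = {1..part p j}"
    using \<open>part p j \<le> ?M\<close> le_part_iff[OF p _ j] by (auto simp: less_Suc_eq_le)
  finally show ?thesis by simp
qed

lemma Z_diagram_part:
  assumes Z: "Z_diagram a bs p" and j: "1 \<le> j"
  shows "part p j = (if j \<le> 2*a then 1 else 0) + 2 * length (filter (\<lambda>x. j \<le> x) bs)"
proof -
  have p: "sorted_wrt (\<ge>) p" using Z by (simp add: Z_diagram_def partition_of_def)
  have "part p j = size (filter_mset (\<lambda>c. j \<le> c) (mset (transpose_partition p)))"
    using part_eq_transpose[OF p j] by (simp flip: size_mset mset_filter)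
  also have "mset (transpose_partition p) = filter_mset (\<lambda>c. 0 < c) ({#2*a#} + mset bs + mset bs)"
    using Z by (simp add: Z_diagram_def)
  also have "filter_mset (\<lambda>c. j \<le> c) \<dots> = filter_mset (\<lambda>c. j \<le> c) ({#2*a#} + mset bs + mset bs)"
  proof -
    have "(\<lambda>c. 0 < c \<and> j \<le> c) = (\<lambda>c. j \<le> c)" using j by auto
    then show ?thesis unfolding filter_filter_mset by simp
  qed
  also have "size \<dots> = (if j \<le> 2*a then 1 else 0) + 2 * size (filter_mset (\<lambda>x. j \<le> x) (mset bs))"
    by simp
  also have "size (filter_mset (\<lambda>x. j \<le> x) (mset bs)) = length (filter (\<lambda>x. j \<le> x) bs)"
    by (simp flip: size_mset mset_filter)
  finally show ?thesis .
qed

context composition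
begin

text \<open>The extra box in row \<open>2*m + 1\<close> lengthens the column of length
  \<open>2*m\<close> to \<open>2*m + 1\<close>, the size of the middle block, so that the columns
  become the block sizes.\<close>

lemma Z_diagram_shape:
  assumes Z: "Z_diagram m ns p"
  defines "P \<equiv> take (2*m) p @ [part p (2*m+1) + 1] @ drop (2*m+1) p"
  shows "partition_of (2 * rk + 1) P"
    and "1 \<le> j \<Longrightarrow> part P j = (if j \<le> 2*m + 1 then 1 else 0) + 2 * length (filter (\<lambda>x. j \<le> x) ns)"
proof -
  note part_p = Z_diagram_part[OF Z]
  have pos_p: "\<forall>x\<in>set p. 0 < x" using Z by (simp add: Z_diagram_def partition_of_def)
  \<comment> \<open>The column of length \<open>2*m\<close> guarantees that many rows, so
    \<open>take\<close> is not cut short and the extra box lands in row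
    \<open>2*m + 1\<close>.\<close>
  have len: "2*m \<le> length p"
  proof (rule ccontr)
    assume "\<not> 2*m \<le> length p"
    then have "part p (2*m) = 0" "1 \<le> 2*m" by (auto simp: part_def)
    then show False using part_p[of "2*m"] by simp
  qed
  have PP: "part P j = part p j + (if j = 2*m + 1 then 1 else 0)" if j: "1 \<le> j" for j
  proof -
    consider "j \<le> 2*m" | "j = 2*m + 1" | "2*m + 1 < j" by linarith
    then show ?thesis
    proof cases
      case 1
      then have "j - 1 < 2*m" using j by linarith
      then show ?thesis using 1 len j by (simp add: P_def part_def nth_append)
    next
      case 2
      then show ?thesis using len by (simp add: P_def part_def nth_append)
    next
      case 3
      then obtain k where k: "j = 2*m + 2 + k" using le_Suc_ex[of "2*m + 2" j] by auto
      then show ?thesis using len by (auto simp: P_def part_def nth_append)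
    qed
  qed
  show cols: "part P j = (if j \<le> 2*m + 1 then 1 else 0) + 2 * length (filter (\<lambda>x. j \<le> x) ns)"
    if "1 \<le> j" for j
    using PP[OF that] part_p[OF that] by auto
  have anti: "part P k \<le> part P j" if "1 \<le> j" "j \<le> k" for j k
  proof -
    have "length (filter (\<lambda>x. k \<le> x) ns) \<le> length (filter (\<lambda>x. j \<le> x) ns)"
      using that by (induction ns) auto
    then show ?thesis using cols[of j] cols[of k] that by auto
  qed
  have "sorted_wrt (\<ge>) P"
    unfolding sorted_wrt_iff_nth_less
  proof (intro allI impI)
    fix i j assume "i < j" "j < length P"
    then show "P ! j \<le> P ! i" using anti[of "Suc i" "Suc j"] by (simp add: part_def)
  qed
  moreover have "\<forall>x\<in>set P. 0 < x"
    using pos_p by (auto simp: P_def dest: in_set_takeD in_set_dropD)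
  moreover have "sum_list P = 2 * rk + 1"
  proof -
    \<comment> \<open>A bound for the number of rows and for every column length; at this value all
      the minima disappear.\<close>
    let ?q = "length P + (2*m + 1) + sum_list ns"
    have q: "length P \<le> ?q" "2*m + 1 \<le> ?q" by simp_all
    have ns_le: "x \<le> ?q" if "x \<in> set ns" for x using member_le_sum_list[of x ns] that by simp
    have "sum_list P = (\<Sum>j = 1..?q. part P j)"
      using excess_eq_sum_part[OF q(1), of 0] by (simp add: excess_def)
    also have "\<dots> = min (2*m + 1) ?q + 2 * (\<Sum>x\<leftarrow>ns. min x ?q)"
      by (rule sum_part_columns[OF cols])
    also have "min (2*m + 1) ?q = 2*m + 1" using q(2) by (rule min_absorb1)
    also have "map (\<lambda>x. min x ?q) ns = ns" using ns_le by (intro map_idI) (simp add: min_absorb1)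
    finally show ?thesis by (simp add: rk_def)
  qed
  ultimately show "partition_of (2 * rk + 1) P" by (simp add: partition_of_def)
qed

end

section \<open>The Jordan type of the Richardson orbit\<close>

lemma adjoint_orbit_similar:
  assumes "X \<in> adjoint_orbit n Z" and "Z \<in> so_odd n"
  shows "similar_mat X Z"
proof -
  obtain g h where g: "g \<in> SO_odd n" and h: "h \<in> SO_odd n" and gh: "g * h = 1\<^sub>m (2*n+1)" and X: "X = g * Z * h"
    using assms(1) unfolding adjoint_orbit_def by blast
  have c: "g \<in> carrier_mat (2*n+1) (2*n+1)" "h \<in> carrier_mat (2*n+1) (2*n+1)"
    using g h by (simp_all add: SO_odd_def)
  note Z = so_odd_carrier[OF assms(2)]
  have XZ: "X \<in> carrier_mat (2*n+1) (2*n+1)" unfolding X using c Z by (intro mult_carrier_mat)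
  show ?thesis
    by (rule similar_matI[of X Z g h "2*n+1"])
      (use c Z XZ gh mat_mult_left_right_inverse[OF c gh] X in simp_all)
qed

theorem theorem6p4:
  fixes n s m\<^sub>s :: nat and ns ms p :: "nat list"
    and I :: "complex vec set" and \<O> :: "complex mat set"
  assumes "parabolic_type n I ns"
    and "Z_diagram (last ns) (butlast ns) p"
    and "mset ms = mset ns"
    and "1 \<le> s" and "s \<le> length ms" and "m\<^sub>s = ms ! (s - 1)" and "m\<^sub>s = last ns"
    and "sorted_wrt (\<ge>) (column_sequence s ms)"
    and "transpose_partition p = filter (\<lambda>c. 0 < c) (column_sequence s ms)"
    and "richardson_orbit n (standard_parabolic n I) \<O>"
  shows "orbit_partition \<O>
    (B_collapse n (take (2*m\<^sub>s) p @ [part p (2*m\<^sub>s+1) + 1] @ drop (2*m\<^sub>s+1) p))"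
proof -
  let ?N = "2*n + 1"
  interpret composition "butlast ns" m\<^sub>s
    using assms(1) by unfold_locales (simp add: parabolic_type_def)
  note type = parabolic_blocks_blk[OF assms(1) HOL.refl assms(7)[symmetric]]
  have n: "n = rk" by (rule type(1))
  interpret parabolic_blocks n I blk "2 * length (butlast ns)" by (rule type(2))
  define P where "P = take (2*m\<^sub>s) p @ [part p (2*m\<^sub>s+1) + 1] @ drop (2*m\<^sub>s+1) p"
  have Z: "Z_diagram m\<^sub>s (butlast ns) p" using assms(2,7) by simp
  note shape = Z_diagram_shape[OF Z, folded P_def]
  have P: "partition_of ?N P" using shape(1) by (simp add: n)
  then have sP: "sorted_wrt (\<ge>) P" by (simp add: partition_of_def)
  define U where "U = block_nilpotent n blk"
  have Uc: "U \<subseteq> carrier_mat ?N ?N" using so_odd_carrier by (auto simp: U_def block_nilpotent_def)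
  note rich = assms(10)[unfolded richardson_orbit_def Let_def nilradical_eq, folded U_def]
  note orbit = rich[THEN conjunct1] and cl = rich[THEN conjunct2, THEN conjunct2]
  obtain Z where Z: "Z \<in> so_odd n" "\<O> = adjoint_orbit n Z"
    using orbit unfolding nilpotent_orbit_def by blast
  \<comment> \<open>Density is applied to a rank condition on the zeroth power, which every element
    shares; this produces a point of the orbit inside \<open>U\<close>.\<close>
  obtain Y r where "Y \<in> U" "rank_ge (Y ^\<^sub>m 0) r"
    using block_nilpotent_rank_ge[OF shape(2)] unfolding U_def n by metis
  then obtain X where X: "X \<in> \<O>" "X \<in> U" using closure_rank_ge[OF Uc cl] by (metis IntE)
  have Xso: "X \<in> so_odd n" using X(2) by (simp add: U_def block_nilpotent_def)
  note Xc = so_odd_carrier[OF Xso]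
  have "X $$ (i, j) = 0" if "i < ?N" "j \<le> i" for i j
    using X(2) that blk_mono[of j i] by (simp add: U_def block_nilpotent_def)
  then obtain d where d: "partition_of ?N d" and nf: "jordan_nf X (map (\<lambda>r. (r, 0)) d)"
    using strictly_upper_triangular_jordan[OF Xc] by metis
  have nf_orbit: "jordan_nf X' (map (\<lambda>r. (r, 0)) d)" if "X' \<in> \<O>" for X'
  proof (rule jordan_nf_similar[OF nf])
    have "similar_mat X' Z" "similar_mat X Z"
      using adjoint_orbit_similar[OF _ Z(1)] that X(1) Z(2) by auto
    then show "similar_mat X' X" using similar_mat_trans similar_mat_sym by metis
  qed
  have B: "B_partition n d"
    unfolding B_partition_iff_excess[OF d]
    using so_odd_pow_rank_even[OF Xso] jordan_nf_rank_pow[OF Xc nf] by blast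
  have upper: "excess i d \<le> excess i P" for i
  proof (rule rank_ge_le)
    show "rank_ge (X ^\<^sub>m i) (excess i d)" by (rule jordan_nf_rank_pow(1)[OF Xc nf])
    show "rank_le (X ^\<^sub>m i) (excess i P)"
      using block_nilpotent_rank_le[OF sP shape(2)] X(2) by (simp add: U_def n)
  qed
  \<comment> \<open>The test element changes with \<open>i\<close> and \<open>q\<close>, and so does
    the orbit element \<open>X'\<close> found near it, but its Jordan type is always
    \<open>d\<close>.\<close>
  have lower: "(\<Sum>j = 1..q. part P j) \<le> excess i d + i * q + (if odd q \<or> q \<le> 2*m\<^sub>s + 1 then 0 else 1)" for i q
  proof -
    obtain Y r where Y: "Y \<in> U" "rank_ge (Y ^\<^sub>m i) r"
      and le: "(\<Sum>j = 1..q. part P j) \<le> r + i * q + (if odd q \<or> q \<le> 2*m\<^sub>s + 1 then 0 else 1)"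
      using block_nilpotent_rank_ge[OF shape(2), of i q] unfolding U_def n by metis
    obtain X' where X': "X' \<in> \<O>" "X' \<in> U" "rank_ge (X' ^\<^sub>m i) r"
      using closure_rank_ge[OF Uc cl Y] by (metis IntE)
    have "X' \<in> carrier_mat ?N ?N" using X'(2) Uc by (rule rev_subsetD)
    then have "r \<le> excess i d" using rank_ge_le[OF X'(3)] jordan_nf_rank_pow(2) nf_orbit[OF X'(1)] by metis
    then show ?thesis using le by linarith
  qed
  have "B_collapse n P = d"
  proof (rule B_collapse_criterion[OF P shape(2) B upper])
    show "(\<Sum>j = 1..q. part P j) \<le> excess i d + i * q" if "odd q \<or> q \<le> 2*m\<^sub>s + 1" for i q
      using lower[of q i] that by simp
    show "(\<Sum>j = 1..q. part P j) \<le> excess i d + i * q + 1" for i q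
      using lower[of q i] by (simp split: if_splits)
  qed
  then show ?thesis using nf_orbit by (simp add: orbit_partition_def P_def)
qed


end
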